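(* Let $L$ be a binary $\mathbb{Z}$-lattice on a positive definite quadratic space over $\mathbb{Q}$ such that $-4d_L$ is the discriminant of the imaginary quadratic field $F=\mathbb{Q}(\sqrt{-4d_L})$. Then, as Dirichlet series, \[ \zeta^{\mathrm{SL}}_L(s) = \frac{2}{|\mathcal{O}_F^{\times}|} \frac{\zeta(s)\zeta(s-1)}{\zeta_{F}(s)} \left( \sum_{n=1}^{\infty} \frac{ \# \{ [J]\in \mathrm{Cl}_F: J \le \mathcal{O}_F, \, N(J)=n\} }{n^{s}} \right) + \frac{|\mathcal{O}_F^{\times}| - 2}{|\mathcal{O}_F^{\times}|} \left(\prod_{p\ \text{split in } F} (1-p^{-s}) \right) \zeta_{F}(s), \] where $J$ ranges over nonzero ideals of $\mathcal{O}_F$ and the product runs over all rational primes $p$ that split in $F$.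
   Context: $V$ is a positive definite quadratic space over $\mathbb{Q}$ with symmetric bilinear form $B$ and quadratic form $Q(x)=B(x,x)$. A $\mathbb{Z}$-lattice $L$ on $V$ is the $\mathbb{Z}$-span of a basis $e_1,\dots,e_n$ of $V$, with $Q(L)\subseteq\mathbb{Z}$; its discriminant is $d_L=\det(B(e_i,e_j))$. $O(V)$ is the orthogonal group of $V$ and $O^+(V)=O(V)\cap \mathrm{SL}(V)$. For $m\ge1$, $a_m^+(L)$ is the number of $O^+(V)$-orbits-equivalence classes (i.e. classes under $K_1\sim K_2 \iff \sigma(K_1)=K_2$ for some $\sigma\in O^+(V)$) among the sublattices $K\subseteq L$ with $|L:K|=m$, and $\zeta^{\mathrm{SL}}_L(s)=\sum_{m\ge1}a_m^+(L)m^{-s}$. For the imaginary quadratic field $F$: $\mathcal{O}_F$ is its ring of integers, $\mathcal{O}_F^\times$ its unit group, $\mathrm{Cl}_F$ its ideal class group, $[J]$ the class of $J$, $N(J)=|\mathcal{O}_F:J|$, and $\zeta_F(s)=\sum_{\mathfrak{a}\le\mathcal{O}_F}N(\mathfrak{a})^{-s}$ the Dedekind zeta function; $\zeta$ is the Riemann zeta function. *)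

theory Defs
  imports
    "Jordan_Normal_Form.Determinant"
    "HOL-Algebra.Ideal_Product"
    "HOL-Algebra.QuotRing"
    "HOL-Computational_Algebra.Computational_Algebra"
begin

section \<open>Bases, lattices and endomorphisms\<close>

text \<open>Vector spaces over the rationals are given by their scalar multiplication, as in
  \<^locale>\<open>vector_space\<close>. Ordered bases are lists, so that the dimension is the length of a basis;
  \<open>W\<close> is the subspace spanned by the basis.\<close>

definition basis_of :: "(rat \<Rightarrow> 'v \<Rightarrow> 'v) \<Rightarrow> 'v set \<Rightarrow> 'v::ab_group_add list \<Rightarrow> bool" where
  "basis_of scale W e \<longleftrightarrow>
     distinct e \<and> \<not> module.dependent scale (set e) \<and> module.span scale (set e) = W"

definition int_span :: "(rat \<Rightarrow> 'v \<Rightarrow> 'v) \<Rightarrow> 'v::ab_group_add list \<Rightarrow> 'v set" where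
  "int_span scale e = range (\<lambda>c :: nat \<Rightarrow> int. \<Sum>i<length e. scale (of_int (c i)) (e ! i))"

definition gram_det :: "('v \<Rightarrow> 'v \<Rightarrow> rat) \<Rightarrow> 'v list \<Rightarrow> rat" where
  "gram_det B e = det (mat (length e) (length e) (\<lambda>(i, j). B (e ! i) (e ! j)))"

definition matrix_of :: "(rat \<Rightarrow> 'v \<Rightarrow> 'v) \<Rightarrow> 'v::ab_group_add list \<Rightarrow> ('v \<Rightarrow> 'v) \<Rightarrow> rat mat" where
  "matrix_of scale e f = mat (length e) (length e)
     (\<lambda>(i, j). module.representation scale (set e) (f (e ! j)) (e ! i))"

text \<open>Determinant and trace of an endomorphism of the finite-dimensional space \<open>W\<close>; they do not
  depend on the chosen basis.\<close>

definition endo_det :: "(rat \<Rightarrow> 'v \<Rightarrow> 'v) \<Rightarrow> 'v::ab_group_add set \<Rightarrow> ('v \<Rightarrow> 'v) \<Rightarrow> rat" where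
  "endo_det scale W f = det (matrix_of scale (SOME e. basis_of scale W e) f)"

definition endo_trace :: "(rat \<Rightarrow> 'v \<Rightarrow> 'v) \<Rightarrow> 'v::ab_group_add set \<Rightarrow> ('v \<Rightarrow> 'v) \<Rightarrow> rat" where
  "endo_trace scale W f = sum_list (diag_mat (matrix_of scale (SOME e. basis_of scale W e) f))"


section \<open>Positive definite quadratic spaces\<close>

locale pos_def_quadratic_space = vector_space scale
  for scale :: "rat \<Rightarrow> 'v::ab_group_add \<Rightarrow> 'v" +
  fixes B :: "'v \<Rightarrow> 'v \<Rightarrow> rat"
  assumes B_sym: "B x y = B y x"
    and B_add: "B (x + y) z = B x z + B y z"
    and B_scale: "B (scale a x) y = a * B x y"
    and B_pos: "x \<noteq> 0 \<Longrightarrow> B x x > 0"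

definition orthogonal_group ::
    "(rat \<Rightarrow> 'v \<Rightarrow> 'v) \<Rightarrow> ('v \<Rightarrow> 'v \<Rightarrow> rat) \<Rightarrow> ('v::ab_group_add \<Rightarrow> 'v) set" where
  "orthogonal_group scale B =
     {\<sigma>. Vector_Spaces.linear scale scale \<sigma> \<and> bij \<sigma> \<and> (\<forall>x y. B (\<sigma> x) (\<sigma> y) = B x y)}"

definition special_orthogonal_group ::
    "(rat \<Rightarrow> 'v \<Rightarrow> 'v) \<Rightarrow> ('v \<Rightarrow> 'v \<Rightarrow> rat) \<Rightarrow> ('v::ab_group_add \<Rightarrow> 'v) set" where
  "special_orthogonal_group scale B =
     {\<sigma> \<in> orthogonal_group scale B. endo_det scale UNIV \<sigma> = 1}"

text \<open>A \<open>\<int>\<close>-lattice on the whole space, with integral quadratic form.\<close>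

definition zlattice ::
    "(rat \<Rightarrow> 'v \<Rightarrow> 'v) \<Rightarrow> ('v \<Rightarrow> 'v \<Rightarrow> rat) \<Rightarrow> 'v::ab_group_add set \<Rightarrow> bool" where
  "zlattice scale B L \<longleftrightarrow>
     (\<exists>e. basis_of scale UNIV e \<and> L = int_span scale e) \<and> (\<forall>x\<in>L. B x x \<in> \<int>)"

text \<open>The index is the number of cosets; it is \<open>0\<close> if there are infinitely many.\<close>

definition lattice_index :: "'v::ab_group_add set \<Rightarrow> 'v set \<Rightarrow> nat" where
  "lattice_index L K = card ((\<lambda>x. (+) x ` K) ` L)"

definition sublattices ::
    "(rat \<Rightarrow> 'v \<Rightarrow> 'v) \<Rightarrow> ('v \<Rightarrow> 'v \<Rightarrow> rat) \<Rightarrow> 'v::ab_group_add set \<Rightarrow> nat \<Rightarrow> 'v set set" where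
  "sublattices scale B L m = {K. zlattice scale B K \<and> K \<subseteq> L \<and> lattice_index L K = m}"

definition num_SL_classes ::
    "(rat \<Rightarrow> 'v \<Rightarrow> 'v) \<Rightarrow> ('v \<Rightarrow> 'v \<Rightarrow> rat) \<Rightarrow> 'v::ab_group_add set \<Rightarrow> nat \<Rightarrow> nat" where
  "num_SL_classes scale B L m =
     card (sublattices scale B L m //
       {(K1, K2) \<in> sublattices scale B L m \<times> sublattices scale B L m.
          \<exists>\<sigma>\<in>special_orthogonal_group scale B. \<sigma> ` K1 = K2})"


section \<open>Number fields inside the complex numbers\<close>

text \<open>A field \<open>F\<close> and its subrings are subsets of \<^typ>\<open>complex\<close>, viewed as ring records.\<close>

definition subring_of_complex :: "complex set \<Rightarrow> complex ring" where
  "subring_of_complex R = \<lparr>carrier = R, mult = (*), one = 1, zero = 0, add = (+)\<rparr>"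

definition quadratic_field :: "rat \<Rightarrow> complex set" where
  "quadratic_field D = {of_rat a + of_rat b * csqrt (of_rat D) | a b. True}"

definition ring_of_integers :: "complex set \<Rightarrow> complex set" where
  "ring_of_integers F = {x \<in> F. algebraic_int x}"

abbreviation int_ring :: "complex set \<Rightarrow> complex ring" where
  "int_ring F \<equiv> subring_of_complex (ring_of_integers F)"

definition unit_count :: "complex set \<Rightarrow> nat" where
  "unit_count F = card (Units (int_ring F))"

abbreviation rat_scale :: "rat \<Rightarrow> complex \<Rightarrow> complex" where
  "rat_scale q z \<equiv> of_rat q * z"

definition field_trace :: "complex set \<Rightarrow> complex \<Rightarrow> rat" where
  "field_trace F x = endo_trace rat_scale F (\<lambda>y. x * y)"

text \<open>\<open>D\<close> is the discriminant of \<open>F\<close>: the determinant of the trace form with respect to an integral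
  basis (any two integral bases give the same value).\<close>

definition is_field_discriminant :: "complex set \<Rightarrow> rat \<Rightarrow> bool" where
  "is_field_discriminant F D \<longleftrightarrow>
     (\<exists>w. basis_of rat_scale F w \<and> int_span rat_scale w = ring_of_integers F \<and>
          gram_det (\<lambda>x y. field_trace F (x * y)) w = D)"

definition nonzero_ideals :: "complex set \<Rightarrow> complex set set" where
  "nonzero_ideals F = {J. ideal J (int_ring F) \<and> J \<noteq> {0}}"

definition ideal_norm :: "complex set \<Rightarrow> complex set \<Rightarrow> nat" where
  "ideal_norm F J = order (int_ring F Quot J)"

definition fractional_ideals :: "complex set \<Rightarrow> complex set set" where
  "fractional_ideals F =
     {I. I \<subseteq> F \<and> (\<exists>a\<in>ring_of_integers F - {0}. (*) a ` I \<in> nonzero_ideals F)}"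

definition fractional_ideal_group :: "complex set \<Rightarrow> complex set monoid" where
  "fractional_ideal_group F =
     \<lparr>carrier = fractional_ideals F,
      mult = ideal_prod (subring_of_complex F),
      one = ring_of_integers F\<rparr>"

definition principal_fractional_ideals :: "complex set \<Rightarrow> complex set set" where
  "principal_fractional_ideals F = (\<lambda>a. (*) a ` ring_of_integers F) ` (F - {0})"

definition class_group :: "complex set \<Rightarrow> complex set set monoid" where
  "class_group F = fractional_ideal_group F Mod principal_fractional_ideals F"

definition ideal_class :: "complex set \<Rightarrow> complex set \<Rightarrow> complex set set" where
  "ideal_class F J = principal_fractional_ideals F #>\<^bsub>fractional_ideal_group F\<^esub> J"

text \<open>Splitting of a rational prime in a quadratic field: \<open>(p) = P Q\<close> with distinct primes.\<close>

definition splits_in :: "nat \<Rightarrow> complex set \<Rightarrow> bool" where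
  "splits_in p F \<longleftrightarrow>
     (\<exists>P Q. primeideal P (int_ring F) \<and> primeideal Q (int_ring F) \<and> P \<noteq> Q \<and>
            P \<cdot>\<^bsub>int_ring F\<^esub> Q = PIdl\<^bsub>int_ring F\<^esub> (of_nat p))"


section \<open>Formal Dirichlet series\<close>

text \<open>The series with coefficients \<open>f 1, f 2, \<dots>\<close> is represented by the sequence \<open>f\<close> with the
  convention \<open>f 0 = 0\<close>.\<close>

typedef dirichlet_series = "{f :: nat \<Rightarrow> complex. f 0 = 0}"
  morphisms ds_coeff Abs_dirichlet_series
  by auto

setup_lifting type_definition_dirichlet_series

lift_definition dirichlet :: "(nat \<Rightarrow> complex) \<Rightarrow> dirichlet_series"
  is "\<lambda>f n. if n = 0 then 0 else f n"
  by simp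

lemma ds_coeff_dirichlet: "ds_coeff (dirichlet f) n = (if n = 0 then 0 else f n)"
  by transfer simp

lemma ds_coeff_0 [simp]: "ds_coeff f 0 = 0"
  by transfer simp

lemma ds_eqI: "(\<And>n. n > 0 \<Longrightarrow> ds_coeff f n = ds_coeff g n) \<Longrightarrow> f = g"
proof -
  assume *: "\<And>n. n > 0 \<Longrightarrow> ds_coeff f n = ds_coeff g n"
  have "ds_coeff f n = ds_coeff g n" for n
    using *[of n] by (cases "n = 0") simp_all
  then show "f = g"
    by (simp add: ds_coeff_inject[symmetric] fun_eq_iff)
qed

instantiation dirichlet_series :: comm_ring_1
begin

lift_definition zero_dirichlet_series :: dirichlet_series is "\<lambda>_. 0" by simp

lift_definition one_dirichlet_series :: dirichlet_series is "\<lambda>n. if n = 1 then 1 else 0" by simp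

lift_definition plus_dirichlet_series ::
    "dirichlet_series \<Rightarrow> dirichlet_series \<Rightarrow> dirichlet_series"
  is "\<lambda>f g n. f n + g n" by simp

lift_definition minus_dirichlet_series ::
    "dirichlet_series \<Rightarrow> dirichlet_series \<Rightarrow> dirichlet_series"
  is "\<lambda>f g n. f n - g n" by simp

lift_definition uminus_dirichlet_series :: "dirichlet_series \<Rightarrow> dirichlet_series"
  is "\<lambda>f n. - f n" by simp

lift_definition times_dirichlet_series ::
    "dirichlet_series \<Rightarrow> dirichlet_series \<Rightarrow> dirichlet_series"
  is "\<lambda>f g n. \<Sum>d | d dvd n. f d * g (n div d)"
  by simp

lemma ds_coeff_times:
  assumes "n > 0"
  shows "ds_coeff (f * g) n = (\<Sum>(d, e) | d * e = n. ds_coeff f d * ds_coeff g e)"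
  unfolding times_dirichlet_series.rep_eq
  by (rule sum.reindex_bij_witness[of _ fst "\<lambda>d. (d, n div d)"]) (use assms in auto)

lemma finite_factor_pairs: "finite {p. fst p * snd p = (n :: nat)}" if "n > 0"
proof (rule finite_subset)
  show "{p. fst p * snd p = n} \<subseteq> {d. d dvd n} \<times> {d. d dvd n}"
    by auto
  show "finite ({d. d dvd n} \<times> {d. d dvd n})"
    using that by simp
qed

lemma ds_coeff_times':
  "n > 0 \<Longrightarrow> ds_coeff (f * g) n =
     (\<Sum>x | fst x * snd x = n. ds_coeff f (fst x) * ds_coeff g (snd x))"
  using ds_coeff_times[of n f g] by (simp add: case_prod_unfold)

instance
proof
  fix a b c :: dirichlet_series
  show "a * b * c = a * (b * c)"
  proof (rule ds_eqI)
    fix n :: nat assume n: "n > 0"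
    have pos: "fst x > 0" "snd x > 0" if "fst x * snd x = n" for x
      using n that by (auto intro: Nat.gr0I)
    have "ds_coeff (a * b * c) n = (\<Sum>x | fst x * snd x = n. \<Sum>y | fst y * snd y = fst x.
        ds_coeff a (fst y) * ds_coeff b (snd y) * ds_coeff c (snd x))"
      unfolding ds_coeff_times'[OF n, of "a * b"]
      by (intro sum.cong refl) (simp add: ds_coeff_times' pos sum_distrib_right)
    also have "\<dots> = (\<Sum>(x, y)\<in>(SIGMA x:{x. fst x * snd x = n}. {y. fst y * snd y = fst x}).
        ds_coeff a (fst y) * ds_coeff b (snd y) * ds_coeff c (snd x))"
      by (rule sum.Sigma) (use n pos in \<open>simp_all add: finite_factor_pairs\<close>)
    also have "\<dots> = (\<Sum>(x, y)\<in>(SIGMA x:{x. fst x * snd x = n}. {y. fst y * snd y = snd x}).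
        ds_coeff a (fst x) * (ds_coeff b (fst y) * ds_coeff c (snd y)))"
      by (rule sum.reindex_bij_witness[of _
            "\<lambda>((d, _), (e, r)). ((d * e, r), (d, e))" "\<lambda>((_, r), (d, e)). ((d, e * r), (e, r))"])
         auto
    also have "\<dots> = (\<Sum>x | fst x * snd x = n. \<Sum>y | fst y * snd y = snd x.
        ds_coeff a (fst x) * (ds_coeff b (fst y) * ds_coeff c (snd y)))"
      by (rule sum.Sigma[symmetric]) (use n pos in \<open>simp_all add: finite_factor_pairs\<close>)
    also have "\<dots> = ds_coeff (a * (b * c)) n"
      unfolding ds_coeff_times'[OF n, of a]
      by (intro sum.cong refl) (simp add: ds_coeff_times' pos sum_distrib_left)
    finally show "ds_coeff (a * b * c) n = ds_coeff (a * (b * c)) n" .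
  qed
  show "a * b = b * a"
  proof (rule ds_eqI)
    fix n :: nat assume n: "n > 0"
    show "ds_coeff (a * b) n = ds_coeff (b * a) n"
      unfolding ds_coeff_times[OF n]
      by (rule sum.reindex_bij_witness[of _ prod.swap prod.swap]) (auto simp: mult_ac)
  qed
  show "1 * a = a"
  proof (rule ds_eqI)
    fix n :: nat assume n: "n > 0"
    have "ds_coeff (1 * a) n = (\<Sum>d | d dvd n. if d = 1 then ds_coeff a n else 0)"
      unfolding times_dirichlet_series.rep_eq one_dirichlet_series.rep_eq
      by (intro sum.cong) auto
    also have "\<dots> = ds_coeff a n"
      using n by simp
    finally show "ds_coeff (1 * a) n = ds_coeff a n" .
  qed
  show "(a + b) * c = a * c + b * c"
    by (rule ds_eqI)
       (simp add: times_dirichlet_series.rep_eq plus_dirichlet_series.rep_eq sum.distrib distrib_right)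
  show "(0 :: dirichlet_series) \<noteq> 1"
    by (simp add: ds_coeff_inject[symmetric] zero_dirichlet_series.rep_eq
        one_dirichlet_series.rep_eq fun_eq_iff)
qed (simp_all add: ds_coeff_inject[symmetric] zero_dirichlet_series.rep_eq
      plus_dirichlet_series.rep_eq minus_dirichlet_series.rep_eq
      uminus_dirichlet_series.rep_eq fun_eq_iff)

end

text \<open>The inverse in the ring of Dirichlet series, where it exists, and \<open>0\<close> otherwise.\<close>

instantiation dirichlet_series :: inverse
begin

definition inverse_dirichlet_series :: "dirichlet_series \<Rightarrow> dirichlet_series" where
  "inverse_dirichlet_series f = (if f dvd 1 then THE g. f * g = 1 else 0)"

definition divide_dirichlet_series ::
    "dirichlet_series \<Rightarrow> dirichlet_series \<Rightarrow> dirichlet_series" where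
  "divide_dirichlet_series f g = f * inverse g"

instance ..

end

lemma ds_times_inverse:
  fixes f :: dirichlet_series
  assumes "f dvd 1"
  shows "f * inverse f = 1"
proof -
  obtain g where g: "f * g = 1"
    using assms by (metis dvdE)
  have "h = g" if "f * h = 1" for h
    using g that by (metis mult.assoc mult.commute mult_1)
  with g have "\<exists>!h. f * h = 1"
    by blast
  from theI'[OF this] show ?thesis
    using assms by (simp add: inverse_dirichlet_series_def)
qed

definition ds_const :: "complex \<Rightarrow> dirichlet_series" where
  "ds_const c = dirichlet (\<lambda>n. if n = 1 then c else 0)"

text \<open>The Dirichlet series \<open>n\<^sup>-\<^sup>s\<close>.\<close>

definition ds_npow :: "nat \<Rightarrow> dirichlet_series" where
  "ds_npow n = dirichlet (\<lambda>k. if k = n then 1 else 0)"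

text \<open>\<open>f(s - 1)\<close> has the coefficients \<open>n f\<^sub>n\<close>, because \<open>n\<^bsup>-(s - 1)\<^esup> = n n\<^sup>-\<^sup>s\<close>.\<close>

definition ds_shift1 :: "dirichlet_series \<Rightarrow> dirichlet_series" where
  "ds_shift1 f = dirichlet (\<lambda>n. of_nat n * ds_coeff f n)"

text \<open>Infinite product over a set of natural numbers, as the coefficientwise limit of the partial
  products.\<close>

definition ds_infprod :: "(nat \<Rightarrow> dirichlet_series) \<Rightarrow> nat set \<Rightarrow> dirichlet_series" where
  "ds_infprod f A = dirichlet (\<lambda>n. lim (\<lambda>N. ds_coeff (\<Prod>p\<in>{p \<in> A. p \<le> N}. f p) n))"

definition zeta :: dirichlet_series where
  "zeta = dirichlet (\<lambda>n. 1)"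

text \<open>\<open>\<Sum> N(a)\<^sup>-\<^sup>s\<close> over the nonzero ideals, collected by norm.\<close>

definition dedekind_zeta :: "complex set \<Rightarrow> dirichlet_series" where
  "dedekind_zeta F = dirichlet (\<lambda>n. of_nat (card {J \<in> nonzero_ideals F. ideal_norm F J = n}))"

definition ideal_class_series :: "complex set \<Rightarrow> dirichlet_series" where
  "ideal_class_series F = dirichlet (\<lambda>n. of_nat (card
     {c \<in> carrier (class_group F). \<exists>J\<in>nonzero_ideals F. ideal_norm F J = n \<and> c = ideal_class F J}))"

definition zeta_SL ::
    "(rat \<Rightarrow> 'v \<Rightarrow> 'v) \<Rightarrow> ('v \<Rightarrow> 'v \<Rightarrow> rat) \<Rightarrow> 'v::ab_group_add set \<Rightarrow> dirichlet_series" where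
  "zeta_SL scale B L = dirichlet (\<lambda>m. of_nat (num_SL_classes scale B L m))"

end

(* A binary lattice of fundamental discriminant D is, up to scaling, an ideal I of the maximal order R
   of F with the norm form, and proper isometries are multiplications by elements of F of norm 1.
   So the left side counts the subgroups K of I up to homothety. Such a K generates an ideal
   J = R K; write f for the index of K in J. All fractional ideals are invertible, hence the number
   psi(f) of K of index f generating a given J does not depend on J, and counting all subgroups of
   index m of R gives psi * zeta_F = zeta(s) zeta(s - 1). Up to homothety fixing J, the units permute
   these K freely modulo -1 and 1 as soon as f > 1, because a unit other than -1 and 1 generates the
   ring R. This gives 2 psi(f) / w classes for each ideal class J with the exception of f = 1, where
   there is one; the exceptional term survives only if w > 2, in which case R is Euclidean and
   the series of ideal classes is the indicator of the norms of ideals. For the Euler product, choose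
   a prime P over every split p: multiplication by 1 - p^-s removes the ideals divisible by P, and
   exactly one ideal of each possible norm is divisible by none of the chosen primes. *)

theory Submission
  imports Defs "HOL-Library.Product_Plus"
begin

section \<open>Subgroups of finite index in the square lattice\<close>


text \<open>Norms and indices are handled as ratios of covolumes in the complex plane, so they
  multiply in towers and apply to fractional ideals and to mere subgroups alike. Covolume also
  explains why all homotheties may replace those of norm 1: two subgroups of the same index have the
  same covolume, so a factor in F carrying one to the other has modulus 1. The determinant condition
  excludes the isometries that involve conjugation. Invertibility rests on one computation, which
  compares R with a ring Z + Z \<theta> read off from a primitive norm form of J. Stability of J
  under R shows that this ring contains R, maximality of R that it is no larger, and J conj(J) =
  nu(J) R follows. Multiplicativity of the norm, cancellation of ideals and the independence of
  psi(f) from J all come from it; for a non-maximal order the second inclusion can fail. The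
  constants come from the term f = 1: psi(1) = 1 there, so 2 psi(f) / w undercounts the one class by
  1 - 2 / w = (w - 2) / w.\<close>

definition add_subgroup :: "'a::ab_group_add set \<Rightarrow> bool" where
  "add_subgroup K \<longleftrightarrow> 0 \<in> K \<and> (\<forall>x\<in>K. \<forall>y\<in>K. x - y \<in> K)"

lemma add_subgroup_0: "add_subgroup K \<Longrightarrow> 0 \<in> K"
  and add_subgroup_diff: "add_subgroup K \<Longrightarrow> x \<in> K \<Longrightarrow> y \<in> K \<Longrightarrow> x - y \<in> K"
  by (auto simp: add_subgroup_def)

lemma add_subgroup_uminus: "add_subgroup K \<Longrightarrow> x \<in> K \<Longrightarrow> - x \<in> K"
  using add_subgroup_diff[of K 0 x] add_subgroup_0[of K] by simp

lemma add_subgroup_add: "add_subgroup K \<Longrightarrow> x \<in> K \<Longrightarrow> y \<in> K \<Longrightarrow> x + y \<in> K"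
  using add_subgroup_diff[of K x "- y"] add_subgroup_uminus[of K y] by simp

text \<open>An additive map on the integers is determined by \<open>f 1\<close>, so this supplies
  closure under integer multiples in types that carry no scalar multiplication.\<close>

lemma add_subgroup_int_hom:
  fixes f :: "int \<Rightarrow> 'a::ab_group_add"
  assumes K: "add_subgroup K" and f: "\<And>m n. f (m + n) = f m + f n" and f1: "f 1 \<in> K"
  shows "f n \<in> K"
proof -
  have f0: "f 0 = 0"
    using f[of 0 0] by simp
  show ?thesis
  proof (induction n rule: int_induct[of _ 0])
    case base
    then show ?case using f0 add_subgroup_0[OF K] by simp
  next
    case (step1 i)
    then show ?case using f[of i 1] add_subgroup_add[OF K _ f1] by simp
  next
    case (step2 i)
    then show ?case using f[of "i - 1" 1] add_subgroup_diff[OF K _ f1, of "f i"] by simp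
  qed
qed

lemma add_subgroup_image:
  assumes "add_subgroup K" "\<And>x y. f (x + y) = f x + f y"
  shows "add_subgroup (f ` K)"
proof -
  have d: "f (x - y) = f x - f y" for x y
    using assms(2)[of "x - y" y] by (simp add: algebra_simps)
  then have "f 0 = 0"
    using d[of 0 0] by simp
  then show ?thesis
    using assms(1) unfolding add_subgroup_def by (force simp flip: d)
qed

lemma coset_eq_iff:
  assumes K: "add_subgroup K"
  shows "(+) x ` K = (+) y ` K \<longleftrightarrow> x - y \<in> K"
proof
  assume "(+) x ` K = (+) y ` K"
  then have "x + 0 \<in> (+) y ` K"
    using add_subgroup_0[OF K] by blast
  then show "x - y \<in> K" by auto
next
  have *: "(+) x ` K \<subseteq> (+) y ` K" if "x - y \<in> K" for x y
  proof
    fix z assume "z \<in> (+) x ` K"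
    then obtain k where "k \<in> K" "z = y + ((x - y) + k)" by auto
    then show "z \<in> (+) y ` K"
      using add_subgroup_add[OF K that] by blast
  qed
  assume "x - y \<in> K"
  then show "(+) x ` K = (+) y ` K"
    using *[of x y] *[of y x] add_subgroup_uminus[OF K, of "x - y"] by auto
qed

lemma lattice_index_image:
  assumes add: "\<And>x y. f (x + y) = f x + f y" and "inj f"
  shows "lattice_index (f ` A) (f ` B) = lattice_index A B"
proof -
  have "(\<lambda>x. (+) x ` f ` B) ` f ` A = (\<lambda>X. f ` X) ` (\<lambda>x. (+) x ` B) ` A"
    by (simp add: image_image add)
  moreover have "inj_on (\<lambda>X. f ` X) S" for S
    using \<open>inj f\<close> by (auto intro!: inj_onI simp: inj_image_eq_iff)
  ultimately show ?thesis
    unfolding lattice_index_def by (simp add: card_image)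
qed

text \<open>Pigeonhole: infinitely many integers, finitely many cosets. The hypothesis
  \<open>lattice_index M K > 0\<close> carries the finiteness, because \<open>card\<close> is 0 on
  infinite sets.\<close>

lemma finite_index_multiple:
  fixes f :: "int \<Rightarrow> 'a::ab_group_add"
  assumes K: "add_subgroup K" and idx: "lattice_index M K > 0"
    and f: "\<And>m n. f (m + n) = f m + f n" and M: "\<And>n. f n \<in> M"
  shows "\<exists>k>0. f k \<in> K"
proof -
  have "finite ((\<lambda>x. (+) x ` K) ` M)"
    using idx card_ge_0_finite unfolding lattice_index_def by blast
  moreover have "range (\<lambda>n. (+) (f n) ` K) \<subseteq> (\<lambda>x. (+) x ` K) ` M"
    using M by auto
  ultimately have "finite (range (\<lambda>n. (+) (f n) ` K))"
    by (rule rev_finite_subset)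
  then have "\<not> inj (\<lambda>n. (+) (f n) ` K)"
    using finite_imageD infinite_UNIV_int by blast
  then obtain m n where mn: "m < n" "(+) (f m) ` K = (+) (f n) ` K"
    unfolding inj_def by (metis linorder_neqE)
  then have "f n - f m \<in> K"
    using coset_eq_iff[OF K] by metis
  then have "f (n - m) \<in> K"
    using f[of "n - m" m] by simp
  then show ?thesis
    using mn(1) by (intro exI[of _ "n - m"]) auto
qed

lemma lattice_index_self: "add_subgroup K \<Longrightarrow> lattice_index K K = 1"
proof -
  assume K: "add_subgroup K"
  have "(\<lambda>x. (+) x ` K) ` K = {K}"
    using coset_eq_iff[OF K, of _ 0] add_subgroup_0[OF K] by auto
  then show ?thesis
    by (simp add: lattice_index_def)
qed

text \<open>The row lattice of the matrix with rows (a, 0) and (b, d). With d > 0 and 0 <= b < a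
  this is the Hermite normal form, unique for each subgroup of finite index.\<close>

definition hnf :: "int \<Rightarrow> int \<Rightarrow> int \<Rightarrow> (int \<times> int) set" where
  "hnf a b d = range (\<lambda>(s, t). (s * a + t * b, t * d))"

lemma hnf_iff:
  assumes "d \<noteq> 0"
  shows "(x, y) \<in> hnf a b d \<longleftrightarrow> d dvd y \<and> a dvd x - (y div d) * b"
proof -
  have "(x, y) \<in> hnf a b d \<longleftrightarrow> (\<exists>s t. x = s * a + t * b \<and> y = t * d)"
    by (auto simp: hnf_def)
  also have "\<dots> \<longleftrightarrow> d dvd y \<and> a dvd x - (y div d) * b"
  proof
    assume "\<exists>s t. x = s * a + t * b \<and> y = t * d"
    then show "d dvd y \<and> a dvd x - (y div d) * b" using assms by auto
  next
    assume R: "d dvd y \<and> a dvd x - (y div d) * b"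
    then obtain s where "x - (y div d) * b = a * s" by (auto elim: dvdE)
    then have "x = s * a + (y div d) * b" "y = (y div d) * d"
      using R by (auto simp: algebra_simps)
    then show "\<exists>s t. x = s * a + t * b \<and> y = t * d" by blast
  qed
  finally show ?thesis .
qed

lemma add_subgroup_hnf: "add_subgroup (hnf a b d)"
  unfolding hnf_def
  by (rule add_subgroup_image) (auto simp: add_subgroup_def algebra_simps)

text \<open>Division with remainder by the least positive element, whose existence is guaranteed by
  k.\<close>

lemma int_subgroup:
  fixes S :: "int set"
  assumes S: "add_subgroup S" and k: "k \<in> S" "k > 0"
  shows "\<exists>d>0. \<forall>x. x \<in> S \<longleftrightarrow> d dvd x"
proof -
  define d where "d = (LEAST n::nat. n > 0 \<and> int n \<in> S)"
  have ex: "nat k > 0 \<and> int (nat k) \<in> S" using k by simp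
  have d: "d > 0" "int d \<in> S"
    using LeastI[of "\<lambda>n. n > 0 \<and> int n \<in> S", OF ex] by (simp_all add: d_def)
  have mult: "int d * n \<in> S" for n
    by (rule add_subgroup_int_hom[OF S]) (use d in \<open>auto simp: algebra_simps\<close>)
  have "int d dvd x" if "x \<in> S" for x
  proof (rule ccontr)
    assume "\<not> int d dvd x"
    then have "x mod int d \<noteq> 0"
      by (simp add: dvd_eq_mod_eq_0)
    moreover have "x mod int d \<in> S"
      using add_subgroup_diff[OF S that mult[of "x div int d"]]
      by (simp add: minus_mult_div_eq_mod)
    moreover obtain r where r: "x mod int d = int r"
      using d(1) nonneg_int_cases[of "x mod int d"] by auto
    moreover have "r < d"
      using d(1) pos_mod_bound[of "int d" x] r by simp
    ultimately show False
      using not_less_Least[of r "\<lambda>n. n > 0 \<and> int n \<in> S"] unfolding d_def by simp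
  qed
  then show ?thesis
    using d mult by (intro exI[of _ "int d"]) (auto elim!: dvdE)
qed

text \<open>d generates the projection of H to the second coordinate, a generates the kernel of that
  projection, and b is the first coordinate of a lift of d, reduced modulo a. The multiples of both
  unit vectors make projection and kernel nonzero.\<close>

lemma ex_hnf:
  assumes H: "add_subgroup H" and k: "(k, 0) \<in> H" "(0, k) \<in> H" "k > 0"
  shows "\<exists>a b d. 0 < a \<and> 0 \<le> b \<and> b < a \<and> 0 < d \<and> H = hnf a b d"
proof -
  have "add_subgroup (snd ` H)"
    by (rule add_subgroup_image[OF H]) auto
  moreover have "k \<in> snd ` H"
    using k by force
  ultimately obtain d where d: "d > 0" "\<And>y. y \<in> snd ` H \<longleftrightarrow> d dvd y"
    using int_subgroup k(3) by metis
  have "add_subgroup {x. (x, 0) \<in> H}"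
    using H unfolding add_subgroup_def by (force simp: zero_prod_def)
  then obtain a where a: "a > 0" "\<And>x. (x, 0) \<in> H \<longleftrightarrow> a dvd x"
    using int_subgroup[of "{x. (x, 0) \<in> H}" k] k by auto
  obtain b' where b': "(b', d) \<in> H"
    using d(2)[of d] by force
  define b where "b = b' mod a"
  have "a dvd b' - b" by (simp add: b_def)
  then have "(b', d) - (b' - b, 0) \<in> H"
    using a(2) by (intro add_subgroup_diff[OF H b']) blast
  then have b: "(b, d) \<in> H" by simp
  have mult: "(t * b, t * d) \<in> H" for t
    by (rule add_subgroup_int_hom[OF H, of "\<lambda>t. (t * b, t * d)"]) (use b in \<open>auto simp: algebra_simps\<close>)
  have "(x, y) \<in> H \<longleftrightarrow> (x, y) \<in> hnf a b d" for x y
  proof -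
    have "(x, y) \<in> H \<longleftrightarrow> a dvd x - (y div d) * b" if "d dvd y"
    proof -
      have "(x, y) = (x - (y div d) * b, 0) + ((y div d) * b, (y div d) * d)"
        using that by simp
      then have "(x, y) \<in> H \<longleftrightarrow> (x - (y div d) * b, 0) \<in> H"
        using add_subgroup_add[OF H _ mult[of "y div d"]] add_subgroup_diff[OF H _ mult[of "y div d"]]
        by (metis add_diff_cancel_right')
      then show ?thesis using a(2) by simp
    qed
    moreover have "d dvd y" if "(x, y) \<in> H"
      using that d(2) by force
    ultimately show ?thesis
      using d(1) by (auto simp: hnf_iff)
  qed
  then have "H = hnf a b d" by auto
  then show ?thesis
    using a d by (intro exI[of _ a] exI[of _ b] exI[of _ d]) (auto simp: b_def)
qed

lemma eq_if_dvd_diff: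
  fixes d :: int
  assumes "d dvd y - y'" "0 \<le> y" "y < d" "0 \<le> y'" "y' < d"
  shows "y = y'"
  using assms mod_eq_dvd_iff[of y d y'] by simp

text \<open>The box [0, a) x [0, d) is a set of coset representatives.\<close>

lemma lattice_index_hnf:
  assumes "a > 0" "d > 0"
  shows "lattice_index UNIV (hnf a b d) = nat (a * d)"
proof -
  let ?H = "hnf a b d" and ?X = "{0..<a} \<times> {0..<d}"
  note co = coset_eq_iff[OF add_subgroup_hnf[of a b d]]
  have inj: "inj_on (\<lambda>x. (+) x ` ?H) ?X"
  proof (rule inj_onI, clarsimp simp: co)
    fix x y x' y'
    assume *: "0 \<le> x" "x < a" "0 \<le> y" "y < d" "0 \<le> x'" "x' < a" "0 \<le> y'" "y' < d"
      and "(x - x', y - y') \<in> ?H"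
    then have dv: "d dvd y - y'" "a dvd x - x' - ((y - y') div d) * b"
      using assms by (auto simp: hnf_iff)
    have "y = y'"
      using eq_if_dvd_diff[OF dv(1)] * by simp
    moreover from this have "x = x'"
      using eq_if_dvd_diff[of a x x'] dv(2) * by simp
    ultimately show "x = x' \<and> y = y'" by simp
  qed
  have "(\<lambda>x. (+) x ` ?H) ` ?X = range (\<lambda>x. (+) x ` ?H)"
  proof (intro equalityI subsetI)
    fix C assume "C \<in> range (\<lambda>x. (+) x ` ?H)"
    then obtain x y where C: "C = (+) (x, y) ` ?H" by auto
    \<comment> \<open>First y is reduced modulo d by a multiple of the row (b, d), which shifts x;
      the shifted x is then reduced modulo a by the row (a, 0).\<close>
    define y' where "y' = y mod d"
    define x' where "x' = (x - (y div d) * b) mod a"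
    have "y - y' = (y div d) * d" unfolding y'_def by (simp add: minus_mod_eq_div_mult)
    moreover have "x - x' - (y div d) * b = ((x - (y div d) * b) div a) * a"
      unfolding x'_def using minus_mod_eq_div_mult[of "x - (y div d) * b" a] by simp
    ultimately have "(x, y) - (x', y') \<in> ?H"
      using assms by (simp add: hnf_iff)
    then have "C = (+) (x', y') ` ?H"
      using C co by blast
    moreover have "(x', y') \<in> ?X"
      using assms by (auto simp: x'_def y'_def)
    ultimately show "C \<in> (\<lambda>x. (+) x ` ?H) ` ?X" by blast
  qed auto
  then have "lattice_index UNIV ?H = card ?X"
    unfolding lattice_index_def using card_image[OF inj] by simp
  then show ?thesis
    using assms by (simp add: nat_mult_distrib)
qed

text \<open>The points with second coordinate 0 give a, the second coordinates that occur give d,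
  and b is then determined modulo a.\<close>

lemma hnf_inject:
  assumes eq: "hnf a b d = hnf a' b' d'"
    and "0 < a" "0 \<le> b" "b < a" "0 < d" "0 < a'" "0 \<le> b'" "b' < a'" "0 < d'"
  shows "a = a'" "b = b'" "d = d'"
proof -
  have mem: "d dvd y \<and> a dvd x - (y div d) * b \<longleftrightarrow> d' dvd y \<and> a' dvd x - (y div d') * b'" for x y
    using hnf_iff[of d x y a b] hnf_iff[of d' x y a' b'] assms by auto
  have "a dvd x \<longleftrightarrow> a' dvd x" for x
    using mem[of 0 x] by simp
  from this[of a] this[of a'] show a: "a = a'"
    using assms(2,6) zdvd_antisym_nonneg[of a a'] by simp
  have "d dvd d'"
    using mem[of d' b'] assms by simp
  moreover have "d' dvd d"
    using mem[of d b] assms by simp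
  ultimately show d: "d = d'"
    using assms by (simp add: zdvd_antisym_nonneg)
  have "a dvd b - b'"
    using mem[of d b] assms a d by simp
  then show "b = b'"
    using assms a eq_if_dvd_diff[of a b b'] by simp
qed

text \<open>A subgroup of index m amounts to a divisor a, which forces d = m div a, and one of the a
  residues b; hence the divisor sum.\<close>

lemma card_subgroups_int2:
  assumes m: "m > 0"
  shows "finite {H :: (int \<times> int) set. add_subgroup H \<and> lattice_index UNIV H = m}" (is "finite ?S")
    and "card {H :: (int \<times> int) set. add_subgroup H \<and> lattice_index UNIV H = m} = \<Sum>{a. a dvd m}"
proof -
  let ?T = "SIGMA a:{a. a dvd m}. {0..<a}"
  let ?f = "\<lambda>(a, b). hnf (int a) (int b) (int (m div a))"
  have pos: "a > 0" "m div a > 0" if "a dvd m" for a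
    using that m by (auto intro: Nat.gr0I)
  have inj: "inj_on ?f ?T"
  proof (rule inj_onI, clarify)
    fix a b a' b'
    assume *: "a dvd m" "a' dvd m" "b \<in> {0..<a}" "b' \<in> {0..<a'}"
      and eq: "hnf (int a) (int b) (int (m div a)) = hnf (int a') (int b') (int (m div a'))"
    show "a = a' \<and> b = b'"
      using hnf_inject(1,2)[OF eq] * pos[of a] pos[of a'] by auto
  qed
  have "?f ` ?T = ?S"
  proof (intro equalityI subsetI)
    fix H assume "H \<in> ?f ` ?T"
    then obtain a b where *: "a dvd m" "H = hnf (int a) (int b) (int (m div a))" by auto
    then have "lattice_index UNIV H = nat (int a * int (m div a))"
      using pos[of a] by (simp add: lattice_index_hnf)
    also have "\<dots> = m"
      using * by (simp flip: of_nat_mult)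
    finally show "H \<in> ?S"
      using * add_subgroup_hnf by auto
  next
    fix H assume "H \<in> ?S"
    then have H: "add_subgroup H" and idx: "lattice_index UNIV H = m" by auto
    obtain k where k: "k > 0" "(k, 0) \<in> H"
      using finite_index_multiple[OF H, of UNIV "\<lambda>n. (n, 0)"] idx m by auto
    obtain l where l: "l > 0" "(0, l) \<in> H"
      using finite_index_multiple[OF H, of UNIV "\<lambda>n. (0, n)"] idx m by auto
    have "(l * k, 0) \<in> H"
      by (rule add_subgroup_int_hom[OF H, of "\<lambda>l. (l * k, 0)"]) (use k in \<open>auto simp: algebra_simps\<close>)
    moreover have "(0, k * l) \<in> H"
      by (rule add_subgroup_int_hom[OF H, of "\<lambda>k. (0, k * l)"]) (use l in \<open>auto simp: algebra_simps\<close>)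
    ultimately obtain a b d where *: "0 < a" "0 \<le> b" "b < a" "0 < d" "H = hnf a b d"
      using ex_hnf[OF H, of "k * l"] k l by (auto simp: mult.commute)
    then have "nat (a * d) = m"
      using idx lattice_index_hnf by simp
    then have md: "m = nat a * nat d"
      using * by (simp add: nat_mult_distrib)
    then have "H = ?f (nat a, nat b)" "(nat a, nat b) \<in> ?T"
      using * by auto
    then show "H \<in> ?f ` ?T" by blast
  qed
  moreover have "finite ?T"
    using m by auto
  ultimately show "finite ?S" and "card ?S = \<Sum>{a. a dvd m}"
    using card_image[OF inj] m finite_imageI[of ?T ?f] by auto
qed

section \<open>Lattices in the complex plane\<close>


text \<open>The determinant of two real vectors, so nonvanishing means independence over the reals.
  The sign is kept because determinants of linear maps are later read off as ratios of
  areas.\<close>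

definition area :: "complex \<Rightarrow> complex \<Rightarrow> real" where
  "area x y = Im (cnj x * y)"

definition lat :: "complex \<Rightarrow> complex \<Rightarrow> complex set" where
  "lat \<alpha> \<beta> = range (\<lambda>(x::int, y::int). of_int x * \<alpha> + of_int y * \<beta>)"

text \<open>A choice among bases turns the covolume into a function of the set;
  \<open>covol_lat\<close> shows that the choice does not matter.\<close>

definition covol :: "complex set \<Rightarrow> real" where
  "covol K = (SOME v. \<exists>\<alpha> \<beta>. area \<alpha> \<beta> \<noteq> 0 \<and> K = lat \<alpha> \<beta> \<and> v = \<bar>area \<alpha> \<beta>\<bar>)"

lemma area_lin:
  "area (of_real p * \<alpha> + of_real q * \<beta>) (of_real r * \<alpha> + of_real s * \<beta>) = (p * s - q * r) * area \<alpha> \<beta>"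
  by (simp add: area_def algebra_simps)

lemma area_lin_int:
  "area (of_int p * \<alpha> + of_int q * \<beta>) (of_int r * \<alpha> + of_int s * \<beta>) = of_int (p * s - q * r) * area \<alpha> \<beta>"
  using area_lin[of "of_int p" \<alpha> "of_int q" \<beta> "of_int r" "of_int s"] by simp

lemma area_mult: "area (u * x) (u * y) = (cmod u)\<^sup>2 * area x y"
  unfolding area_def cmod_power2 by (simp add: power2_eq_square algebra_simps)

lemma lat_mem: "of_int x * \<alpha> + of_int y * \<beta> \<in> lat \<alpha> \<beta>"
  by (auto simp: lat_def)

lemma latE:
  assumes "z \<in> lat \<alpha> \<beta>"
  obtains x y where "z = of_int x * \<alpha> + of_int y * \<beta>"
  using assms by (auto simp: lat_def)

lemma lat_gens: "\<alpha> \<in> lat \<alpha> \<beta>" "\<beta> \<in> lat \<alpha> \<beta>"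
  using lat_mem[of 1 \<alpha> 0 \<beta>] lat_mem[of 0 \<alpha> 1 \<beta>] by simp_all

lemma add_subgroup_lat: "add_subgroup (lat \<alpha> \<beta>)"
  unfolding lat_def by (rule add_subgroup_image) (auto simp: add_subgroup_def algebra_simps)

lemma add_subgroup_of_int_mult:
  assumes "add_subgroup K" "x \<in> K"
  shows "of_int n * (x::complex) \<in> K"
  by (rule add_subgroup_int_hom[OF assms(1), of "\<lambda>n. of_int n * x"]) (use assms in \<open>auto simp: algebra_simps\<close>)

lemma lat_subset: "add_subgroup K \<Longrightarrow> \<alpha> \<in> K \<Longrightarrow> \<beta> \<in> K \<Longrightarrow> lat \<alpha> \<beta> \<subseteq> K"
  by (auto elim!: latE intro!: add_subgroup_add add_subgroup_of_int_mult)

lemma lat_subset_iff: "lat \<alpha> \<beta> \<subseteq> lat \<gamma> \<delta> \<longleftrightarrow> \<alpha> \<in> lat \<gamma> \<delta> \<and> \<beta> \<in> lat \<gamma> \<delta>"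
  using lat_subset[OF add_subgroup_lat] lat_gens by blast

lemma image_mult_lat: "(*) u ` lat \<alpha> \<beta> = lat (u * \<alpha>) (u * \<beta>)"
  by (simp add: lat_def image_image case_prod_unfold algebra_simps)

lemma area_lat_subset:
  assumes "lat \<gamma> \<delta> \<subseteq> lat \<alpha> \<beta>"
  shows "\<exists>k::int. area \<gamma> \<delta> = of_int k * area \<alpha> \<beta>"
  using assms unfolding lat_subset_iff by (metis area_lin_int latE)

text \<open>Two bases of one lattice have areas that are integer multiples of each other; the two
  integer factors have product 1, so each is 1 or -1.\<close>

lemma covol_lat:
  assumes "area \<alpha> \<beta> \<noteq> 0"
  shows "covol (lat \<alpha> \<beta>) = \<bar>area \<alpha> \<beta>\<bar>"
  unfolding covol_def
proof (rule some_equality)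
  show "\<exists>\<alpha>' \<beta>'. area \<alpha>' \<beta>' \<noteq> 0 \<and> lat \<alpha> \<beta> = lat \<alpha>' \<beta>' \<and> \<bar>area \<alpha> \<beta>\<bar> = \<bar>area \<alpha>' \<beta>'\<bar>"
    using assms by blast
next
  fix v
  assume "\<exists>\<gamma> \<delta>. area \<gamma> \<delta> \<noteq> 0 \<and> lat \<alpha> \<beta> = lat \<gamma> \<delta> \<and> v = \<bar>area \<gamma> \<delta>\<bar>"
  then obtain \<gamma> \<delta> where *: "area \<gamma> \<delta> \<noteq> 0" "lat \<alpha> \<beta> = lat \<gamma> \<delta>" "v = \<bar>area \<gamma> \<delta>\<bar>" by blast
  obtain k l :: int where kl: "area \<gamma> \<delta> = of_int k * area \<alpha> \<beta>" "area \<alpha> \<beta> = of_int l * area \<gamma> \<delta>"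
    using area_lat_subset *(2) by (metis order_refl)
  then have "of_int (k * l) * area \<alpha> \<beta> = 1 * area \<alpha> \<beta>" by simp
  then have "k * l = 1"
    using assms by (metis mult_right_cancel of_int_eq_1_iff)
  then have "\<bar>k\<bar> = 1"
    using abs_zmult_eq_1[of k l] by simp
  then show "v = \<bar>area \<alpha> \<beta>\<bar>"
    using kl(1) *(3) by (simp add: abs_mult flip: of_int_abs)
qed

context
  fixes \<alpha> \<beta> :: complex
  assumes nz: "area \<alpha> \<beta> \<noteq> 0"
begin

private definition f :: "int \<times> int \<Rightarrow> complex" where
  "f = (\<lambda>(x, y). of_int x * \<alpha> + of_int y * \<beta>)"

private lemma f_add: "f (p + q) = f p + f q"
  by (cases p; cases q) (simp add: f_def algebra_simps)

text \<open>The areas against \<alpha> and against \<beta> are the coordinate functionals, up to the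
  nonzero factor \<open>area \<alpha> \<beta>\<close> and a sign.\<close>

lemma lat_coord_unique:
  assumes "of_real x * \<alpha> + of_real y * \<beta> = of_real x' * \<alpha> + of_real y' * \<beta>"
  shows "x = x'" "y = y'"
proof -
  have *: "area \<alpha> (of_real x * \<alpha> + of_real y * \<beta>) = y * area \<alpha> \<beta>"
    "area \<beta> (of_real x * \<alpha> + of_real y * \<beta>) = - x * area \<alpha> \<beta>" for x y
    using area_lin[of 1 \<alpha> 0 \<beta> x y] area_lin[of 0 \<alpha> 1 \<beta> x y] by simp_all
  show "y = y'" using *(1)[of x y] *(1)[of x' y'] assms nz by simp
  show "x = x'" using *(2)[of x y] *(2)[of x' y'] assms nz by simp
qed

private lemma inj_f: "inj f"
proof (rule injI)
  fix p q assume "f p = f q"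
  then show "p = q"
    using lat_coord_unique[of "of_int (fst p)" "of_int (snd p)" "of_int (fst q)" "of_int (snd q)"]
    by (cases p; cases q) (auto simp: f_def)
qed

private lemma range_f: "range f = lat \<alpha> \<beta>"
  by (simp add: f_def lat_def)

private lemma subgroup_eq_image:
  assumes "add_subgroup K" "K \<subseteq> lat \<alpha> \<beta>"
  obtains H where "add_subgroup H" "K = f ` H" "lattice_index (lat \<alpha> \<beta>) K = lattice_index UNIV H"
proof -
  define H where "H = f -` K"
  have K: "K = f ` H"
    using assms(2) by (auto simp: H_def range_f[symmetric])
  have d: "f (x - y) = f x - f y" for x y
    using f_add[of "x - y" y] by (simp add: algebra_simps)
  have "add_subgroup H"
    using assms(1) d[of 0 0] unfolding add_subgroup_def H_def by (auto simp: d)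
  moreover have "lattice_index (lat \<alpha> \<beta>) K = lattice_index UNIV H"
    unfolding K range_f[symmetric] by (rule lattice_index_image[OF f_add inj_f])
  ultimately show thesis
    using that K by blast
qed

text \<open>In coordinates K has a Hermite basis, whose determinant \<open>a * d\<close> is both the
  index and the factor of the area. This links indices with covolumes.\<close>

private lemma sublattice_aux:
  assumes K: "add_subgroup K" "K \<subseteq> lat \<alpha> \<beta>" and k: "k > 0"
    "of_int k * \<alpha> \<in> K" "of_int k * \<beta> \<in> K"
  shows "\<exists>\<gamma> \<delta>. area \<gamma> \<delta> \<noteq> 0 \<and> K = lat \<gamma> \<delta> \<and>
    covol K = lattice_index (lat \<alpha> \<beta>) K * covol (lat \<alpha> \<beta>) \<and> lattice_index (lat \<alpha> \<beta>) K > 0"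
proof -
  obtain H where H: "add_subgroup H" "K = f ` H" "lattice_index (lat \<alpha> \<beta>) K = lattice_index UNIV H"
    using subgroup_eq_image[OF K] by blast
  have "f (k, 0) \<in> K" "f (0, k) \<in> K"
    using k by (simp_all add: f_def)
  then have "(k, 0) \<in> H" "(0, k) \<in> H"
    using inj_f unfolding H(2) by (auto simp: inj_image_mem_iff)
  then obtain a b d where h: "0 < a" "0 < d" "H = hnf a b d"
    using ex_hnf[OF H(1)] k(1) by blast
  define \<gamma> \<delta> where "\<gamma> = of_int a * \<alpha> + of_int 0 * \<beta>" and "\<delta> = of_int b * \<alpha> + of_int d * \<beta>"
  have "K = lat \<gamma> \<delta>"
    unfolding H(2) h(3) lat_def hnf_def image_image
    by (intro image_cong) (auto simp: f_def \<gamma>_def \<delta>_def algebra_simps)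
  moreover have ar: "area \<gamma> \<delta> = of_int (a * d) * area \<alpha> \<beta>"
    unfolding \<gamma>_def \<delta>_def by (subst area_lin_int) simp
  moreover have "lattice_index (lat \<alpha> \<beta>) K = nat (a * d)"
    unfolding H(3) h(3) by (rule lattice_index_hnf[OF h(1,2)])
  moreover have "a * d > 0" using h by simp
  ultimately show ?thesis
    using nz h by (intro exI[of _ \<gamma>] exI[of _ \<delta>]) (auto simp: covol_lat abs_mult)
qed

lemma finite_index_multiple_lat:
  assumes K: "add_subgroup K" and idx: "lattice_index (lat \<alpha> \<beta>) K > 0"
  shows "\<exists>k::int>0. \<forall>x\<in>lat \<alpha> \<beta>. of_int k * x \<in> K"
proof -
  have M: "of_int n * \<alpha> \<in> lat \<alpha> \<beta>" "of_int n * \<beta> \<in> lat \<alpha> \<beta>" for n :: int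
    using lat_mem[of n \<alpha> 0 \<beta>] lat_mem[of 0 \<alpha> n \<beta>] by simp_all
  obtain k :: int where k: "k > 0" "of_int k * \<alpha> \<in> K"
    using finite_index_multiple[OF K idx, of "\<lambda>n. of_int n * \<alpha>"] M by (auto simp: algebra_simps)
  obtain l :: int where l: "l > 0" "of_int l * \<beta> \<in> K"
    using finite_index_multiple[OF K idx, of "\<lambda>n. of_int n * \<beta>"] M by (auto simp: algebra_simps)
  have "of_int (k * l) * x \<in> K" if x: "x \<in> lat \<alpha> \<beta>" for x
  proof -
    obtain p q where "x = of_int p * \<alpha> + of_int q * \<beta>"
      using latE[OF x] .
    then have "of_int (k * l) * x = of_int (l * p) * (of_int k * \<alpha>) + of_int (k * q) * (of_int l * \<beta>)"
      by (simp add: algebra_simps)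
    then show ?thesis
      using add_subgroup_add[OF K add_subgroup_of_int_mult[OF K k(2)] add_subgroup_of_int_mult[OF K l(2)]]
      by (simp only:)
  qed
  then show ?thesis
    using k l by (intro exI[of _ "k * l"]) auto
qed

lemma sublattice:
  assumes K: "add_subgroup K" "K \<subseteq> lat \<alpha> \<beta>" and k: "k > 0" "\<And>x. x \<in> lat \<alpha> \<beta> \<Longrightarrow> of_int k * x \<in> K"
  shows "\<exists>\<gamma> \<delta>. area \<gamma> \<delta> \<noteq> 0 \<and> K = lat \<gamma> \<delta>"
    and "covol K = lattice_index (lat \<alpha> \<beta>) K * covol (lat \<alpha> \<beta>)"
    and "lattice_index (lat \<alpha> \<beta>) K > 0"
  using sublattice_aux[OF K k(1) k(2)[OF lat_gens(1)] k(2)[OF lat_gens(2)]] by auto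

lemma card_subgroups_lat:
  assumes m: "m > 0"
  shows "finite {K. add_subgroup K \<and> K \<subseteq> lat \<alpha> \<beta> \<and> lattice_index (lat \<alpha> \<beta>) K = m}" (is "finite ?S")
    and "card {K. add_subgroup K \<and> K \<subseteq> lat \<alpha> \<beta> \<and> lattice_index (lat \<alpha> \<beta>) K = m} = \<Sum>{a. a dvd m}"
proof -
  let ?H = "{H. add_subgroup H \<and> lattice_index UNIV H = m}"
  have "?S = (\<lambda>H. f ` H) ` ?H"
  proof (intro equalityI subsetI)
    fix K assume "K \<in> ?S"
    then obtain H where "add_subgroup H" "K = f ` H" "lattice_index (lat \<alpha> \<beta>) K = lattice_index UNIV H"
      using subgroup_eq_image[of K] by auto
    then show "K \<in> (\<lambda>H. f ` H) ` ?H"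
      using \<open>K \<in> ?S\<close> by auto
  next
    fix K assume "K \<in> (\<lambda>H. f ` H) ` ?H"
    then obtain H where H: "add_subgroup H" "lattice_index UNIV H = m" "K = f ` H" by auto
    then have "lattice_index (lat \<alpha> \<beta>) K = m"
      unfolding range_f[symmetric] using lattice_index_image[OF f_add inj_f, of UNIV H] by simp
    then show "K \<in> ?S"
      using H add_subgroup_image[OF H(1) f_add] range_f by auto
  qed
  moreover have "inj_on (\<lambda>H. f ` H) ?H"
    by (rule inj_onI) (simp add: inj_image_eq_iff[OF inj_f])
  ultimately show "finite ?S" "card ?S = \<Sum>{a. a dvd m}"
    using card_subgroups_int2[OF m] card_image[of "\<lambda>H. f ` H" ?H] finite_imageI[of ?H "\<lambda>H. f ` H"]
    by simp_all
qed

end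

section \<open>Fractional ideals of an imaginary quadratic field\<close>


text \<open>\<open>ideal_prod\<close> ignores the carrier of its ring argument, so products are
  formed once in all of \<open>complex\<close> and serve for R, for F and for subgroups that are not
  ideals.\<close>

definition prd :: "complex set \<Rightarrow> complex set \<Rightarrow> complex set"  (infixl "\<star>" 70) where
  "I \<star> J = ideal_prod (subring_of_complex UNIV) I J"

lemma ideal_prod_subring_of_complex: "ideal_prod (subring_of_complex S) I J = I \<star> J"
proof -
  have "x \<in> ideal_prod (subring_of_complex A) I J \<Longrightarrow> x \<in> ideal_prod (subring_of_complex B) I J" for x A B
  proof (induction rule: ideal_prod.induct)
    case (prod i j)
    then show ?case
      using ideal_prod.prod[of i I j J "subring_of_complex B"] by (simp add: subring_of_complex_def)
  next
    case (sum s1 s2)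
    then show ?case
      using ideal_prod.sum[of s1 "subring_of_complex B" I J s2] by (simp add: subring_of_complex_def)
  qed
  then show ?thesis unfolding prd_def by blast
qed

lemma prdI: "i \<in> I \<Longrightarrow> j \<in> J \<Longrightarrow> i * j \<in> I \<star> J"
  using ideal_prod.prod[of i I j J "subring_of_complex UNIV"] by (simp add: subring_of_complex_def prd_def)

lemma prd_add: "x \<in> I \<star> J \<Longrightarrow> y \<in> I \<star> J \<Longrightarrow> x + y \<in> I \<star> J"
  using ideal_prod.sum[of x "subring_of_complex UNIV" I J y] by (simp add: subring_of_complex_def prd_def)

lemma prd_induct [consumes 1, case_names prod sum]:
  assumes "x \<in> I \<star> J" "\<And>i j. i \<in> I \<Longrightarrow> j \<in> J \<Longrightarrow> P (i * j)"
    "\<And>x y. x \<in> I \<star> J \<Longrightarrow> P x \<Longrightarrow> y \<in> I \<star> J \<Longrightarrow> P y \<Longrightarrow> P (x + y)"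
  shows "P x"
  using assms(1) unfolding prd_def
proof (induction rule: ideal_prod.induct)
  case (prod i j)
  then show ?case using assms(2) by (simp add: subring_of_complex_def)
next
  case (sum x y)
  then show ?case using assms(3)[of x y] by (simp add: subring_of_complex_def prd_def)
qed

lemma prd_subset:
  assumes "add_subgroup K" "\<And>i j. i \<in> I \<Longrightarrow> j \<in> J \<Longrightarrow> i * j \<in> K"
  shows "I \<star> J \<subseteq> K"
proof
  fix x assume "x \<in> I \<star> J"
  then show "x \<in> K"
    by (induction rule: prd_induct) (use assms add_subgroup_add in auto)
qed

lemma prd_mono:
  assumes "I \<subseteq> I'" "J \<subseteq> J'"
  shows "I \<star> J \<subseteq> I' \<star> J'"
proof
  fix x assume "x \<in> I \<star> J"
  then show "x \<in> I' \<star> J'"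
  proof (induction rule: prd_induct)
    case (prod i j)
    then show ?case using assms by (blast intro: prdI)
  qed (rule prd_add)
qed

lemma add_subgroup_prd:
  assumes I: "add_subgroup I" and J: "add_subgroup J"
  shows "add_subgroup (I \<star> J)"
proof -
  have m: "- x \<in> I \<star> J" if "x \<in> I \<star> J" for x
    using that
  proof (induction rule: prd_induct)
    case (prod i j)
    then show ?case
      using prdI[OF add_subgroup_uminus[OF I, of i], of j J] by simp
  next
    case (sum x y)
    then show ?case using prd_add[of "- x" I J "- y"] by simp
  qed
  have "x - y \<in> I \<star> J" if "x \<in> I \<star> J" "y \<in> I \<star> J" for x y
    using prd_add[OF that(1) m[OF that(2)]] by simp
  moreover have "0 \<in> I \<star> J"
    using prdI[OF add_subgroup_0[OF I] add_subgroup_0[OF J]] by simp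
  ultimately show ?thesis
    by (simp add: add_subgroup_def)
qed

lemma prd_comm: "I \<star> J = J \<star> I"
proof -
  have "I \<star> J \<subseteq> J \<star> I" for I J
  proof
    fix x assume "x \<in> I \<star> J"
    then show "x \<in> J \<star> I"
    proof (induction rule: prd_induct)
      case (prod i j)
      then show ?case using prdI[of j J i I] by (simp add: mult.commute)
    qed (rule prd_add)
  qed
  then show ?thesis by blast
qed

lemma prd_assoc: "I \<star> J \<star> K = I \<star> (J \<star> K)"
proof -
  have *: "I \<star> J \<star> K \<subseteq> I \<star> (J \<star> K)" for I J K
  proof
    fix x assume "x \<in> I \<star> J \<star> K"
    then show "x \<in> I \<star> (J \<star> K)"
    proof (induction rule: prd_induct)
      case (prod p k)
      from prod(1) show ?case
      proof (induction rule: prd_induct)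
        case (prod i j)
        then show ?case
          using prdI[OF prod(1) prdI[OF prod(2) \<open>k \<in> K\<close>]] by (simp add: mult.assoc)
      next
        case (sum x y)
        then show ?case using prd_add by (simp add: distrib_right)
      qed
    qed (rule prd_add)
  qed
  show ?thesis
  proof
    show "I \<star> J \<star> K \<subseteq> I \<star> (J \<star> K)" by (rule *)
    have "I \<star> (J \<star> K) = K \<star> J \<star> I" by (simp add: prd_comm)
    also have "\<dots> \<subseteq> K \<star> (J \<star> I)" by (rule *)
    also have "\<dots> = I \<star> J \<star> K" by (simp add: prd_comm)
    finally show "I \<star> (J \<star> K) \<subseteq> I \<star> J \<star> K" .
  qed
qed

lemma prd_left_commute: "I \<star> (J \<star> K) = J \<star> (I \<star> K)"
  by (metis prd_assoc prd_comm)

lemmas prd_ac = prd_assoc prd_comm prd_left_commute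

text \<open>Three maps allow both uses: a homothety acts on one factor only, conjugation on
  both.\<close>

lemma prd_image:
  assumes f: "\<And>x y. f (x + y) = f x + f y" and m: "\<And>i j. i \<in> I \<Longrightarrow> j \<in> J \<Longrightarrow> f (i * j) = g i * h j"
  shows "f ` (I \<star> J) = g ` I \<star> h ` J"
proof
  show "f ` (I \<star> J) \<subseteq> g ` I \<star> h ` J"
  proof clarify
    fix x assume "x \<in> I \<star> J"
    then show "f x \<in> g ` I \<star> h ` J"
      by (induction rule: prd_induct) (use m prdI f prd_add in auto)
  qed
  show "g ` I \<star> h ` J \<subseteq> f ` (I \<star> J)"
  proof
    fix x assume "x \<in> g ` I \<star> h ` J"
    then show "x \<in> f ` (I \<star> J)"
    proof (induction rule: prd_induct)
      case (prod i j)
      then show ?case using m prdI by (auto simp flip: m)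
    next
      case (sum x y)
      then show ?case using prd_add f by (auto simp flip: f)
    qed
  qed
qed

lemma scale_prd: "(*) u ` (I \<star> J) = (*) u ` I \<star> J"
  using prd_image[of "(*) u" I J "(*) u" "\<lambda>x. x"] by (simp add: algebra_simps)

lemma cnj_prd: "cnj ` (I \<star> J) = cnj ` I \<star> cnj ` J"
  by (rule prd_image) auto

lemma of_real_of_rat: "of_real (of_rat q) = (of_rat q :: complex)"
  by (cases q) (simp add: of_rat_rat)

lemma cnj_of_rat: "cnj (of_rat q) = of_rat q"
  by (simp flip: of_real_of_rat)

lemma cmod_square_eq: "x * cnj x = of_real r \<Longrightarrow> (cmod x)\<^sup>2 = r"
  by (metis complex_norm_square of_real_eq_iff)

text \<open>The content of a rational triple: clear the denominators and divide by the gcd. It will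
  extract the factor that makes a norm form primitive.\<close>

lemma ex_primitive_ratio:
  fixes A T C :: rat
  assumes "A > 0"
  shows "\<exists>r a t c. r > 0 \<and> A = r * of_int a \<and> T = r * of_int t \<and> C = r * of_int c \<and> gcd a (gcd t c) = 1"
proof -
  have "\<exists>d n. d > 0 \<and> q = of_int n / of_int d" for q :: rat
    using quotient_of_div[of q] quotient_of_denom_pos[of q] by (metis prod.collapse)
  then obtain d1 n1 d2 n2 d3 n3 where d: "d1 > 0" "d2 > 0" "d3 > 0"
    and eq: "A = of_int n1 / of_int d1" "T = of_int n2 / of_int d2" "C = of_int n3 / of_int d3"
    by metis
  define x y z where "x = n1 * d2 * d3" and "y = n2 * d1 * d3" and "z = n3 * d1 * d2"
  define g where "g = gcd x (gcd y z)"
  define r :: rat where "r = of_int g / of_int (d1 * d2 * d3)"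
  have "n1 \<noteq> 0" using assms eq d by auto
  then have g: "g > 0" using d by (simp add: g_def x_def)
  have "g dvd x" "g dvd y" "g dvd z"
    by (auto simp: g_def intro: dvd_trans)
  then obtain a t c where atc: "x = g * a" "y = g * t" "z = g * c"
    by (auto elim!: dvdE)
  have "gcd x (gcd y z) = g * gcd a (gcd t c)"
    unfolding atc using g by (simp add: gcd_mult_left abs_of_pos)
  then have "gcd a (gcd t c) = 1"
    using g unfolding g_def[symmetric] by simp
  moreover have "r > 0" using g d by (simp add: r_def)
  moreover have "A = of_int x / of_int (d1 * d2 * d3)" "T = of_int y / of_int (d1 * d2 * d3)"
    "C = of_int z / of_int (d1 * d2 * d3)"
    using d unfolding eq x_def y_def z_def by simp_all
  ultimately show ?thesis
    using atc unfolding r_def by (intro exI[of _ r] exI[of _ a] exI[of _ t] exI[of _ c]) (simp add: r_def)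
qed

text \<open>\<omega> is a root of X^2 - \<tau> X + \<kappa>, and \<open>maximal\<close> says that Z
  + Z \<omega> contains every algebraic integer of its field. It is in this form that the
  fundamental discriminant enters the theory of ideals.\<close>

locale imag_quadratic =
  fixes \<omega> :: complex and \<tau> \<kappa> :: int
  assumes Im_om: "Im \<omega> \<noteq> 0" and om2: "\<omega> * \<omega> = of_int \<tau> * \<omega> - of_int \<kappa>"
    and maximal: "\<And>x y. algebraic_int (of_rat x + of_rat y * \<omega>) \<Longrightarrow> of_rat x + of_rat y * \<omega> \<in> lat 1 \<omega>"
begin

definition R :: "complex set" where "R = lat 1 \<omega>"

definition F :: "complex set" where "F = range (\<lambda>(x, y). of_rat x + of_rat y * \<omega>)"

lemma cnj_om: "cnj \<omega> = of_int \<tau> - \<omega>"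
proof -
  have "Im (\<omega> * \<omega>) = Im (of_int \<tau> * \<omega> - of_int \<kappa>)" using om2 by simp
  then have "(2 * Re \<omega>) * Im \<omega> = of_int \<tau> * Im \<omega>" by simp
  then have "2 * Re \<omega> = of_int \<tau>" using Im_om by simp
  then show ?thesis by (simp add: complex_eq_iff)
qed

lemma area_1_om: "area 1 \<omega> \<noteq> 0"
  using Im_om by (simp add: area_def)

lemma F_mem: "of_rat x + of_rat y * \<omega> \<in> F"
  by (auto simp: F_def)

lemma FE:
  assumes "z \<in> F"
  obtains x y where "z = of_rat x + of_rat y * \<omega>"
  using assms by (auto simp: F_def)

lemma F_rat: "of_rat q \<in> F"
  using F_mem[of q 0] by simp

lemma F_int: "of_int k \<in> F"
  using F_rat[of "of_int k"] by simp

lemma F_mult: "u \<in> F \<Longrightarrow> v \<in> F \<Longrightarrow> u * v \<in> F"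
proof (elim FE)
  fix x y x' y' assume uv: "u = of_rat x + of_rat y * \<omega>" "v = of_rat x' + of_rat y' * \<omega>"
  have "u * v = of_rat (x * x') + of_rat (x * y' + y * x') * \<omega> + of_rat (y * y') * (\<omega> * \<omega>)"
    unfolding uv by (simp add: of_rat_add of_rat_mult algebra_simps)
  also have "\<dots> = of_rat (x * x' - y * y' * of_int \<kappa>) + of_rat (x * y' + y * x' + y * y' * of_int \<tau>) * \<omega>"
    unfolding om2 by (simp add: of_rat_add of_rat_diff of_rat_mult algebra_simps)
  finally show ?thesis using F_mem by simp
qed

lemma F_cnj: "u \<in> F \<Longrightarrow> cnj u \<in> F"
proof (elim FE)
  fix x y assume u: "u = of_rat x + of_rat y * \<omega>"
  note c = cnj_of_rat
  have "cnj u = of_rat (x + y * of_int \<tau>) + of_rat (- y) * \<omega>"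
    unfolding u by (simp add: c cnj_om of_rat_add of_rat_mult of_rat_minus algebra_simps)
  then show ?thesis using F_mem by simp
qed

lemma F_norm_trace:
  assumes "u \<in> F"
  shows "\<exists>q. u * cnj u = of_rat q" "\<exists>q. u + cnj u = of_rat q"
proof -
  obtain x y where u: "u = of_rat x + of_rat y * \<omega>" using assms by (rule FE)
  note c = cnj_of_rat
  have "u + cnj u = of_rat (2 * x + y * of_int \<tau>)"
    unfolding u by (simp add: c cnj_om of_rat_add of_rat_mult algebra_simps)
  then show "\<exists>q. u + cnj u = of_rat q" by blast
  have "u * cnj u = of_rat x * of_rat x + of_rat x * of_rat y * of_int \<tau>
      + of_rat y * of_rat y * of_int \<tau> * \<omega> - of_rat y * of_rat y * (\<omega> * \<omega>)"
    unfolding u by (simp add: c cnj_om algebra_simps)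
  also have "\<dots> = of_rat (x * x + x * y * of_int \<tau> + y * y * of_int \<kappa>)"
    unfolding om2 by (simp add: of_rat_add of_rat_mult algebra_simps)
  finally show "\<exists>q. u * cnj u = of_rat q" by blast
qed

lemma F_inverse: "u \<in> F \<Longrightarrow> inverse u \<in> F"
proof (cases "u = 0")
  case True
  then show ?thesis using F_int[of 0] by simp
next
  case False
  assume u: "u \<in> F"
  obtain q where q: "u * cnj u = of_rat q" using F_norm_trace[OF u] by blast
  have "inverse u = of_rat (inverse q) * cnj u"
    using False q[symmetric] by (simp add: of_rat_inverse)
  then show ?thesis using F_mult[OF F_rat F_cnj[OF u]] by simp
qed

lemma F_divide: "u \<in> F \<Longrightarrow> v \<in> F \<Longrightarrow> u / v \<in> F"
  using F_mult[of u "inverse v"] F_inverse[of v] by (simp add: divide_inverse)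

lemma R_subset_F: "R \<subseteq> F"
proof
  fix z assume "z \<in> R"
  then obtain x y where "z = of_int x * 1 + of_int y * \<omega>" unfolding R_def by (rule latE)
  then show "z \<in> F" using F_mem[of "of_int x" "of_int y"] by simp
qed

lemma add_subgroup_R: "add_subgroup R"
  unfolding R_def by (rule add_subgroup_lat)

lemma R_int: "of_int k \<in> R"
  using lat_mem[of k 1 0 \<omega>] by (simp add: R_def)

lemma R_1: "1 \<in> R"
  using R_int[of 1] by simp

lemma R_om: "\<omega> \<in> R"
  by (simp add: R_def lat_gens)

lemma R_mult: "u \<in> R \<Longrightarrow> v \<in> R \<Longrightarrow> u * v \<in> R"
  unfolding R_def
proof (elim latE)
  fix x y x' y' assume uv: "u = of_int x * 1 + of_int y * \<omega>" "v = of_int x' * 1 + of_int y' * \<omega>"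
  have "u * v = of_int (x * x') + of_int (x * y' + y * x') * \<omega> + of_int (y * y') * (\<omega> * \<omega>)"
    unfolding uv by (simp add: algebra_simps)
  also have "\<dots> = of_int (x * x' - y * y' * \<kappa>) * 1 + of_int (x * y' + y * x' + y * y' * \<tau>) * \<omega>"
    unfolding om2 by (simp add: algebra_simps)
  finally show "u * v \<in> lat 1 \<omega>" by (simp only: lat_mem)
qed

lemma R_cnj: "u \<in> R \<Longrightarrow> cnj u \<in> R"
  unfolding R_def
proof (elim latE)
  fix x y assume u: "u = of_int x * 1 + of_int y * \<omega>"
  have "cnj u = of_int (x + y * \<tau>) * 1 + of_int (- y) * \<omega>"
    unfolding u by (simp add: cnj_om algebra_simps)
  then show "cnj u \<in> lat 1 \<omega>" by (simp only: lat_mem)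
qed

lemma F_denominator:
  assumes "u \<in> F"
  shows "\<exists>k::int>0. of_int k * u \<in> R"
proof -
  obtain x y where u: "u = of_rat x + of_rat y * \<omega>" using assms by (rule FE)
  have "\<exists>d m. d > 0 \<and> q = of_int m / of_int d" for q :: rat
    using quotient_of_div[of q] quotient_of_denom_pos[of q] by (metis prod.collapse)
  then obtain d1 m1 d2 m2 where d: "d1 > 0" "d2 > 0" and eq: "x = of_int m1 / of_int d1" "y = of_int m2 / of_int d2"
    by metis
  have "of_int (d1 * d2) * u = of_int (m1 * d2) * 1 + of_int (m2 * d1) * \<omega>"
    unfolding u eq using d by (simp add: of_rat_divide field_simps)
  then have "of_int (d1 * d2) * u \<in> R"
    using lat_mem unfolding R_def by metis
  then show ?thesis using d by (intro exI[of _ "d1 * d2"]) auto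
qed

lemma R_rat:
  assumes "of_rat q \<in> R"
  shows "\<exists>m. q = of_int m"
proof -
  obtain x y where "of_rat q = of_int x * 1 + of_int y * \<omega>"
    using assms unfolding R_def by (rule latE)
  then have "of_real (of_rat q) * 1 + of_real 0 * \<omega> = of_real (of_int x) * 1 + of_real (of_int y) * \<omega>"
    by (simp add: of_real_of_rat)
  then have "of_rat q = (of_int x :: real)"
    using lat_coord_unique(1)[OF area_1_om] by blast
  then have "of_rat q = (of_rat (of_int x) :: real)" by simp
  then have "q = of_int x" unfolding of_rat_eq_iff .
  then show ?thesis by blast
qed

text \<open>Norm and trace are rational and lie in R, and R meets the rationals in the
  integers.\<close>

lemma R_norm_trace:
  assumes "u \<in> R"
  shows "\<exists>m::int. u * cnj u = of_int m" "\<exists>m::int. u + cnj u = of_int m"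
proof -
  have "u \<in> F" using assms R_subset_F by blast
  then obtain p q where pq: "u * cnj u = of_rat p" "u + cnj u = of_rat q"
    using F_norm_trace by meson
  moreover have "u * cnj u \<in> R" "u + cnj u \<in> R"
    using assms by (auto intro: R_mult R_cnj add_subgroup_add[OF add_subgroup_R])
  ultimately obtain k l where kl: "p = of_int k" "q = of_int l"
    using R_rat[of p] R_rat[of q] by metis
  have "u * cnj u = of_int k" "u + cnj u = of_int l" using pq kl by simp_all
  then show "\<exists>m::int. u * cnj u = of_int m" "\<exists>m::int. u + cnj u = of_int m" by blast+
qed

lemma quadratic_integer:
  assumes "z \<in> F" "z * z = of_int p * z - of_int q"
  shows "z \<in> R"
proof -
  have "poly [:of_int q, - of_int p, 1:] z = 0"
    using assms(2) by (simp add: algebra_simps)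
  then have "algebraic_int z"
    by (intro algebraic_int.intros[of "[:of_int q, - of_int p, 1:]"])
       (auto simp: coeff_pCons split: nat.splits)
  then show ?thesis
    using assms(1) maximal unfolding R_def by (auto elim!: FE)
qed

text \<open>Commensurability with R, by one integer k for both directions. In this form stability
  under homothety, conjugation and products is immediate; a basis is recovered in
  \<open>is_lat_basis\<close>.\<close>

definition is_lat :: "complex set \<Rightarrow> bool" where
  "is_lat K \<longleftrightarrow> add_subgroup K \<and> (\<exists>k::int>0. (\<forall>x\<in>R. of_int k * x \<in> K) \<and> (\<forall>x\<in>K. of_int k * x \<in> R))"

lemma is_latI:
  assumes "add_subgroup K" "k > 0" "\<And>x. x \<in> R \<Longrightarrow> of_int k * x \<in> K" "\<And>x. x \<in> K \<Longrightarrow> of_int k * x \<in> R"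
  shows "is_lat K"
  using assms unfolding is_lat_def by blast

lemma is_latE:
  assumes "is_lat K"
  obtains k where "k > 0" "\<And>x. x \<in> R \<Longrightarrow> of_int k * x \<in> K" "\<And>x. x \<in> K \<Longrightarrow> of_int k * x \<in> R"
  using assms unfolding is_lat_def by blast

lemma is_lat_subgroup: "is_lat K \<Longrightarrow> add_subgroup K"
  by (simp add: is_lat_def)

lemma is_lat_R: "is_lat R"
  by (rule is_latI[of _ 1]) (auto simp: add_subgroup_R)

lemma is_lat_subset_F: "is_lat K \<Longrightarrow> K \<subseteq> F"
proof
  fix x assume "is_lat K" "x \<in> K"
  then obtain k :: int where k: "k > 0" "of_int k * x \<in> R" by (auto elim: is_latE)
  have "x = of_int k * x / of_int k" using k by simp
  also have "\<dots> \<in> F" using k R_subset_F by (intro F_divide F_int) auto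
  finally show "x \<in> F" .
qed

lemma is_lat_basis:
  assumes "is_lat K"
  shows "\<exists>\<alpha> \<beta>. area \<alpha> \<beta> \<noteq> 0 \<and> K = lat \<alpha> \<beta>"
proof -
  obtain k where k: "k > 0" "\<And>x. x \<in> R \<Longrightarrow> of_int k * x \<in> K" "\<And>x. x \<in> K \<Longrightarrow> of_int k * x \<in> R"
    using is_latE[OF assms] by blast
  \<comment> \<open>Multiplication by k pushes K into R, where \<open>sublattice\<close> applies;
    the basis found there is scaled back.\<close>
  let ?K = "(*) (of_int k) ` K"
  have "add_subgroup ?K"
    by (rule add_subgroup_image[OF is_lat_subgroup[OF assms]]) (simp add: algebra_simps)
  moreover have "?K \<subseteq> lat 1 \<omega>" using k(3) by (auto simp: R_def)
  moreover have "of_int (k * k) * x \<in> ?K" if "x \<in> lat 1 \<omega>" for x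
    using k(2) that by (auto simp: R_def mult.assoc)
  ultimately obtain \<gamma> \<delta> where *: "area \<gamma> \<delta> \<noteq> 0" "?K = lat \<gamma> \<delta>"
    using sublattice(1)[OF area_1_om, of ?K "k * k"] k(1) by auto
  let ?u = "inverse (of_int k) :: complex"
  have "K = (*) ?u ` ?K"
    using k(1) by (auto simp: image_image field_simps)
  then have "K = lat (?u * \<gamma>) (?u * \<delta>)"
    unfolding *(2) image_mult_lat .
  moreover have "area (?u * \<gamma>) (?u * \<delta>) \<noteq> 0"
    using *(1) k(1) by (simp add: area_mult)
  ultimately show ?thesis by blast
qed

lemma covol_pos: "is_lat K \<Longrightarrow> covol K > 0"
  using is_lat_basis[of K] covol_lat by auto

lemma covol_scale:
  assumes "is_lat K" "u \<noteq> 0"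
  shows "covol ((*) u ` K) = (cmod u)\<^sup>2 * covol K"
proof -
  obtain \<alpha> \<beta> where *: "area \<alpha> \<beta> \<noteq> 0" "K = lat \<alpha> \<beta>" using is_lat_basis assms by blast
  then have "area (u * \<alpha>) (u * \<beta>) \<noteq> 0" using assms by (simp add: area_mult)
  then show ?thesis
    using * unfolding *(2) image_mult_lat by (simp add: covol_lat area_mult abs_mult)
qed

lemma is_lat_scale:
  assumes "is_lat K" "u \<in> F" "u \<noteq> 0"
  shows "is_lat ((*) u ` K)"
proof -
  obtain k where k: "k > 0" "\<And>x. x \<in> R \<Longrightarrow> of_int k * x \<in> K" "\<And>x. x \<in> K \<Longrightarrow> of_int k * x \<in> R"
    using is_latE[OF assms(1)] by blast
  obtain l :: int where l: "l > 0" "of_int l * u \<in> R" using F_denominator[OF assms(2)] by blast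
  obtain l' :: int where l': "l' > 0" "of_int l' * inverse u \<in> R"
    using F_denominator[OF F_inverse[OF assms(2)]] by blast
  show ?thesis
  proof (rule is_latI[of _ "k * l * l'"])
    show "add_subgroup ((*) u ` K)"
      by (rule add_subgroup_image[OF is_lat_subgroup[OF assms(1)]]) (simp add: algebra_simps)
    show "k * l * l' > 0" using k l l' by simp
    show "of_int (k * l * l') * x \<in> (*) u ` K" if "x \<in> R" for x
    proof -
      have "of_int k * (of_int l * (of_int l' * inverse u) * x) \<in> K"
        by (intro k(2) R_mult R_int l' that)
      then have "u * (of_int k * (of_int l * (of_int l' * inverse u) * x)) \<in> (*) u ` K" by blast
      then show ?thesis using assms(3) by (simp add: field_simps)
    qed
    show "of_int (k * l * l') * x \<in> R" if "x \<in> (*) u ` K" for x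
    proof -
      obtain y where y: "y \<in> K" "x = u * y" using \<open>x \<in> _\<close> by blast
      have "of_int l' * (of_int l * u) * (of_int k * y) \<in> R"
        by (intro R_mult R_int l k y)
      then show ?thesis by (simp add: y algebra_simps)
    qed
  qed
qed

lemma is_lat_cnj:
  assumes "is_lat K"
  shows "is_lat (cnj ` K)"
proof -
  obtain k where k: "k > 0" "\<And>x. x \<in> R \<Longrightarrow> of_int k * x \<in> K" "\<And>x. x \<in> K \<Longrightarrow> of_int k * x \<in> R"
    using is_latE[OF assms(1)] by blast
  show ?thesis
  proof (rule is_latI[of _ k])
    show "add_subgroup (cnj ` K)"
      by (rule add_subgroup_image[OF is_lat_subgroup[OF assms(1)]]) simp
    show "k > 0" by fact
    show "of_int k * x \<in> cnj ` K" if "x \<in> R" for x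
      using imageI[OF k(2)[OF R_cnj[OF that]], of cnj] by simp
    show "of_int k * x \<in> R" if "x \<in> cnj ` K" for x
      using that R_cnj[OF k(3)] by auto
  qed
qed

lemma is_lat_prd:
  assumes "is_lat I" "is_lat J"
  shows "is_lat (I \<star> J)"
proof -
  obtain k where k: "k > 0" "\<And>x. x \<in> R \<Longrightarrow> of_int k * x \<in> I" "\<And>x. x \<in> I \<Longrightarrow> of_int k * x \<in> R"
    using is_latE[OF assms(1)] by blast
  obtain l where l: "l > 0" "\<And>x. x \<in> R \<Longrightarrow> of_int l * x \<in> J" "\<And>x. x \<in> J \<Longrightarrow> of_int l * x \<in> R"
    using is_latE[OF assms(2)] by blast
  show ?thesis
  proof (rule is_latI[of _ "k * l"])
    show "add_subgroup (I \<star> J)"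
      by (intro add_subgroup_prd is_lat_subgroup assms)
    show "k * l > 0" using k l by simp
    show "of_int (k * l) * x \<in> I \<star> J" if "x \<in> R" for x
      using prdI[OF k(2)[OF that] l(2)[OF R_1]] by (simp add: algebra_simps)
    show "of_int (k * l) * x \<in> R" if "x \<in> I \<star> J" for x
      using that
    proof (induction rule: prd_induct)
      case (prod i j)
      then show ?case using R_mult[OF k(3) l(3), of i j] by (simp add: algebra_simps)
    next
      case (sum x y)
      then show ?case using add_subgroup_add[OF add_subgroup_R] by (simp add: algebra_simps)
    qed
  qed
qed

lemma is_lat_index:
  assumes "is_lat M" "is_lat K" "K \<subseteq> M"
  shows "lattice_index M K > 0" "covol K = lattice_index M K * covol M"
proof -
  obtain \<alpha> \<beta> where M: "area \<alpha> \<beta> \<noteq> 0" "M = lat \<alpha> \<beta>" using is_lat_basis assms by blast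
  obtain k where k: "k > 0" "\<And>x. x \<in> R \<Longrightarrow> of_int k * x \<in> K"
    using is_latE[OF assms(2)] by blast
  obtain l where l: "l > 0" "\<And>x. x \<in> M \<Longrightarrow> of_int l * x \<in> R"
    using is_latE[OF assms(1)] by blast
  have kl: "of_int (k * l) * x \<in> K" if "x \<in> lat \<alpha> \<beta>" for x
    using k(2)[OF l(2)] that M(2) by (simp add: mult.assoc)
  show "lattice_index M K > 0" "covol K = lattice_index M K * covol M"
    using sublattice(2,3)[OF M(1), of K "k * l"] kl k(1) l(1) assms is_lat_subgroup[OF assms(2)]
    unfolding M(2) by auto
qed

lemma is_lat_finite_index:
  assumes "is_lat M" "add_subgroup K" "K \<subseteq> M" "lattice_index M K > 0"
  shows "is_lat K"
proof -
  obtain \<alpha> \<beta> where M: "area \<alpha> \<beta> \<noteq> 0" "M = lat \<alpha> \<beta>" using is_lat_basis assms by blast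
  obtain l where l: "l > 0" "\<And>x. x \<in> M \<Longrightarrow> of_int l * x \<in> R" "\<And>x. x \<in> R \<Longrightarrow> of_int l * x \<in> M"
    using is_latE[OF assms(1)] by blast
  obtain k :: int where k: "k > 0" "\<forall>x\<in>M. of_int k * x \<in> K"
    using finite_index_multiple_lat[OF M(1) assms(2)] assms(4) unfolding M(2) by blast
  show ?thesis
  proof (rule is_latI[OF assms(2), of "k * l"])
    show "k * l > 0" using k l by simp
    show "of_int (k * l) * x \<in> K" if "x \<in> R" for x
      using k(2) l(3)[OF that] by (simp add: mult.assoc)
    show "of_int (k * l) * x \<in> R" if "x \<in> K" for x
      using R_mult[OF R_int l(2), of x k] that assms(3) by (auto simp: mult.assoc)
  qed
qed

lemma is_lat_between:
  assumes "is_lat M" "is_lat K" "add_subgroup N" "K \<subseteq> N" "N \<subseteq> M"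
  shows "is_lat N"
proof -
  obtain k where k: "k > 0" "\<And>x. x \<in> R \<Longrightarrow> of_int k * x \<in> K"
    using is_latE[OF assms(2)] by blast
  obtain l where l: "l > 0" "\<And>x. x \<in> M \<Longrightarrow> of_int l * x \<in> R"
    using is_latE[OF assms(1)] by blast
  show ?thesis
  proof (rule is_latI[OF assms(3), of "k * l"])
    show "k * l > 0" using k l by simp
    show "of_int (k * l) * x \<in> N" if "x \<in> R" for x
      using k(2)[OF R_mult[OF R_int that, of l]] assms(4) by (auto simp: mult.assoc)
    show "of_int (k * l) * x \<in> R" if "x \<in> N" for x
      using R_mult[OF R_int l(2), of x k] that assms(5) by (auto simp: mult.assoc)
  qed
qed

text \<open>For an ideal this is the absolute norm.\<close>

definition nu :: "complex set \<Rightarrow> real" where "nu K = covol K / covol R"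

lemma nu_pos: "is_lat K \<Longrightarrow> nu K > 0"
  by (simp add: nu_def covol_pos is_lat_R)

lemma nu_R: "nu R = 1"
  using covol_pos[OF is_lat_R] by (simp add: nu_def)

lemma nu_scale: "is_lat K \<Longrightarrow> u \<noteq> 0 \<Longrightarrow> nu ((*) u ` K) = (cmod u)\<^sup>2 * nu K"
  by (simp add: nu_def covol_scale)

lemma nu_index:
  assumes "is_lat M" "is_lat K" "K \<subseteq> M"
  shows "nu K = lattice_index M K * nu M" "lattice_index M K > 0"
  using is_lat_index[OF assms] by (simp_all add: nu_def)

text \<open>Equal covolume means index 1, hence a single coset. This is the device by which
  inclusions become equalities.\<close>

lemma lattice_eq_if_nu_eq:
  assumes "is_lat M" "is_lat K" "K \<subseteq> M" "nu K = nu M"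
  shows "K = M"
proof -
  have "lattice_index M K = 1"
    using nu_index[OF assms(1-3)] assms(4) nu_pos[OF assms(1)] by simp
  then obtain C where "(\<lambda>x. (+) x ` K) ` M = {C}"
    unfolding lattice_index_def by (rule card_1_singletonE)
  then have "(+) x ` K = (+) 0 ` K" if "x \<in> M" for x
    using that add_subgroup_0[OF is_lat_subgroup[OF assms(1)]] by (metis imageI singletonD)
  then have "x - 0 \<in> K" if "x \<in> M" for x
    using that coset_eq_iff[OF is_lat_subgroup[OF assms(2)]] by metis
  then show ?thesis using assms(3) by auto
qed

text \<open>These are the nonzero fractional ideals of \<open>R\<close>.\<close>

definition fideal :: "complex set \<Rightarrow> bool" where
  "fideal J \<longleftrightarrow> is_lat J \<and> (\<forall>x\<in>R. \<forall>y\<in>J. x * y \<in> J)"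

lemma fideal_is_lat: "fideal J \<Longrightarrow> is_lat J"
  and fideal_mult: "fideal J \<Longrightarrow> x \<in> R \<Longrightarrow> y \<in> J \<Longrightarrow> x * y \<in> J"
  by (auto simp: fideal_def)

lemma fideal_subgroup: "fideal J \<Longrightarrow> add_subgroup J"
  by (simp add: fideal_is_lat is_lat_subgroup)

lemma fideal_R: "fideal R"
  using R_mult is_lat_R by (auto simp: fideal_def)

lemma R_prd:
  assumes "fideal J"
  shows "R \<star> J = J"
proof
  show "R \<star> J \<subseteq> J"
    by (rule prd_subset[OF fideal_subgroup[OF assms]]) (rule fideal_mult[OF assms])
  show "J \<subseteq> R \<star> J"
    using prdI[OF R_1] by fastforce
qed

lemma fideal_scale:
  assumes "fideal J" "u \<in> F" "u \<noteq> 0"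
  shows "fideal ((*) u ` J)"
  using assms is_lat_scale unfolding fideal_def by (auto simp: mult.left_commute)

lemma fideal_cnj:
  assumes "fideal J"
  shows "fideal (cnj ` J)"
  unfolding fideal_def
proof (intro conjI ballI)
  show "is_lat (cnj ` J)" using assms by (simp add: fideal_def is_lat_cnj)
  fix x y assume "x \<in> R" "y \<in> cnj ` J"
  then show "x * y \<in> cnj ` J"
    using imageI[OF fideal_mult[OF assms R_cnj[OF \<open>x \<in> R\<close>]], of _ cnj] by auto
qed

lemma fideal_prd_left:
  assumes "fideal I" "is_lat J"
  shows "fideal (I \<star> J)"
  unfolding fideal_def
proof (intro conjI ballI)
  show "is_lat (I \<star> J)" using assms by (simp add: fideal_is_lat is_lat_prd)
  fix x y assume x: "x \<in> R" and "y \<in> I \<star> J"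
  from this(2) show "x * y \<in> I \<star> J"
  proof (induction rule: prd_induct)
    case (prod i j)
    then show ?case
      using prdI[OF fideal_mult[OF assms(1) x]] by (simp flip: mult.assoc)
  next
    case (sum y z)
    then show ?case using prd_add by (simp add: algebra_simps)
  qed
qed

lemma fideal_prd: "fideal I \<Longrightarrow> fideal J \<Longrightarrow> fideal (I \<star> J)"
  by (rule fideal_prd_left[OF _ fideal_is_lat])

end


section \<open>Invertibility of fractional ideals and multiplicativity of the norm\<close>

context imag_quadratic
begin

text \<open>If \<open>J = \<int>\<alpha> + \<int>\<beta>\<close> has the norm form \<open>r (a x\<^sup>2 + t x y + c y\<^sup>2)\<close> with \<open>a, t, c\<close> coprime,
  then \<open>\<theta> = cnj \<alpha> * \<beta> / r\<close> is integral, and primitivity of the form forces \<open>R = \<int> + \<int>\<theta>\<close>.\<close>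

lemma fideal_cnj_aux:
  assumes J: "fideal J"
  shows "J \<star> cnj ` J = (*) (of_real (nu J)) ` R \<and> (\<exists>q. nu J = of_rat q)"
proof -
  obtain \<alpha> \<beta> where ar: "area \<alpha> \<beta> \<noteq> 0" and Jeq: "J = lat \<alpha> \<beta>"
    using is_lat_basis[OF fideal_is_lat[OF J]] by blast
  have mem: "\<alpha> \<in> J" "\<beta> \<in> J" using lat_gens Jeq by auto
  then have memF: "\<alpha> \<in> F" "\<beta> \<in> F" using is_lat_subset_F[OF fideal_is_lat[OF J]] by auto
  have \<alpha>0: "\<alpha> \<noteq> 0" using ar by (auto simp: area_def)
  obtain A where A: "\<alpha> * cnj \<alpha> = of_rat A" using F_norm_trace(1)[OF memF(1)] by blast
  obtain C where C: "\<beta> * cnj \<beta> = of_rat C" using F_norm_trace(1)[OF memF(2)] by blast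
  obtain T where T: "cnj \<alpha> * \<beta> + \<alpha> * cnj \<beta> = of_rat T"
    using F_norm_trace(2)[OF F_mult[OF F_cnj[OF memF(1)] memF(2)]] by auto
  have "A > 0"
  proof -
    have "(cmod \<alpha>)\<^sup>2 = of_rat A"
      using A by (intro cmod_square_eq) (simp only: of_real_of_rat)
    moreover have "(cmod \<alpha>)\<^sup>2 > 0" using \<alpha>0 by simp
    ultimately have "(of_rat A :: real) > 0" by (simp only:)
    then show ?thesis by simp
  qed
  then obtain r a t c where r: "r > 0" and atc: "A = r * of_int a" "T = r * of_int t" "C = r * of_int c"
    and prim: "gcd a (gcd t c) = 1"
    using ex_primitive_ratio by meson
  define \<rho> :: complex where "\<rho> = of_rat r"
  have \<rho>0: "\<rho> \<noteq> 0" using r by (simp add: \<rho>_def)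
  have a0: "a \<noteq> 0" using \<open>A > 0\<close> atc by auto
  define \<theta> where "\<theta> = cnj \<alpha> * \<beta> / \<rho>"
  have c\<rho>: "cnj \<rho> = \<rho>" by (simp add: \<rho>_def cnj_of_rat)
  have N\<alpha>: "\<alpha> * cnj \<alpha> = \<rho> * of_int a" and N\<beta>: "\<beta> * cnj \<beta> = \<rho> * of_int c"
    using A C atc by (simp_all add: \<rho>_def of_rat_mult)
  have \<theta>: "cnj \<alpha> * \<beta> = \<rho> * \<theta>" "\<alpha> * cnj \<beta> = \<rho> * cnj \<theta>"
    using \<rho>0 by (simp_all add: \<theta>_def c\<rho>)
  have tr: "\<theta> + cnj \<theta> = of_int t"
  proof -
    have "\<rho> * (\<theta> + cnj \<theta>) = \<rho> * of_int t"
      using T \<theta> atc by (simp add: \<rho>_def of_rat_mult distrib_left)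
    then show ?thesis using \<rho>0 by simp
  qed
  have nm: "\<theta> * cnj \<theta> = of_int (a * c)"
  proof -
    have "(\<rho> * \<theta>) * (\<rho> * cnj \<theta>) = (\<alpha> * cnj \<alpha>) * (\<beta> * cnj \<beta>)"
      unfolding \<theta>[symmetric] by (simp add: mult_ac)
    then have "\<rho> * \<rho> * (\<theta> * cnj \<theta>) = \<rho> * \<rho> * of_int (a * c)"
      unfolding N\<alpha> N\<beta> by (simp add: mult_ac)
    then show ?thesis using \<rho>0 by simp
  qed
  have \<theta>sq: "\<theta> * \<theta> = of_int t * \<theta> - of_int (a * c)"
  proof -
    have "\<theta> * \<theta> = (\<theta> + cnj \<theta>) * \<theta> - \<theta> * cnj \<theta>" by (simp add: algebra_simps)
    then show ?thesis unfolding tr nm .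
  qed
  have "\<theta> \<in> F"
    unfolding \<theta>_def \<rho>_def by (intro F_divide F_mult F_cnj memF F_rat)
  then have \<theta>R: "\<theta> \<in> R" using \<theta>sq by (rule quadratic_integer)
  have area_\<theta>: "area \<alpha> \<beta> = of_rat r * area 1 \<theta>"
  proof -
    have "Im (of_real (of_rat r) * \<theta>) = of_rat r * Im \<theta>" by simp
    then show ?thesis
      unfolding area_def \<theta>(1) \<rho>_def by (simp add: of_real_of_rat)
  qed
  then have ar\<theta>: "area 1 \<theta> \<noteq> 0" using ar by auto
  \<comment> \<open>J is stable under \<omega>. The action on \<alpha>, \<beta> is an integer
    matrix, and comparing coefficients in the basis 1, \<theta> shows that \<omega> has integral
    coordinates there.\<close>
  have "\<omega> \<in> lat 1 \<theta>"
  proof -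
    obtain p q where pq: "\<omega> * \<alpha> = of_int p * \<alpha> + of_int q * \<beta>"
      using fideal_mult[OF J R_om mem(1)] unfolding Jeq by (rule latE)
    obtain s u where su: "\<omega> * \<beta> = of_int s * \<alpha> + of_int u * \<beta>"
      using fideal_mult[OF J R_om mem(2)] unfolding Jeq by (rule latE)
    have "\<omega> * (\<alpha> * cnj \<alpha>) = of_int p * (\<alpha> * cnj \<alpha>) + of_int q * (cnj \<alpha> * \<beta>)"
      using arg_cong[OF pq, of "\<lambda>z. z * cnj \<alpha>"] by (simp add: algebra_simps)
    then have "\<rho> * (\<omega> * of_int a) = \<rho> * (of_int p * of_int a + of_int q * \<theta>)"
      unfolding N\<alpha> \<theta> by (simp add: algebra_simps)
    then have e1: "\<omega> * of_int a = of_int p * of_int a + of_int q * \<theta>"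
      using \<rho>0 by simp
    have "\<omega> * (cnj \<alpha> * \<beta>) = of_int s * (\<alpha> * cnj \<alpha>) + of_int u * (cnj \<alpha> * \<beta>)"
      using arg_cong[OF su, of "\<lambda>z. z * cnj \<alpha>"] by (simp add: algebra_simps)
    then have "\<rho> * (\<omega> * \<theta>) = \<rho> * (of_int s * of_int a + of_int u * \<theta>)"
      unfolding N\<alpha> \<theta> by (simp add: algebra_simps)
    then have e2: "\<omega> * \<theta> = of_int s * of_int a + of_int u * \<theta>"
      using \<rho>0 by simp
    have "of_int a * (of_int s * of_int a + of_int u * \<theta>) = (\<omega> * of_int a) * \<theta>"
      unfolding e2[symmetric] by simp
    also have "\<dots> = of_int (p * a) * \<theta> + of_int q * (\<theta> * \<theta>)"
      unfolding e1 by (simp add: algebra_simps)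
    also have "\<dots> = of_real (of_int (- q * (a * c))) * 1 + of_real (of_int (p * a + q * t)) * \<theta>"
      unfolding \<theta>sq by (simp add: algebra_simps)
    finally have "of_real (of_int (a * (s * a))) * 1 + of_real (of_int (a * u)) * \<theta>
        = of_real (of_int (- q * (a * c))) * 1 + of_real (of_int (p * a + q * t)) * \<theta>"
      by (simp add: algebra_simps)
    from lat_coord_unique[OF ar\<theta> this]
    have "a * (s * a) = - q * (a * c)" "a * u = p * a + q * t"
      by (simp_all only: of_int_eq_iff)
    then have "a * (s * a + q * c) = 0" and qt: "q * t = a * (u - p)"
      by (simp_all add: algebra_simps)
    then have "s * a + q * c = 0" using a0 by simp
    then have "q * c = a * (- s)"
      by (simp add: eq_neg_iff_add_eq_0 algebra_simps)
    with qt have "a dvd q * c" "a dvd q * t"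
      by (blast intro: dvdI)+
    moreover have "a dvd q * a" by simp
    \<comment> \<open>a divides q times each coefficient of a form with coprime coefficients, so a
      divides q. This is where primitivity is used.\<close>
    ultimately have "a dvd gcd (q * a) (gcd (q * t) (q * c))"
      by (intro gcd_greatest)
    also have "gcd (q * a) (gcd (q * t) (q * c)) = \<bar>q\<bar> * gcd a (gcd t c)"
      by (simp add: gcd_mult_left abs_mult)
    finally have "a dvd q" using prim by simp
    then obtain q' where q': "q = a * q'" by blast
    have "of_int a * \<omega> = of_int a * (of_int p * 1 + of_int q' * \<theta>)"
      using e1 unfolding q' by (simp add: algebra_simps)
    then have "\<omega> = of_int p * 1 + of_int q' * \<theta>" using a0 by simp
    then show ?thesis by (simp only: lat_mem)
  qed
  then have "R \<subseteq> lat 1 \<theta>"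
    unfolding R_def lat_subset_iff using lat_gens by blast
  \<comment> \<open>Maximality of R enters here, through the integrality of \<theta>.\<close>
  moreover have "lat 1 \<theta> \<subseteq> R"
    by (rule lat_subset[OF add_subgroup_R R_1 \<theta>R])
  ultimately have Req: "R = lat 1 \<theta>" by blast
  have nu: "nu J = of_rat r"
    using ar\<theta> r unfolding nu_def Req Jeq covol_lat[OF ar\<theta>] covol_lat[OF ar] area_\<theta>
    by (simp add: abs_mult)
  have "J \<star> cnj ` J = (*) \<rho> ` R"
  proof
    show "J \<star> cnj ` J \<subseteq> (*) \<rho> ` R"
    proof (rule prd_subset)
      show "add_subgroup ((*) \<rho> ` R)"
        by (rule add_subgroup_image[OF add_subgroup_R]) (simp add: algebra_simps)
      fix i j assume "i \<in> J" "j \<in> cnj ` J"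
      then obtain x y x' y' where ij: "i = of_int x * \<alpha> + of_int y * \<beta>" "j = cnj (of_int x' * \<alpha> + of_int y' * \<beta>)"
        unfolding Jeq by (auto elim!: latE)
      have "i * j = of_int (x * x') * (\<alpha> * cnj \<alpha>) + of_int (y * y') * (\<beta> * cnj \<beta>)
          + of_int (x * y') * (\<alpha> * cnj \<beta>) + of_int (y * x') * (cnj \<alpha> * \<beta>)"
        unfolding ij by (simp add: algebra_simps)
      also have "\<dots> = \<rho> * (of_int (x * x' * a) + of_int (y * y' * c) + of_int (x * y') * cnj \<theta> + of_int (y * x') * \<theta>)"
        unfolding \<theta> N\<alpha> N\<beta> by (simp add: algebra_simps)
      finally show "i * j \<in> (*) \<rho> ` R"
        using \<theta>R R_cnj[OF \<theta>R] by (auto intro!: imageI add_subgroup_add[OF add_subgroup_R] R_mult R_int)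
    qed
    have sg: "add_subgroup (J \<star> cnj ` J)"
      by (intro is_lat_subgroup is_lat_prd is_lat_cnj fideal_is_lat J)
    have cm: "cnj \<alpha> \<in> cnj ` J" "cnj \<beta> \<in> cnj ` J" using mem by auto
    have g: "\<rho> * of_int a \<in> J \<star> cnj ` J" "\<rho> * of_int c \<in> J \<star> cnj ` J" "\<rho> * \<theta> \<in> J \<star> cnj ` J" "\<rho> * cnj \<theta> \<in> J \<star> cnj ` J"
      using prdI[OF mem(1) cm(1)] prdI[OF mem(2) cm(2)] prdI[OF mem(2) cm(1)] prdI[OF mem(1) cm(2)]
      by (simp_all add: N\<alpha> N\<beta> \<theta> mult.commute[of \<beta> "cnj \<alpha>"])
    then have g2: "\<rho> * of_int t \<in> J \<star> cnj ` J"
      using add_subgroup_add[OF sg g(3,4)] by (simp add: tr[symmetric] distrib_left)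
    \<comment> \<open>Bezout for the coprime a, t, c writes \<rho> as an integral combination of
      products of generators of J with conjugates of generators.\<close>
    obtain x y where xy: "x * a + y * gcd t c = gcd a (gcd t c)" using bezout_int by blast
    obtain z w where zw: "z * t + w * c = gcd t c" using bezout_int by blast
    have "x * a + y * z * t + y * w * c = 1"
      using xy zw prim by (simp add: distrib_left algebra_simps flip: zw)
    then have "of_int (x * a + y * z * t + y * w * c) = (1 :: complex)" by simp
    then have "of_int x * (\<rho> * of_int a) + of_int (y * z) * (\<rho> * of_int t) + of_int (y * w) * (\<rho> * of_int c) = \<rho>"
      by (simp add: algebra_simps) (simp flip: distrib_left distrib_right add: mult_ac)
    then have "\<rho> \<in> J \<star> cnj ` J"
      using g g2 add_subgroup_add[OF sg] add_subgroup_of_int_mult[OF sg] by metis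
    then have "lat (\<rho> * 1) (\<rho> * \<theta>) \<subseteq> J \<star> cnj ` J"
      using g(3) by (intro lat_subset[OF sg]) simp_all
    then show "(*) \<rho> ` R \<subseteq> J \<star> cnj ` J"
      unfolding Req image_mult_lat .
  qed
  then show ?thesis
    using nu by (auto simp: \<rho>_def of_real_of_rat)
qed

lemma prd_cnj: "fideal J \<Longrightarrow> J \<star> cnj ` J = (*) (of_real (nu J)) ` R"
  using fideal_cnj_aux by blast

lemma nu_in_F: "fideal J \<Longrightarrow> of_real (nu J) \<in> F"
  using fideal_cnj_aux[of J] F_rat by (auto simp: of_real_of_rat)

lemma image_mult_mult: "(*) u ` ((*) v ` K) = (*) (u * v) ` (K :: complex set)"
  by (simp add: image_image mult.assoc)

lemma prd_scale: "I \<star> (*) u ` J = (*) u ` (I \<star> J)"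
  using scale_prd[of u J I] by (simp add: prd_comm)

text \<open>Regrouping the product of I, J and their conjugates gives two descriptions of one
  multiple of R. Comparing covolumes equates the squares of two positive numbers.\<close>

lemma nu_prd:
  assumes "fideal I" "fideal J"
  shows "nu (I \<star> J) = nu I * nu J"
proof -
  have pos: "nu I > 0" "nu J > 0" "nu (I \<star> J) > 0"
    using assms fideal_prd fideal_is_lat nu_pos by auto
  have "(*) (of_real (nu (I \<star> J))) ` R = (I \<star> J) \<star> (cnj ` I \<star> cnj ` J)"
    using prd_cnj[OF fideal_prd[OF assms]] by (simp add: cnj_prd)
  also have "\<dots> = (I \<star> cnj ` I) \<star> (J \<star> cnj ` J)" by (simp add: prd_ac)
  also have "\<dots> = (*) (of_real (nu I)) ` ((*) (of_real (nu J)) ` (R \<star> R))"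
    by (simp only: prd_cnj assms prd_scale scale_prd image_mult_mult
        mult.commute[of "complex_of_real (nu J)" "complex_of_real (nu I)"])
  also have "\<dots> = (*) (of_real (nu I * nu J)) ` R"
    by (simp add: R_prd[OF fideal_R] image_mult_mult)
  finally have "nu ((*) (of_real (nu (I \<star> J))) ` R) = nu ((*) (of_real (nu I * nu J)) ` R)" by simp
  then have "(nu (I \<star> J))\<^sup>2 = (nu I * nu J)\<^sup>2"
    using pos by (simp add: nu_scale is_lat_R nu_R norm_mult)
  then show ?thesis
    using pos by (simp add: power2_eq_iff_nonneg)
qed

text \<open>Since I times its conjugate is nu(I) R, the conjugate divided by the norm inverts
  I.\<close>

definition fideal_inv :: "complex set \<Rightarrow> complex set" where
  "fideal_inv I = (*) (of_real (inverse (nu I))) ` cnj ` I"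

lemma fideal_fideal_inv: "fideal I \<Longrightarrow> fideal (fideal_inv I)"
  unfolding fideal_inv_def using nu_pos[OF fideal_is_lat, of I] nu_in_F[of I] F_inverse[of "of_real (nu I)"]
  by (intro fideal_scale fideal_cnj) auto

lemma prd_fideal_inv: "fideal I \<Longrightarrow> I \<star> fideal_inv I = R"
proof -
  assume I: "fideal I"
  then have "of_real (nu I) \<noteq> (0 :: complex)" using nu_pos[OF fideal_is_lat[OF I]] by simp
  then show ?thesis
    unfolding fideal_inv_def prd_scale prd_cnj[OF I] image_mult_mult by simp
qed

lemma fideal_inv_prd: "fideal I \<Longrightarrow> fideal_inv I \<star> I = R"
  using prd_fideal_inv prd_comm by metis

lemma prd_fideal_inv_prd: "fideal I \<Longrightarrow> fideal J \<Longrightarrow> I \<star> (fideal_inv I \<star> J) = J"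
  by (simp add: prd_fideal_inv R_prd flip: prd_assoc)

lemma fideal_inv_prd_prd: "fideal I \<Longrightarrow> fideal J \<Longrightarrow> fideal_inv I \<star> (I \<star> J) = J"
  by (simp add: fideal_inv_prd R_prd flip: prd_assoc)

lemma nu_fideal_inv: "fideal I \<Longrightarrow> nu (fideal_inv I) = 1 / nu I"
  using nu_prd[OF _ fideal_fideal_inv, of I I] nu_pos[OF fideal_is_lat, of I] by (simp add: prd_fideal_inv nu_R field_simps)

text \<open>By way of covolumes the tower law needs no counting of cosets.\<close>

lemma lattice_index_trans:
  assumes "is_lat M" "is_lat J" "is_lat K" "K \<subseteq> J" "J \<subseteq> M"
  shows "lattice_index M K = lattice_index M J * lattice_index J K"
proof -
  have "real (lattice_index M K) * nu M = real (lattice_index M J * lattice_index J K) * nu M"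
    using nu_index(1)[OF assms(1,2,5)] nu_index(1)[OF assms(2,3,4)] nu_index(1)[OF assms(1,3)] assms(4,5)
    by (auto simp: mult_ac)
  then show ?thesis
    using nu_pos[OF assms(1)] by (metis mult_right_cancel of_nat_eq_iff less_irrefl)
qed

lemma lattice_index_nu:
  assumes "is_lat M" "is_lat K" "K \<subseteq> M"
  shows "lattice_index M K = m \<longleftrightarrow> nu K = real m * nu M"
  using nu_index(1)[OF assms] nu_pos[OF assms(1)] by auto

section \<open>Subgroups sorted by the ideal that they generate\<close>

definition ideals_of :: "complex set \<Rightarrow> nat \<Rightarrow> complex set set" where
  "ideals_of M n = {J. fideal J \<and> J \<subseteq> M \<and> lattice_index M J = n}"

lemma ideals_of_iff:
  assumes "is_lat M"
  shows "J \<in> ideals_of M n \<longleftrightarrow> fideal J \<and> J \<subseteq> M \<and> nu J = n * nu M"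
  unfolding ideals_of_def using lattice_index_nu[OF assms fideal_is_lat] by auto

definition subgroups_of :: "complex set \<Rightarrow> nat \<Rightarrow> complex set set" where
  "subgroups_of M m = {K. add_subgroup K \<and> K \<subseteq> M \<and> lattice_index M K = m}"

definition generating :: "complex set \<Rightarrow> nat \<Rightarrow> complex set set" where
  "generating J f = {K \<in> subgroups_of J f. R \<star> K = J}"

lemma card_subgroups_of:
  assumes "is_lat M" "m > 0"
  shows "finite (subgroups_of M m)" "card (subgroups_of M m) = \<Sum>{a. a dvd m}"
proof -
  obtain \<alpha> \<beta> where "area \<alpha> \<beta> \<noteq> 0" "M = lat \<alpha> \<beta>" using is_lat_basis assms by blast
  then show "finite (subgroups_of M m)" "card (subgroups_of M m) = \<Sum>{a. a dvd m}"
    using card_subgroups_lat assms(2) by (auto simp: subgroups_of_def)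
qed

lemma subgroups_of_is_lat: "is_lat M \<Longrightarrow> K \<in> subgroups_of M m \<Longrightarrow> m > 0 \<Longrightarrow> is_lat K"
  by (auto simp: subgroups_of_def intro: is_lat_finite_index)

lemma ideals_of_subset_subgroups_of: "ideals_of M n \<subseteq> subgroups_of M n"
  by (auto simp: ideals_of_def subgroups_of_def fideal_subgroup)

lemma finite_ideals_of: "is_lat M \<Longrightarrow> n > 0 \<Longrightarrow> finite (ideals_of M n)"
  using finite_subset[OF ideals_of_subset_subgroups_of card_subgroups_of(1)] .

lemma ideals_of_1: "fideal M \<Longrightarrow> ideals_of M 1 = {M}"
proof
  assume M: "fideal M"
  show "{M} \<subseteq> ideals_of M 1"
    using M lattice_index_self[OF fideal_subgroup[OF M]] by (simp add: ideals_of_def)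
  show "ideals_of M 1 \<subseteq> {M}"
  proof
    fix J assume "J \<in> ideals_of M 1"
    then have J: "fideal J" "J \<subseteq> M" "lattice_index M J = 1" by (auto simp: ideals_of_def)
    then have "nu J = nu M"
      using nu_index(1)[OF fideal_is_lat[OF M] fideal_is_lat[OF J(1)]] by simp
    then show "J \<in> {M}"
      using lattice_eq_if_nu_eq[OF fideal_is_lat[OF M] fideal_is_lat[OF J(1)]] J by simp
  qed
qed

text \<open>Multiplication by I preserves relative indices because \<open>nu\<close> is
  multiplicative, and the inverse of I undoes it. Hence the number of ideals of given index in I
  does not depend on I.\<close>

lemma bij_betw_ideals_of:
  assumes I: "fideal I"
  shows "bij_betw ((\<star>) I) (ideals_of R n) (ideals_of I n)"
proof (rule bij_betw_byWitness[where f' = "(\<star>) (fideal_inv I)"])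
  show "\<forall>J\<in>ideals_of R n. fideal_inv I \<star> (I \<star> J) = J" "\<forall>J\<in>ideals_of I n. I \<star> (fideal_inv I \<star> J) = J"
    using I by (auto simp: ideals_of_def fideal_inv_prd_prd prd_fideal_inv_prd)
  show "(\<star>) I ` ideals_of R n \<subseteq> ideals_of I n"
  proof clarify
    fix J assume "J \<in> ideals_of R n"
    then have J: "fideal J" "J \<subseteq> R" "nu J = n"
      by (auto simp: ideals_of_iff is_lat_R nu_R)
    have "I \<star> J \<subseteq> I"
      using prd_mono[OF order_refl J(2), of I] R_prd[OF I] by (simp add: prd_comm)
    moreover have "nu (I \<star> J) = n * nu I"
      using nu_prd[OF I J(1)] J(3) by simp
    ultimately show "I \<star> J \<in> ideals_of I n"
      using fideal_prd[OF I J(1)] fideal_is_lat[OF I] by (simp add: ideals_of_iff)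
  qed
  show "(\<star>) (fideal_inv I) ` ideals_of I n \<subseteq> ideals_of R n"
  proof clarify
    fix J assume "J \<in> ideals_of I n"
    then have J: "fideal J" "J \<subseteq> I" "nu J = n * nu I"
      using fideal_is_lat[OF I] by (simp_all add: ideals_of_iff)
    have "fideal_inv I \<star> J \<subseteq> R"
      using prd_mono[OF order_refl J(2), of "fideal_inv I"] fideal_inv_prd[OF I] by simp
    moreover have "nu (fideal_inv I \<star> J) = n"
      using nu_prd[OF fideal_fideal_inv[OF I] J(1)] J(3) nu_fideal_inv[OF I] nu_pos[OF fideal_is_lat[OF I]] by simp
    ultimately show "fideal_inv I \<star> J \<in> ideals_of R n"
      using fideal_prd[OF fideal_fideal_inv[OF I] J(1)] by (simp add: ideals_of_iff is_lat_R nu_R)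
  qed
qed

lemma card_ideals_of: "fideal I \<Longrightarrow> card (ideals_of I n) = card (ideals_of R n)"
  using bij_betw_same_card[OF bij_betw_ideals_of] by simp

lemma subgroups_of_generated:
  assumes M: "fideal M" and K: "K \<in> subgroups_of M m" and m: "m > 0"
  shows "fideal (R \<star> K)" "K \<subseteq> R \<star> K" "R \<star> K \<subseteq> M"
    "lattice_index M (R \<star> K) dvd m" "K \<in> generating (R \<star> K) (m div lattice_index M (R \<star> K))"
proof -
  have lK: "is_lat K" using subgroups_of_is_lat[OF fideal_is_lat[OF M] K m] .
  show fideal: "fideal (R \<star> K)" by (rule fideal_prd_left[OF fideal_R lK])
  show sub: "K \<subseteq> R \<star> K" using prdI[OF R_1] by fastforce
  show sub2: "R \<star> K \<subseteq> M"
    using prd_mono[OF order_refl, of K M R] K R_prd[OF M] by (auto simp: subgroups_of_def)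
  have eq: "m = lattice_index M (R \<star> K) * lattice_index (R \<star> K) K"
    using lattice_index_trans[OF fideal_is_lat[OF M] fideal_is_lat[OF fideal] lK sub sub2] K by (simp add: subgroups_of_def)
  then show "lattice_index M (R \<star> K) dvd m" by simp
  moreover have "lattice_index M (R \<star> K) > 0" using eq m by (auto intro: Nat.gr0I)
  ultimately show "K \<in> generating (R \<star> K) (m div lattice_index M (R \<star> K))"
    using sub eq K by (simp add: generating_def subgroups_of_def)
qed

lemma generating_subset_subgroups_of:
  assumes M: "fideal M" and J: "J \<in> ideals_of M n" and K: "K \<in> generating J f" and pos: "n > 0" "f > 0"
  shows "K \<in> subgroups_of M (n * f)" "R \<star> K = J" "is_lat K"
proof -
  have J': "fideal J" "J \<subseteq> M" "lattice_index M J = n" using J by (auto simp: ideals_of_def)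
  have K': "K \<in> subgroups_of J f" "R \<star> K = J" using K by (auto simp: generating_def)
  show "R \<star> K = J" by fact
  show lK: "is_lat K" using subgroups_of_is_lat[OF fideal_is_lat[OF J'(1)] K'(1) pos(2)] .
  show "K \<in> subgroups_of M (n * f)"
    using lattice_index_trans[OF fideal_is_lat[OF M] fideal_is_lat[OF J'(1)] lK] J' K' by (auto simp: subgroups_of_def)
qed

text \<open>Each K belongs to exactly one piece, that of J = R K, an ideal between K and M.\<close>

lemma subgroups_of_eq_Union:
  assumes M: "fideal M" and m: "m > 0"
  shows "subgroups_of M m = (\<Union>x\<in>(SIGMA n:{n. n dvd m}. ideals_of M n). generating (snd x) (m div fst x))"
proof (intro equalityI subsetI)
  fix K assume K: "K \<in> subgroups_of M m"
  note S = subgroups_of_generated[OF M K m]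
  show "K \<in> (\<Union>x\<in>(SIGMA n:{n. n dvd m}. ideals_of M n). generating (snd x) (m div fst x))"
    by (rule UN_I[of "(lattice_index M (R \<star> K), R \<star> K)"]) (use S in \<open>auto simp: ideals_of_def\<close>)
next
  fix K assume "K \<in> (\<Union>x\<in>(SIGMA n:{n. n dvd m}. ideals_of M n). generating (snd x) (m div fst x))"
  then obtain n J where *: "n dvd m" "J \<in> ideals_of M n" "K \<in> generating J (m div n)" by auto
  then have "n > 0" "m div n > 0" using m by (auto intro: Nat.gr0I)
  then show "K \<in> subgroups_of M m"
    using generating_subset_subgroups_of(1)[OF M *(2,3)] *(1) by simp
qed

lemma sum_divisors_eq:
  assumes M: "fideal M" and m: "m > 0"
  shows "\<Sum>{a. a dvd m} = (\<Sum>n | n dvd m. \<Sum>J\<in>ideals_of M n. card (generating J (m div n)))"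
proof -
  let ?S = "SIGMA n:{n. n dvd m}. ideals_of M n"
  have pos: "n > 0" "m div n > 0" if "n dvd m" for n
    using that m by (auto intro: Nat.gr0I)
  have fin: "finite ?S"
    using m pos finite_ideals_of[OF fideal_is_lat[OF M]] by auto
  have "card (subgroups_of M m) = (\<Sum>x\<in>?S. card (generating (snd x) (m div fst x)))"
    unfolding subgroups_of_eq_Union[OF M m]
  proof (rule card_UN_disjoint[OF fin])
    show "\<forall>x\<in>?S. finite (generating (snd x) (m div fst x))"
      using card_subgroups_of(1)[OF fideal_is_lat] pos by (auto simp: generating_def ideals_of_def)
    show "\<forall>x\<in>?S. \<forall>y\<in>?S. x \<noteq> y \<longrightarrow> generating (snd x) (m div fst x) \<inter> generating (snd y) (m div fst y) = {}"
      by (auto simp: generating_def ideals_of_def)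
  qed
  also have "\<dots> = (\<Sum>n | n dvd m. \<Sum>J\<in>ideals_of M n. card (generating J (m div n)))"
    using m pos finite_ideals_of[OF fideal_is_lat[OF M]] by (subst sum.Sigma) (auto simp: case_prod_unfold)
  finally show ?thesis
    using card_subgroups_of(2)[OF fideal_is_lat[OF M] m] by simp
qed

text \<open>Counting all subgroups of \<open>J\<close> by the ideal they generate determines \<open>card (generating J f)\<close>
  recursively from the numbers of ideals contained in \<open>J\<close>, which do not depend on \<open>J\<close>.\<close>

lemma card_generating:
  assumes "fideal J" "f > 0"
  shows "card (generating J f) = card (generating R f)"
  using assms
proof (induction f arbitrary: J rule: less_induct)
  case (less f)
  have *: "\<Sum>{a. a dvd f} = card (generating M f) + (\<Sum>n\<in>{n. n dvd f} - {1}. card (ideals_of R n) * card (generating R (f div n)))"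
    if M: "fideal M" for M
  proof -
    \<comment> \<open>For n = 1 the only ideal is M itself, so the unknown number for M splits off.
      In all other terms f div n < f, and the induction hypothesis removes the dependence on
      J.\<close>
    have "(\<Sum>n | n dvd f. \<Sum>J\<in>ideals_of M n. card (generating J (f div n))) = card (generating M f)
        + (\<Sum>n\<in>{n. n dvd f} - {1}. \<Sum>J\<in>ideals_of M n. card (generating J (f div n)))"
      using less.prems(2) by (subst sum.remove[of _ 1]) (use ideals_of_1[OF M] in auto)
    also have "(\<Sum>n\<in>{n. n dvd f} - {1}. \<Sum>J\<in>ideals_of M n. card (generating J (f div n)))
        = (\<Sum>n\<in>{n. n dvd f} - {1}. \<Sum>J\<in>ideals_of M n. card (generating R (f div n)))"
    proof (intro sum.cong refl)
      fix n J assume n: "n \<in> {n. n dvd f} - {1}" and J: "J \<in> ideals_of M n"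
      have "n \<noteq> 0" using n less.prems(2) by (intro notI) auto
      then have "f div n < f" "f div n > 0"
        using n less.prems(2) by (auto intro: Nat.gr0I)
      then show "card (generating J (f div n)) = card (generating R (f div n))"
        using less.IH J by (auto simp: ideals_of_def)
    qed
    finally show ?thesis
      using sum_divisors_eq[OF M less.prems(2)] card_ideals_of[OF M] by simp
  qed
  show ?case using *[OF less.prems(1)] *[OF fideal_R] by simp
qed

text \<open>The left side is a coefficient of zeta(s) zeta(s - 1), the right side one of the
  Dedekind zeta function times the series of the numbers
  \<open>card (generating R f)\<close>.\<close>

lemma sum_divisors_eq_convolution:
  assumes m: "m > 0"
  shows "\<Sum>{a. a dvd m} = (\<Sum>n | n dvd m. card (ideals_of R n) * card (generating R (m div n)))"
proof -
  have "(\<Sum>J\<in>ideals_of R n. card (generating J (m div n))) = card (ideals_of R n) * card (generating R (m div n))" if "n dvd m" for n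
  proof -
    have "m div n > 0" using m that by (auto intro: Nat.gr0I)
    then have "card (generating J (m div n)) = card (generating R (m div n))" if "J \<in> ideals_of R n" for J
      using card_generating that by (auto simp: ideals_of_def)
    then show ?thesis by simp
  qed
  then show ?thesis
    using sum_divisors_eq[OF fideal_R m] by simp
qed

lemma generating_1: "fideal J \<Longrightarrow> generating J 1 = {J}"
proof -
  assume J: "fideal J"
  have "K = J" if "K \<in> subgroups_of J 1" for K
  proof -
    have K: "is_lat K" "K \<subseteq> J" "lattice_index J K = 1"
      using subgroups_of_is_lat[OF fideal_is_lat[OF J] that] that by (auto simp: subgroups_of_def)
    then show ?thesis
      using lattice_eq_if_nu_eq[OF fideal_is_lat[OF J]] nu_index(1)[OF fideal_is_lat[OF J]] by simp
  qed
  moreover have "J \<in> subgroups_of J 1"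
    using lattice_index_self fideal_subgroup[OF J] by (simp add: subgroups_of_def)
  ultimately show ?thesis
    using R_prd[OF J] by (auto simp: generating_def)
qed

end

section \<open>Homothety classes of lattices\<close>


lemma card_image_eq_if_same_kernel:
  assumes g: "bij_betw g A A'" and h: "\<And>x y. x \<in> A \<Longrightarrow> y \<in> A \<Longrightarrow> h x = h y \<longleftrightarrow> h' (g x) = h' (g y)"
  shows "card (h ` A) = card (h' ` A')"
proof -
  define \<phi> where "\<phi> = (\<lambda>c. h' (g (inv_into A h c)))"
  have \<phi>: "\<phi> (h x) = h' (g x)" if "x \<in> A" for x
  proof -
    have "inv_into A h (h x) \<in> A" "h (inv_into A h (h x)) = h x"
      using that by (auto simp: inv_into_into f_inv_into_f)
    then show ?thesis unfolding \<phi>_def using h that by blast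
  qed
  have "inj_on \<phi> (h ` A)"
    using \<phi> h by (intro inj_onI) auto
  moreover have "\<phi> ` h ` A = h' ` A'"
    using \<phi> g unfolding bij_betw_def image_image by (auto simp: image_iff)
  ultimately show ?thesis
    using card_image by metis
qed

lemma card_eq_mult_if_fibres:
  assumes "finite A" "\<And>x. x \<in> A \<Longrightarrow> card {y \<in> A. f y = f x} = k"
  shows "card A = k * card (f ` A)"
proof -
  have "card A = (\<Sum>x\<in>A. 1)" by simp
  also have "\<dots> = (\<Sum>z\<in>f ` A. \<Sum>y\<in>{y \<in> A. f y = z}. 1)"
    by (rule sum.image_gen[OF assms(1)])
  also have "\<dots> = (\<Sum>z\<in>f ` A. k)"
    by (rule sum.cong) (use assms(2) in auto)
  finally show ?thesis by simp
qed

context imag_quadratic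
begin

text \<open>The orbit under the multiplicative group of F. For a fractional ideal this is the ideal
  class itself, as a set (\<open>ideal_class_eq\<close>), so ideals and arbitrary lattices share one
  notion of class.\<close>

definition hclass :: "complex set \<Rightarrow> complex set set" where
  "hclass K = (\<lambda>u. (*) u ` K) ` (F - {0})"

lemma hclass_eq_iff: "hclass K = hclass K' \<longleftrightarrow> (\<exists>u\<in>F - {0}. K' = (*) u ` K)"
proof
  assume "hclass K = hclass K'"
  moreover have "(*) 1 ` K' \<in> hclass K'"
    unfolding hclass_def using F_int[of 1] by (intro imageI) simp
  ultimately have "K' \<in> hclass K" by simp
  then show "\<exists>u\<in>F - {0}. K' = (*) u ` K"
    by (auto simp: hclass_def)
next
  assume "\<exists>u\<in>F - {0}. K' = (*) u ` K"
  then obtain u where u: "u \<in> F" "u \<noteq> 0" "K' = (*) u ` K" by blast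
  have "hclass K' \<subseteq> hclass K"
    using F_mult[OF _ u(1)] u(2) by (auto simp: hclass_def u(3) image_mult_mult)
  moreover have "hclass K \<subseteq> hclass K'"
  proof
    fix X assume "X \<in> hclass K"
    then obtain v where v: "v \<in> F" "v \<noteq> 0" "X = (*) v ` K" by (auto simp: hclass_def)
    have X: "X = (*) (v / u) ` K'"
      unfolding v(3) u(3) image_mult_mult using u(2) by simp
    have "v / u \<in> F - {0}"
      using v u F_divide[OF v(1) u(1)] by simp
    then show "X \<in> hclass K'"
      unfolding hclass_def X by (rule imageI)
  qed
  ultimately show "hclass K = hclass K'" by blast
qed

text \<open>Multiplication by I commutes with homotheties and is invertible, so it respects classes
  in both directions.\<close>

lemma card_classes_ideals_of:
  assumes I: "fideal I"
  shows "card (hclass ` ideals_of I n) = card (hclass ` ideals_of R n)"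
proof (rule card_image_eq_if_same_kernel[OF bij_betw_ideals_of[OF I], symmetric])
  fix J J' assume "J \<in> ideals_of R n" "J' \<in> ideals_of R n"
  then have J: "fideal J" "fideal J'" by (auto simp: ideals_of_def)
  show "hclass J = hclass J' \<longleftrightarrow> hclass (I \<star> J) = hclass (I \<star> J')"
    unfolding hclass_eq_iff
  proof (intro bex_cong refl)
    fix u
    show "J' = (*) u ` J \<longleftrightarrow> I \<star> J' = (*) u ` (I \<star> J)"
    proof
      assume "I \<star> J' = (*) u ` (I \<star> J)"
      then have "fideal_inv I \<star> (I \<star> J') = (*) u ` (fideal_inv I \<star> (I \<star> J))"
        by (simp only: prd_scale)
      then show "J' = (*) u ` J"
        using J by (simp only: fideal_inv_prd_prd[OF I])
    qed (simp only: prd_scale)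
  qed
qed

lemma scale_norm_1:
  assumes "is_lat K" "nu ((*) u ` K) = nu K" "u \<noteq> 0"
  shows "cmod u = 1"
proof -
  have "(cmod u)\<^sup>2 = 1"
    using nu_scale[OF assms(1,3)] assms(2) nu_pos[OF assms(1)] by simp
  then show ?thesis by (simp add: power2_eq_1_iff) (smt (verit) norm_ge_zero)
qed

lemma generating_scale:
  assumes "K \<in> generating J f" "u \<noteq> 0"
  shows "(*) u ` K \<in> generating ((*) u ` J) f"
proof -
  have K: "add_subgroup K" "K \<subseteq> J" "lattice_index J K = f" "R \<star> K = J"
    using assms by (auto simp: generating_def subgroups_of_def)
  have "lattice_index ((*) u ` J) ((*) u ` K) = f"
    using lattice_index_image[of "(*) u" J K] assms(2) K(3) by (simp add: inj_def algebra_simps)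
  moreover have "add_subgroup ((*) u ` K)"
    by (rule add_subgroup_image[OF K(1)]) (simp add: algebra_simps)
  ultimately show ?thesis
    using K by (auto simp: generating_def subgroups_of_def prd_scale)
qed

text \<open>Together with \<open>scale_norm_1\<close> this forces modulus 1 on a homothety between
  two subgroups of the same index.\<close>

lemma subgroups_of_scale_nu:
  assumes M: "is_lat M" and K: "K \<in> subgroups_of M m" "K' \<in> subgroups_of M m" "m > 0"
  shows "nu K = nu K'"
proof -
  have "nu K = m * nu M" if "K \<in> subgroups_of M m" for K
    using nu_index(1)[OF M subgroups_of_is_lat[OF M that K(3)]] that by (simp add: subgroups_of_def)
  then show ?thesis using K by simp
qed

text \<open>Classes of K are sorted by the index n of R K in M and the class of R K. A homothety
  moves K so that it generates the chosen representative of that class, so one ideal per pair has to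
  be examined; g abstracts the number found there.\<close>

lemma card_classes_subgroups_of:
  fixes g :: "nat \<Rightarrow> real"
  assumes M: "fideal M" and m: "m > 0" and g: "\<And>J f. fideal J \<Longrightarrow> f > 0 \<Longrightarrow> real (card (hclass ` generating J f)) = g f"
  shows "real (card (hclass ` subgroups_of M m)) = (\<Sum>n | n dvd m. card (hclass ` ideals_of M n) * g (m div n))"
proof -
  define rep where "rep n C = (SOME J. J \<in> ideals_of M n \<and> hclass J = C)" for n C
  have rep: "rep n C \<in> ideals_of M n" "hclass (rep n C) = C" if "C \<in> hclass ` ideals_of M n" for n C
    unfolding rep_def using someI_ex[of "\<lambda>J. J \<in> ideals_of M n \<and> hclass J = C"] that by blast+
  let ?S = "SIGMA n:{n. n dvd m}. hclass ` ideals_of M n"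
  let ?T = "\<lambda>x. generating (rep (fst x) (snd x)) (m div fst x)"
  have pos: "n > 0" "m div n > 0" if "n dvd m" for n
    using that m by (auto intro: Nat.gr0I)
  have fin: "finite (hclass ` ideals_of M n)" if "n dvd m" for n
    using finite_ideals_of[OF fideal_is_lat[OF M]] pos(1)[OF that] by blast
  have finS: "finite ?S"
    using m fin by auto
  have sub: "K \<in> subgroups_of M m" "R \<star> K = rep (fst x) (snd x)" "is_lat K" if "x \<in> ?S" "K \<in> ?T x" for x K
  proof -
    have x: "fst x dvd m" "snd x \<in> hclass ` ideals_of M (fst x)" using that by auto
    have "fst x * (m div fst x) = m" using x by simp
    then show "K \<in> subgroups_of M m" "R \<star> K = rep (fst x) (snd x)" "is_lat K"
      using generating_subset_subgroups_of[OF M rep(1)[OF x(2)] that(2) pos[OF x(1)]] by simp_all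
  qed
  have "hclass ` subgroups_of M m = (\<Union>x\<in>?S. hclass ` ?T x)"
  proof (intro equalityI subsetI)
    fix C assume "C \<in> hclass ` subgroups_of M m"
    then obtain K where K: "K \<in> subgroups_of M m" "C = hclass K" by blast
    note S = subgroups_of_generated[OF M K(1) m]
    define J where "J = R \<star> K"
    define n where "n = lattice_index M J"
    have J: "J \<in> ideals_of M n" "n dvd m" "K \<in> generating J (m div n)"
      using S by (auto simp: J_def n_def ideals_of_def)
    then have hJ: "hclass J \<in> hclass ` ideals_of M n" by blast
    then obtain u where u: "u \<in> F - {0}" "rep n (hclass J) = (*) u ` J"
      using rep(2)[OF hJ] hclass_eq_iff by metis
    then have "(*) u ` K \<in> ?T (n, hclass J)"
      using generating_scale[OF J(3)] by simp
    moreover have "hclass ((*) u ` K) = C"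
      using K(2) hclass_eq_iff u(1) by metis
    ultimately show "C \<in> (\<Union>x\<in>?S. hclass ` ?T x)"
      using J(2) hJ by (intro UN_I[of "(n, hclass J)"]) auto
  next
    fix C assume "C \<in> (\<Union>x\<in>?S. hclass ` ?T x)"
    then show "C \<in> hclass ` subgroups_of M m" using sub(1) by blast
  qed
  moreover have "card (\<Union>x\<in>?S. hclass ` ?T x) = (\<Sum>x\<in>?S. card (hclass ` ?T x))"
  proof (rule card_UN_disjoint[OF finS])
    show "\<forall>x\<in>?S. finite (hclass ` ?T x)"
      using sub(1) finite_subset[OF _ card_subgroups_of(1)[OF fideal_is_lat[OF M] m]] by (meson finite_imageI subsetI)
    \<comment> \<open>If K and K' from two pieces are homothetic, the factor has modulus 1. So the
      ideals they generate are homothetic with equal covolume, and both the class and n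
      agree.\<close>
    show "\<forall>x\<in>?S. \<forall>y\<in>?S. x \<noteq> y \<longrightarrow> hclass ` ?T x \<inter> hclass ` ?T y = {}"
    proof (intro ballI impI, rule ccontr)
      fix x y assume x: "x \<in> ?S" and y: "y \<in> ?S" and "x \<noteq> y" and ne: "hclass ` ?T x \<inter> hclass ` ?T y \<noteq> {}"
      from ne obtain C where C: "C \<in> hclass ` ?T x \<inter> hclass ` ?T y"
        unfolding ex_in_conv[symmetric] by (rule exE)
      from IntD1[OF C] obtain K where K1: "C = hclass K" "K \<in> ?T x" by (rule imageE)
      from IntD2[OF C] obtain K' where K2: "C = hclass K'" "K' \<in> ?T y" by (rule imageE)
      have K: "K \<in> ?T x" "K' \<in> ?T y" "hclass K = hclass K'" using K1 K2 by simp_all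
      from K(3) obtain u where u: "u \<in> F - {0}" "K' = (*) u ` K" unfolding hclass_eq_iff by (rule bexE)
      have nK: "nu ((*) u ` K) = nu K"
        using subgroups_of_scale_nu[OF fideal_is_lat[OF M] sub(1)[OF x K(1)] sub(1)[OF y K(2)] m] u by simp
      then have u1: "cmod u = 1"
        using scale_norm_1[OF sub(3)[OF x K(1)]] u by simp
      let ?J = "rep (fst x) (snd x)" and ?J' = "rep (fst y) (snd y)"
      have J: "?J' = (*) u ` ?J"
        using sub(2)[OF x K(1)] sub(2)[OF y K(2)] u(2) by (simp only: prd_scale)
      have rx: "?J \<in> ideals_of M (fst x)" "hclass ?J = snd x" and ry: "?J' \<in> ideals_of M (fst y)" "hclass ?J' = snd y"
        using rep x y by auto
      have "snd x = snd y"
        using rx(2) ry(2) J u(1) hclass_eq_iff by metis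
      moreover have "nu ?J' = nu ?J"
        using J u1 u(1) rx(1) nu_scale[of ?J u] fideal_is_lat by (auto simp: ideals_of_def)
      then have "real (fst x) * nu M = real (fst y) * nu M"
        using rx(1) ry(1) by (simp add: ideals_of_iff fideal_is_lat[OF M])
      then have "fst x = fst y" using nu_pos[OF fideal_is_lat[OF M]] by simp
      ultimately show False using \<open>x \<noteq> y\<close> by (simp add: prod_eq_iff)
    qed
  qed
  moreover have "(\<Sum>x\<in>?S. card (hclass ` ?T x)) = (\<Sum>n | n dvd m. \<Sum>C\<in>hclass ` ideals_of M n. card (hclass ` generating (rep n C) (m div n)))"
    using m fin by (subst sum.Sigma) (auto simp: case_prod_unfold)
  ultimately have "real (card (hclass ` subgroups_of M m))
      = (\<Sum>n | n dvd m. \<Sum>C\<in>hclass ` ideals_of M n. real (card (hclass ` generating (rep n C) (m div n))))"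
    by simp
  also have "\<dots> = (\<Sum>n | n dvd m. \<Sum>C\<in>hclass ` ideals_of M n. g (m div n))"
  proof (intro sum.cong refl)
    fix n C assume "n \<in> {n. n dvd m}" "C \<in> hclass ` ideals_of M n"
    then show "real (card (hclass ` generating (rep n C) (m div n))) = g (m div n)"
      using rep(1) pos(2) by (intro g) (auto simp: ideals_of_def)
  qed
  finally show ?thesis by simp
qed

text \<open>The units of R: norms are nonnegative integers, so invertible elements have norm 1. The
  link to \<open>Units\<close> is \<open>unit_count_eq\<close>.\<close>

definition U :: "complex set" where "U = {u \<in> R. u * cnj u = 1}"

lemma U_norm: "u \<in> U \<Longrightarrow> cmod u = 1"
proof -
  assume "u \<in> U"
  then have "(cmod u)\<^sup>2 = 1" by (intro cmod_square_eq) (simp add: U_def)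
  then show ?thesis by (simp add: power2_eq_1_iff) (smt (verit) norm_ge_zero)
qed

lemma U_I: "u \<in> R \<Longrightarrow> cmod u = 1 \<Longrightarrow> u \<in> U"
  using complex_norm_square[of u] by (simp add: U_def)

lemma U_nonzero: "u \<in> U \<Longrightarrow> u \<noteq> 0"
  by (auto simp: U_def)

lemma U_trace:
  assumes "u \<in> U"
  obtains t :: int where "u + cnj u = of_int t" "u * u = of_int t * u - 1" "\<bar>t\<bar> \<le> 2"
proof -
  obtain t :: int where t: "u + cnj u = of_int t"
    using assms R_norm_trace(2)[of u] by (auto simp: U_def)
  have "u * u = (u + cnj u) * u - u * cnj u" by (simp add: algebra_simps)
  also have "\<dots> = of_int t * u - 1" using assms t by (simp only: U_def mem_Collect_eq)
  finally have "u * u = of_int t * u - 1" .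
  moreover have "2 * Re u = of_int t"
    using arg_cong[OF t, of Re] by simp
  then have "\<bar>real_of_int t\<bar> \<le> 2"
    using abs_Re_le_cmod[of u] U_norm[OF assms] by simp
  then have "\<bar>t\<bar> \<le> 2" by linarith
  ultimately show thesis using that t by blast
qed

text \<open>A unit is a root of X^2 - t X + 1, where its trace t is an integer of absolute value at
  most 2.\<close>

lemma finite_U: "finite U"
proof (rule finite_subset)
  show "U \<subseteq> (\<Union>t\<in>{-2..2::int}. {u. poly [:1, - of_int t, 1:] u = 0})"
  proof
    fix u assume "u \<in> U"
    then obtain t :: int where t: "u * u = of_int t * u - 1" "\<bar>t\<bar> \<le> 2" by (rule U_trace)
    have "poly [:1, - of_int t, 1:] u = 1 - of_int t * u + u * u"
      by (simp add: algebra_simps)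
    then show "u \<in> (\<Union>t\<in>{-2..2::int}. {u. poly [:1, - of_int t, 1:] u = 0})"
      using t by (intro UN_I[of t]) auto
  qed
  show "finite (\<Union>t\<in>{-2..2::int}. {u :: complex. poly [:1, - of_int t, 1:] u = 0})"
    by (intro finite_UN_I poly_roots_finite) auto
qed

lemma U_uminus: "u \<in> U \<Longrightarrow> - u \<in> U"
  using add_subgroup_uminus[OF add_subgroup_R] by (auto simp: U_def)

lemma U_1: "1 \<in> U"
  using R_1 by (simp add: U_def)

lemma U_scale_fideal:
  assumes "fideal J" "u \<in> U"
  shows "(*) u ` J = J"
proof -
  have u: "u \<in> R" "cnj u \<in> R" "u * cnj u = 1" using assms(2) R_cnj by (auto simp: U_def)
  show ?thesis
  proof
    show "(*) u ` J \<subseteq> J" using fideal_mult[OF assms(1) u(1)] by auto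
    show "J \<subseteq> (*) u ` J"
    proof
      fix x assume "x \<in> J"
      then have "cnj u * x \<in> J" using fideal_mult[OF assms(1) u(2)] by blast
      then have "u * (cnj u * x) \<in> (*) u ` J" by blast
      then show "x \<in> (*) u ` J" using u(3) by (simp flip: mult.assoc)
    qed
  qed
qed

text \<open>Multiplying u J = J by the inverse of J gives u R = R, so u lies in R; equal covolumes
  give modulus 1.\<close>

lemma in_U_if_scale_fideal:
  assumes J: "fideal J" and u: "u \<in> F" "u \<noteq> 0" "(*) u ` J = J"
  shows "u \<in> U"
proof (rule U_I)
  show "cmod u = 1"
    using scale_norm_1[OF fideal_is_lat[OF J]] u by simp
  have "(*) u ` (J \<star> fideal_inv J) = J \<star> fideal_inv J"
    using u(3) by (simp only: scale_prd)
  then have "(*) u ` R = R" using prd_fideal_inv[OF J] by simp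
  then show "u \<in> R" using imageI[OF R_1, of "(*) u"] by simp
qed

text \<open>Comparison of discriminants: with u = x + y \<omega> of trace t, 4 - t^2 = y^2 (4
  \<kappa> - \<tau>^2). The left side is at most 4, and the second factor on the right is positive
  and never 1, so |y| = 1.\<close>

lemma unit_generates:
  assumes u: "u \<in> U" and nontriv: "u \<noteq> 1" "u \<noteq> -1"
  shows "lat 1 u = R" "Im u \<noteq> 0" "\<exists>t::int. u + cnj u = of_int t \<and> \<bar>t\<bar> \<le> 1"
proof -
  obtain x y where xy: "u = of_int x * 1 + of_int y * \<omega>"
    using u unfolding U_def R_def by (auto elim: latE)
  obtain t :: int where t: "u + cnj u = of_int t" using U_trace[OF u] by blast
  have Re_u: "2 * Re u = of_int t" using arg_cong[OF t, of Re] by simp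
  have Im_u: "Im u = of_int y * Im \<omega>" by (simp add: xy)
  have nrm: "(Re u)\<^sup>2 + (Im u)\<^sup>2 = 1"
    using U_norm[OF u] cmod_power2[of u] by simp
  show Im0: "Im u \<noteq> 0"
  proof
    assume "Im u = 0"
    then have "Re u = 1 \<or> Re u = -1" using nrm by (simp add: power2_eq_1_iff)
    then show False using nontriv \<open>Im u = 0\<close> by (auto simp: complex_eq_iff)
  qed
  have "2 * Re \<omega> = of_int \<tau>" using arg_cong[OF cnj_om, of Re] by simp
  moreover have "Re (\<omega> * \<omega>) = of_int \<tau> * Re \<omega> - of_int \<kappa>" by (simp add: om2)
  then have "(Re \<omega>)\<^sup>2 - (Im \<omega>)\<^sup>2 = of_int \<tau> * Re \<omega> - of_int \<kappa>" by (simp add: power2_eq_square)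
  ultimately have disc: "4 * (Im \<omega>)\<^sup>2 = of_int (4 * \<kappa> - \<tau>\<^sup>2)"
    by (simp flip: \<open>2 * Re \<omega> = of_int \<tau>\<close> add: power2_eq_square algebra_simps)
  have "of_int (4 - t\<^sup>2) = 4 * (1 - (Re u)\<^sup>2)"
    by (simp flip: Re_u add: power_mult_distrib)
  also have "\<dots> = 4 * (Im u)\<^sup>2" using nrm by simp
  also have "\<dots> = of_int (y\<^sup>2 * (4 * \<kappa> - \<tau>\<^sup>2))"
    unfolding Im_u power_mult_distrib using disc by simp
  finally have eq: "4 - t\<^sup>2 = y\<^sup>2 * (4 * \<kappa> - \<tau>\<^sup>2)" unfolding of_int_eq_iff .
  have "real_of_int (4 * \<kappa> - \<tau>\<^sup>2) > 0" using disc Im_om by (smt (verit) zero_less_power2)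
  then have Dpos: "4 * \<kappa> - \<tau>\<^sup>2 > 0" by linarith
  have y0: "y \<noteq> 0" using Im0 Im_u by auto
  then have "y\<^sup>2 > 0" by simp
  then have prod_pos: "y\<^sup>2 * (4 * \<kappa> - \<tau>\<^sup>2) > 0" using Dpos by simp
  then have "\<bar>t\<bar>\<^sup>2 < 2\<^sup>2" using eq by simp
  then have t1: "\<bar>t\<bar> < 2" by (rule power2_less_imp_less) simp
  then show "\<exists>t::int. u + cnj u = of_int t \<and> \<bar>t\<bar> \<le> 1" using t by (intro exI[of _ t]) simp
  have "\<bar>y\<bar> = 1"
  proof (rule ccontr)
    assume "\<bar>y\<bar> \<noteq> 1"
    then have y2: "\<bar>y\<bar> \<ge> 2" using y0 by linarith
    then have "y\<^sup>2 \<ge> 4" using power_mono[of 2 "\<bar>y\<bar>" 2] by simp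
    moreover have "y\<^sup>2 * 1 \<le> y\<^sup>2 * (4 * \<kappa> - \<tau>\<^sup>2)" using Dpos by (intro mult_left_mono) auto
    ultimately have "4 - t\<^sup>2 \<ge> 4" using eq by linarith
    then have "t = 0" by simp
    then have "y\<^sup>2 * (4 * \<kappa> - \<tau>\<^sup>2) = 4" using eq by simp
    moreover have "y\<^sup>2 = 4" using \<open>y\<^sup>2 \<ge> 4\<close> \<open>y\<^sup>2 * 1 \<le> _\<close> calculation by simp
    ultimately have "4 * \<kappa> - \<tau>\<^sup>2 = 1" by simp
    \<comment> \<open>Impossible, since a square is 0 or 1 modulo 4.\<close>
    then have "\<tau>\<^sup>2 mod 4 = 3" by presburger
    moreover have "\<tau>\<^sup>2 mod 4 = (\<tau> mod 4)\<^sup>2 mod 4" by (simp add: power_mod)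
    moreover have "\<tau> mod 4 \<in> {0, 1, 2, 3}"
      using pos_mod_bound[of 4 \<tau>] pos_mod_sign[of 4 \<tau>] by auto
    ultimately show False by auto
  qed
  then have "\<omega> = of_int (- y * x) * 1 + of_int y * u"
    unfolding xy by (auto simp: abs_if algebra_simps split: if_splits)
  then have "\<omega> \<in> lat 1 u" by (simp only: lat_mem)
  moreover have "u \<in> R" using u by (simp add: U_def)
  ultimately show "lat 1 u = R"
    using lat_gens(1)[of 1 u] lat_subset[OF add_subgroup_R R_1] unfolding R_def
    by (intro equalityI) (simp_all add: lat_subset_iff)
qed

text \<open>A subgroup fixed by u is a module over Z + Z u. If u is neither 1 nor -1 this ring is R,
  so K is already the ideal J and f = 1.\<close>

lemma generating_stabilizer:
  assumes J: "fideal J" and f: "f > 1" and K: "K \<in> generating J f" and u: "u \<in> U" "(*) u ` K = K"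
  shows "u = 1 \<or> u = -1"
proof (rule ccontr)
  assume "\<not> (u = 1 \<or> u = -1)"
  then have gen: "lat 1 u = R" using unit_generates(1)[OF u(1)] by blast
  have K': "K \<in> subgroups_of J f" "R \<star> K = J" using K by (auto simp: generating_def)
  have sg: "add_subgroup K" using K' by (simp add: subgroups_of_def)
  have "x * y \<in> K" if x: "x \<in> R" and "y \<in> K" for x y
  proof -
    obtain p q where "x = of_int p * 1 + of_int q * u"
      using x unfolding gen[symmetric] by (rule latE)
    then have "x * y = of_int p * y + of_int q * (u * y)" by (simp add: algebra_simps)
    moreover have "u * y \<in> K" using u(2) \<open>y \<in> K\<close> by blast
    ultimately show ?thesis
      using \<open>y \<in> K\<close> by (simp only: add_subgroup_add[OF sg] add_subgroup_of_int_mult[OF sg])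
  qed
  then have "fideal K"
    using subgroups_of_is_lat[OF fideal_is_lat[OF J] K'(1)] f by (auto simp: fideal_def)
  then have "K = J" using R_prd K'(2) by simp
  then have "f = 1" using K'(1) lattice_index_self[OF sg] by (simp add: subgroups_of_def)
  then show False using f by simp
qed

text \<open>A homothety between two members K fixes J = R K, so the class of K meets
  \<open>generating J f\<close> in the orbit of K under the units. The stabilizer consists of 1 and
  -1, so every orbit has half as many elements as U; the statement avoids the division.\<close>

lemma card_classes_generating:
  assumes J: "fideal J" and f: "f > 1"
  shows "card U * card (hclass ` generating J f) = 2 * card (generating J f)"
proof -
  let ?P = "generating J f"
  have finP: "finite ?P"
    using card_subgroups_of(1)[OF fideal_is_lat[OF J], of f] f by (auto simp: generating_def)
  have fibre: "2 * card {K' \<in> ?P. hclass K' = hclass K} = card U" if K: "K \<in> ?P" for K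
  proof -
    have lK: "is_lat K"
      using subgroups_of_is_lat[OF fideal_is_lat[OF J]] K f by (auto simp: generating_def)
    have "{K' \<in> ?P. hclass K' = hclass K} = (\<lambda>u. (*) u ` K) ` U"
    proof (intro equalityI subsetI)
      fix K' assume "K' \<in> {K' \<in> ?P. hclass K' = hclass K}"
      then have K': "K' \<in> ?P" "hclass K = hclass K'" by auto
      from K'(2) obtain u where u: "u \<in> F - {0}" "K' = (*) u ` K" unfolding hclass_eq_iff by (rule bexE)
      have "(*) u ` J = J"
        using K K' u(2) by (auto simp: generating_def prd_scale)
      then have "u \<in> U" using in_U_if_scale_fideal[OF J] u(1) by blast
      then show "K' \<in> (\<lambda>u. (*) u ` K) ` U" using u(2) by blast
    next
      fix K' assume "K' \<in> (\<lambda>u. (*) u ` K) ` U"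
      then obtain u where u: "u \<in> U" "K' = (*) u ` K" by blast
      then have "K' \<in> ?P"
        using generating_scale[OF K U_nonzero] U_scale_fideal[OF J] by metis
      moreover have "u \<in> F - {0}"
        using u(1) U_nonzero R_subset_F by (auto simp: U_def)
      then have "hclass K = hclass K'" unfolding hclass_eq_iff using u(2) by (rule rev_bexI)
      ultimately show "K' \<in> {K' \<in> ?P. hclass K' = hclass K}" by simp
    qed
    moreover have "card U = 2 * card ((\<lambda>u. (*) u ` K) ` U)"
    proof (rule card_eq_mult_if_fibres[OF finite_U])
      fix u assume u: "u \<in> U"
      have "{v \<in> U. (*) v ` K = (*) u ` K} = {u, - u}"
      proof (intro equalityI subsetI)
        fix v assume "v \<in> {v \<in> U. (*) v ` K = (*) u ` K}"
        then have v: "v \<in> U" "(*) v ` K = (*) u ` K" by auto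
        have "cnj u * v \<in> U"
        proof (rule U_I)
          show "cnj u * v \<in> R" using u v(1) by (auto simp: U_def intro: R_mult R_cnj)
          show "cmod (cnj u * v) = 1" using U_norm[OF u] U_norm[OF v(1)] by (simp add: norm_mult)
        qed
        moreover have "(*) (cnj u) ` ((*) v ` K) = (*) (cnj u * u) ` K"
          unfolding v(2) image_mult_mult ..
        then have "(*) (cnj u * v) ` K = K"
          using u by (simp add: image_mult_mult U_def mult.commute[of "cnj u" u])
        ultimately have "cnj u * v = 1 \<or> cnj u * v = -1"
          using generating_stabilizer[OF J f K] by blast
        then have "u * (cnj u * v) = u \<or> u * (cnj u * v) = - u" by auto
        moreover have "u * (cnj u * v) = v"
          using u by (simp add: U_def flip: mult.assoc)
        ultimately show "v \<in> {u, - u}" by auto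
      next
        fix v assume v: "v \<in> {u, - u}"
        have eq: "(*) (- u) ` K = (*) u ` K"
        proof -
          have "(*) (- u) ` K = (*) u ` uminus ` K" by (simp add: image_image)
          also have "uminus ` K = K"
          proof
            show "uminus ` K \<subseteq> K"
              using add_subgroup_uminus[OF is_lat_subgroup[OF lK]] by blast
            show "K \<subseteq> uminus ` K"
            proof
              fix x assume "x \<in> K"
              then have "- (- x) \<in> uminus ` K"
                using add_subgroup_uminus[OF is_lat_subgroup[OF lK]] by blast
              then show "x \<in> uminus ` K" by simp
            qed
          qed
          finally show ?thesis .
        qed
        show "v \<in> {v \<in> U. (*) v ` K = (*) u ` K}"
        proof (intro CollectI conjI)
          show "v \<in> U" using v u U_uminus by blast
          show "(*) v ` K = (*) u ` K" using v eq by (metis insertE singletonD)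
        qed
      qed
      moreover have "u \<noteq> - u" using U_nonzero[OF u] by simp
      ultimately show "card {v \<in> U. (*) v ` K = (*) u ` K} = 2" by simp
    qed
    ultimately show ?thesis by simp
  qed
  have eq: "card ?P = (card U div 2) * card (hclass ` ?P)"
  proof (rule card_eq_mult_if_fibres[OF finP])
    fix K assume "K \<in> ?P"
    from fibre[OF this] show "card {y \<in> ?P. hclass y = hclass K} = card U div 2" by linarith
  qed
  \<comment> \<open>Evenness of \<open>card U\<close> is read off from one fibre; if there is no
    fibre, both sides are 0.\<close>
  show ?thesis
  proof (cases "?P = {}")
    case False
    then obtain K where "K \<in> ?P" by (meson ex_in_conv)
    from fibre[OF this] have "card U = 2 * (card U div 2)" by presburger
    then show ?thesis using eq by (metis mult.assoc)
  qed (simp only: image_empty card.empty mult_0_right)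
qed

lemma card_U_pos: "card U > 0"
  using U_1 finite_U by (auto simp: card_gt_0_iff)

lemma real_card_classes_generating:
  assumes "fideal J" "f > 0"
  shows "real (card (hclass ` generating J f)) = (if f = 1 then 1 else 2 * card (generating R f) / card U)"
proof (cases "f = 1")
  case True
  then show ?thesis using generating_1[OF assms(1)] by simp
next
  case False
  then have "real (card U * card (hclass ` generating J f)) = real (2 * card (generating R f))"
    using card_classes_generating[of J f] card_generating assms by simp
  then show ?thesis
    using False card_U_pos by (simp add: field_simps)
qed

lemma card_classes_subgroups_of_eq:
  assumes "fideal M" "m > 0"
  shows "real (card (hclass ` subgroups_of M m)) = (\<Sum>n | n dvd m. card (hclass ` ideals_of R n)
    * (if m div n = 1 then 1 else 2 * card (generating R (m div n)) / card U))"
  using card_classes_subgroups_of[OF assms real_card_classes_generating] card_classes_ideals_of[OF assms(1)] by simp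

text \<open>An order generated by a unit other than \<open>\<plusminus>1\<close> is Euclidean.\<close>

lemma principal_if_units:
  assumes u: "u \<in> U" "u \<noteq> 1" "u \<noteq> -1" and J: "fideal J" "J \<subseteq> R"
  shows "hclass J = hclass R"
proof -
  note gen = unit_generates[OF u]
  obtain t :: int where t: "u + cnj u = of_int t" "\<bar>t\<bar> \<le> 1" using gen(3) by blast
  have euclid: "\<exists>\<gamma>\<in>R. cmod (z - \<gamma>) < 1" for z
  proof -
    define q where "q = Im z / Im u"
    define p where "p = Re z - q * Re u"
    have z: "z = of_real p + of_real q * u"
      using gen(2) by (simp add: complex_eq_iff p_def q_def)
    define \<gamma> where "\<gamma> = of_int (round p) * 1 + of_int (round q) * u"
    have "\<gamma> \<in> R" unfolding \<gamma>_def gen(1)[symmetric] by (rule lat_mem)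
    define p' q' where "p' = p - of_int (round p)" and "q' = q - of_int (round q)"
    have le: "\<bar>p'\<bar> \<le> 1/2" "\<bar>q'\<bar> \<le> 1/2"
      using of_int_round_abs_le[of p] of_int_round_abs_le[of q] by (auto simp: p'_def q'_def abs_minus_commute)
    have zg: "z - \<gamma> = of_real p' + of_real q' * u"
      by (simp add: z \<gamma>_def p'_def q'_def algebra_simps)
    have Re_u: "2 * Re u = of_int t" using arg_cong[OF t(1), of Re] by simp
    have nrm: "(Re u)\<^sup>2 + (Im u)\<^sup>2 = 1"
      using U_norm[OF u(1)] cmod_power2[of u] by simp
    have "(cmod (z - \<gamma>))\<^sup>2 = p'\<^sup>2 + p' * q' * (2 * Re u) + q'\<^sup>2 * ((Re u)\<^sup>2 + (Im u)\<^sup>2)"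
      unfolding zg cmod_power2 by (simp add: power2_eq_square algebra_simps)
    also have "\<dots> = p'\<^sup>2 + p' * q' * of_int t + q'\<^sup>2" unfolding nrm Re_u by simp
    \<comment> \<open>The rounding errors are at most 1/2 and |t| <= 1, so rounding the coordinates
      leaves a remainder of norm at most 3/4.\<close>
    also have "\<dots> \<le> 1/4 + 1/4 + 1/4"
    proof (intro add_mono)
      show "p'\<^sup>2 \<le> 1/4" "q'\<^sup>2 \<le> 1/4"
        using power_mono[OF le(1), of 2] power_mono[OF le(2), of 2] by (simp_all add: power2_eq_square)
      have "\<bar>p' * q' * of_int t\<bar> \<le> 1/2 * (1/2) * 1"
        unfolding abs_mult using le t(2) by (intro mult_mono) auto
      then show "p' * q' * of_int t \<le> 1/4" by linarith
    qed
    finally have "(cmod (z - \<gamma>))\<^sup>2 < 1\<^sup>2" by simp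
    then have "cmod (z - \<gamma>) < 1" by (rule power2_less_imp_less) simp
    then show ?thesis using \<open>\<gamma> \<in> R\<close> by blast
  qed
  have nat_norm: "\<exists>m::nat. (cmod x)\<^sup>2 = real m" if x: "x \<in> R" for x
  proof -
    obtain m :: int where "x * cnj x = of_int m" using R_norm_trace(1)[OF x] by blast
    then have m: "(cmod x)\<^sup>2 = of_int m" by (intro cmod_square_eq) simp
    then have "m \<ge> 0" using zero_le_power2[of "cmod x"] by linarith
    then show ?thesis using m by (intro exI[of _ "nat m"]) simp
  qed
  \<comment> \<open>On R the norm is already a natural number; the floor gives N values in
    \<open>nat\<close>, so that a nonzero element of least norm can be chosen in J.\<close>
  define N where "N x = nat \<lfloor>(cmod x)\<^sup>2\<rfloor>" for x
  have N: "real (N x) = (cmod x)\<^sup>2" if "x \<in> R" for x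
    using nat_norm[OF that] unfolding N_def by (metis floor_of_nat nat_int)
  obtain k where k: "k > 0" "\<And>x. x \<in> R \<Longrightarrow> of_int k * x \<in> J"
    using is_latE[OF fideal_is_lat[OF J(1)]] by blast
  have "of_int k * 1 \<in> J - {0}" using k(1) k(2)[OF R_1] by simp
  then obtain \<alpha> where \<alpha>: "\<alpha> \<in> J - {0}" "\<And>y. y \<in> J - {0} \<Longrightarrow> N \<alpha> \<le> N y"
    using ex_has_least_nat[of "\<lambda>x. x \<in> J - {0}" _ N] by blast
  have \<alpha>R: "\<alpha> \<in> R" using \<alpha>(1) J(2) by blast
  have "J = (*) \<alpha> ` R"
  proof
    show "(*) \<alpha> ` R \<subseteq> J"
      using fideal_mult[OF J(1), of _ \<alpha>] \<alpha>(1) by (auto simp: mult.commute)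
    show "J \<subseteq> (*) \<alpha> ` R"
    proof
      fix \<beta> assume \<beta>: "\<beta> \<in> J"
      obtain \<gamma> where \<gamma>: "\<gamma> \<in> R" "cmod (\<beta> / \<alpha> - \<gamma>) < 1" using euclid by blast
      have "\<beta> - \<gamma> * \<alpha> \<in> J"
        using \<alpha>(1) \<gamma>(1) by (intro add_subgroup_diff[OF fideal_subgroup[OF J(1)] \<beta>] fideal_mult[OF J(1)]) auto
      have "\<beta> - \<gamma> * \<alpha> = 0"
      proof (rule ccontr)
        assume "\<beta> - \<gamma> * \<alpha> \<noteq> 0"
        then have "N \<alpha> \<le> N (\<beta> - \<gamma> * \<alpha>)" using \<alpha>(2) \<open>\<beta> - \<gamma> * \<alpha> \<in> J\<close> by blast
        then have "(cmod \<alpha>)\<^sup>2 \<le> (cmod (\<beta> - \<gamma> * \<alpha>))\<^sup>2"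
          using N[OF \<alpha>R] N[of "\<beta> - \<gamma> * \<alpha>"] \<open>\<beta> - \<gamma> * \<alpha> \<in> J\<close> J(2) by (metis of_nat_le_iff subsetD)
        then have "cmod \<alpha> \<le> cmod (\<beta> - \<gamma> * \<alpha>)" by (rule power2_le_imp_le) simp
        also have "\<beta> - \<gamma> * \<alpha> = \<alpha> * (\<beta> / \<alpha> - \<gamma>)" using \<alpha>(1) by (simp add: field_simps)
        also have "cmod \<dots> < cmod \<alpha> * 1"
          unfolding norm_mult using \<alpha>(1) \<gamma>(2) by (intro mult_strict_left_mono) auto
        finally show False by simp
      qed
      then have "\<beta> = \<alpha> * \<gamma>" by (simp add: mult.commute)
      then show "\<beta> \<in> (*) \<alpha> ` R" using \<gamma>(1) by blast
    qed
  qed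
  moreover have "\<alpha> \<in> F - {0}" using \<alpha>(1) \<alpha>R R_subset_F by blast
  ultimately have "hclass R = hclass J" unfolding hclass_eq_iff by blast
  then show ?thesis by simp
qed

text \<open>Either the factor w - 2 of the formula vanishes, or a nontrivial unit makes every ideal
  principal and the number of classes becomes an indicator.\<close>

lemma card_U_eq_2_or_principal:
  "card U = 2 \<or> (\<forall>n. card (hclass ` ideals_of R n) = (if ideals_of R n = {} then 0 else 1))"
proof (cases "\<exists>u\<in>U. u \<noteq> 1 \<and> u \<noteq> -1")
  case True
  then obtain u where u: "u \<in> U" "u \<noteq> 1" "u \<noteq> -1" by blast
  have "hclass ` ideals_of R n = {hclass R}" if "ideals_of R n \<noteq> {}" for n
    using that principal_if_units[OF u] by (auto simp: ideals_of_def)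
  then show ?thesis by auto
next
  case False
  then have "U = {1, -1}" using U_1 U_uminus[OF U_1] by blast
  then show ?thesis by simp
qed

end

section \<open>Split primes and norms of ideals\<close>


context imag_quadratic
begin

definition prime_id :: "complex set \<Rightarrow> bool" where
  "prime_id P \<longleftrightarrow> fideal P \<and> P \<subseteq> R \<and> P \<noteq> R \<and> (\<forall>x\<in>R. \<forall>y\<in>R. x * y \<in> P \<longrightarrow> x \<in> P \<or> y \<in> P)"

definition split_primes :: "nat set" where
  "split_primes = {p. prime p \<and>
     (\<exists>P Q. prime_id P \<and> prime_id Q \<and> P \<noteq> Q \<and> P \<star> Q = (*) (of_nat p) ` R)}"

text \<open>The product of J with its conjugate is symmetric in the two, and it determines the
  norm.\<close>

lemma nu_cnj:
  assumes "fideal J"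
  shows "nu (cnj ` J) = nu J"
proof -
  have "cnj ` J \<star> cnj ` (cnj ` J) = J \<star> cnj ` J"
    by (simp add: image_image prd_comm)
  then have "nu ((*) (of_real (nu (cnj ` J))) ` R) = nu ((*) (of_real (nu J)) ` R)"
    using prd_cnj[OF assms] prd_cnj[OF fideal_cnj[OF assms]] by simp
  then have "(nu (cnj ` J))\<^sup>2 = (nu J)\<^sup>2"
    using nu_pos[OF fideal_is_lat[OF assms]] nu_pos[OF fideal_is_lat[OF fideal_cnj[OF assms]]]
    by (simp add: nu_scale is_lat_R nu_R)
  then show ?thesis
    using nu_pos[OF fideal_is_lat[OF assms]] nu_pos[OF fideal_is_lat[OF fideal_cnj[OF assms]]]
    by (simp add: power2_eq_iff_nonneg)
qed

lemma prd_subset_left: "fideal I \<Longrightarrow> J \<subseteq> R \<Longrightarrow> I \<star> J \<subseteq> I"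
  using prd_mono[OF order_refl, of J R I] R_prd[of I] by (simp add: prd_comm)

lemma nu_nat:
  assumes "fideal J" "J \<subseteq> R"
  shows "nu J = lattice_index R J" "lattice_index R J > 0"
  using nu_index[OF is_lat_R fideal_is_lat[OF assms(1)] assms(2)] by (simp_all add: nu_R)

lemma R_nat: "of_nat k \<in> R"
  using R_int[of "int k"] by simp

lemma fideal_nat_scale: "fideal J \<Longrightarrow> k > 0 \<Longrightarrow> fideal ((*) (of_nat k) ` J)"
  using fideal_scale[of J "of_nat k"] F_int[of "int k"] by simp

lemma nu_nat_scale: "k > 0 \<Longrightarrow> nu ((*) (of_nat k) ` R) = real k ^ 2"
  by (simp add: nu_scale is_lat_R nu_R)

text \<open>To contain is to divide: for J inside I the product of J with the inverse of I is again
  inside R, and the norms divide accordingly.\<close>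

lemma divide_ideal:
  assumes I: "fideal I" "I \<subseteq> R" "nu I = real a" and J: "J \<in> ideals_of R n" "J \<subseteq> I"
  shows "a dvd n" "fideal_inv I \<star> J \<in> ideals_of R (n div a)" "J \<subseteq> fideal_inv I \<star> J" "I \<star> (fideal_inv I \<star> J) = J"
proof -
  have J': "fideal J" "nu J = real n" using J by (auto simp: ideals_of_iff is_lat_R nu_R)
  show eq: "I \<star> (fideal_inv I \<star> J) = J" by (rule prd_fideal_inv_prd[OF I(1) J'(1)])
  have fideal: "fideal (fideal_inv I \<star> J)" by (intro fideal_prd fideal_fideal_inv I J')
  have sub: "fideal_inv I \<star> J \<subseteq> R"
    using prd_mono[OF order_refl J(2), of "fideal_inv I"] fideal_inv_prd[OF I(1)] by simp
  show "J \<subseteq> fideal_inv I \<star> J"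
    using prd_subset_left[OF fideal I(2)] eq by (simp add: prd_comm)
  have "nu J = real a * nu (fideal_inv I \<star> J)"
    using nu_prd[OF I(1) fideal] eq I(3) by simp
  then have "real n = real (a * lattice_index R (fideal_inv I \<star> J))"
    using nu_nat[OF fideal sub] J' by simp
  then have n: "n = a * lattice_index R (fideal_inv I \<star> J)" unfolding of_nat_eq_iff .
  moreover have "a > 0" using nu_nat[OF I(1,2)] I(3) by simp
  ultimately have "lattice_index R (fideal_inv I \<star> J) = n div a" by (metis nonzero_mult_div_cancel_left less_not_refl)
  then show "fideal_inv I \<star> J \<in> ideals_of R (n div a)"
    using fideal sub by (simp add: ideals_of_def)
  show "a dvd n" using n by (metis dvd_triv_left)
qed

lemma multiply_ideal:
  assumes I: "fideal I" "I \<subseteq> R" "nu I = real a" and J: "J \<in> ideals_of R n"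
  shows "I \<star> J \<in> ideals_of R (a * n)" "I \<star> J \<subseteq> I"
proof -
  have J': "fideal J" "J \<subseteq> R" "nu J = real n" using J by (auto simp: ideals_of_iff is_lat_R nu_R)
  show "I \<star> J \<subseteq> I" by (rule prd_subset_left[OF I(1) J'(2)])
  then show "I \<star> J \<in> ideals_of R (a * n)"
    using fideal_prd[OF I(1) J'(1)] nu_prd[OF I(1) J'(1)] I J' by (auto simp: ideals_of_iff is_lat_R nu_R)
qed

lemma prime_id_prd:
  assumes P: "prime_id P" and IJ: "I \<subseteq> R" "J \<subseteq> R" "I \<star> J \<subseteq> P"
  shows "I \<subseteq> P \<or> J \<subseteq> P"
proof (rule ccontr)
  assume "\<not> (I \<subseteq> P \<or> J \<subseteq> P)"
  then obtain x y where xy: "x \<in> I" "x \<notin> P" "y \<in> J" "y \<notin> P" by blast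
  have "x * y \<in> P" using prdI[OF xy(1,3)] IJ(3) by blast
  moreover have "x \<in> R" "y \<in> R" using xy(1,3) IJ(1,2) by blast+
  ultimately show False using P xy(2,4) unfolding prime_id_def by blast
qed

lemma prime_id_fideal: "prime_id P \<Longrightarrow> fideal P"
  and prime_id_subset: "prime_id P \<Longrightarrow> P \<subseteq> R"
  and prime_id_neq: "prime_id P \<Longrightarrow> P \<noteq> R"
  by (auto simp: prime_id_def)

lemma eq_R_if_1: "fideal J \<Longrightarrow> J \<subseteq> R \<Longrightarrow> 1 \<in> J \<Longrightarrow> J = R"
  using fideal_mult[of J _ 1] by auto

lemma prime_id_no_1: "prime_id P \<Longrightarrow> 1 \<notin> P"
  using eq_R_if_1[OF prime_id_fideal prime_id_subset] prime_id_neq by blast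

text \<open>By Bezout, an ideal containing two different primes contains 1.\<close>

lemma prime_id_coprime:
  assumes P: "prime_id P" "of_nat p \<in> P" "of_nat q \<in> P" and pq: "prime p" "prime q"
  shows "p = q"
proof (rule ccontr)
  assume "p \<noteq> q"
  then have "coprime (int p) (int q)" using pq by (simp add: primes_coprime)
  then obtain u v where uv: "u * int p + v * int q = 1"
    using bezout_int[of "int p" "int q"] by (auto simp: coprime_iff_gcd_eq_1)
  have "of_int u * of_nat p + of_int v * of_nat q \<in> P"
    using fideal_mult[OF prime_id_fideal[OF P(1)] R_int] P(2,3) add_subgroup_add[OF fideal_subgroup[OF prime_id_fideal[OF P(1)]]]
    by blast
  moreover have "of_int u * of_nat p + of_int v * of_nat q = (of_int (u * int p + v * int q) :: complex)"
    by simp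
  ultimately show False using prime_id_no_1[OF P(1)] uv by simp
qed

lemma prime_id_cnj:
  assumes P: "prime_id P"
  shows "prime_id (cnj ` P)"
proof -
  have mem: "z \<in> cnj ` P \<longleftrightarrow> cnj z \<in> P" for z
    by (metis complex_cnj_cnj imageE imageI)
  have "cnj ` P \<noteq> R"
  proof
    assume "cnj ` P = R"
    then have "1 \<in> cnj ` P" using R_1 by simp
    then show False using prime_id_no_1[OF P] by (simp add: mem)
  qed
  moreover have "cnj ` P \<subseteq> R" using prime_id_subset[OF P] R_cnj by blast
  moreover have "x \<in> cnj ` P \<or> y \<in> cnj ` P" if "x \<in> R" "y \<in> R" "x * y \<in> cnj ` P" for x y
    using P R_cnj that unfolding mem prime_id_def by simp
  ultimately show ?thesis
    unfolding prime_id_def using fideal_cnj[OF prime_id_fideal[OF P]] by blast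
qed

text \<open>Sandwiched between I and R, the sum of the two ideals is again commensurable with
  R.\<close>

lemma fideal_sum:
  assumes "fideal I" "fideal J" "I \<subseteq> R" "J \<subseteq> R"
  shows "fideal ((\<lambda>(x, y). x + y) ` (I \<times> J))" "(\<lambda>(x, y). x + y) ` (I \<times> J) \<subseteq> R"
    "I \<subseteq> (\<lambda>(x, y). x + y) ` (I \<times> J)" "J \<subseteq> (\<lambda>(x, y). x + y) ` (I \<times> J)"
proof -
  let ?S = "(\<lambda>(x, y). x + y) ` (I \<times> J)"
  note sI = fideal_subgroup[OF assms(1)] and sJ = fideal_subgroup[OF assms(2)]
  have sg: "add_subgroup ?S"
  proof (rule add_subgroup_image)
    show "add_subgroup (I \<times> J)"
      using sI sJ by (auto simp: add_subgroup_def zero_prod_def)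
  qed auto
  show sub: "?S \<subseteq> R" using assms(3,4) add_subgroup_add[OF add_subgroup_R] by auto
  show subI: "I \<subseteq> ?S"
  proof
    fix x assume "x \<in> I"
    then have "x + 0 \<in> ?S" using add_subgroup_0[OF sJ] by blast
    then show "x \<in> ?S" by simp
  qed
  show "J \<subseteq> ?S"
  proof
    fix x assume "x \<in> J"
    then have "0 + x \<in> ?S" using add_subgroup_0[OF sI] by blast
    then show "x \<in> ?S" by simp
  qed
  have "is_lat ?S"
    by (rule is_lat_between[OF is_lat_R fideal_is_lat[OF assms(1)] sg subI sub])
  moreover have "x * y \<in> ?S" if x: "x \<in> R" and "y \<in> ?S" for x y
  proof -
    obtain i j where ij: "i \<in> I" "j \<in> J" "y = i + j" using \<open>y \<in> ?S\<close> by auto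
    have "(x * i, x * j) \<in> I \<times> J" using fideal_mult[OF assms(1) x ij(1)] fideal_mult[OF assms(2) x ij(2)] by simp
    moreover have "x * y = (\<lambda>(x, y). x + y) (x * i, x * j)" by (simp add: ij algebra_simps)
    ultimately show ?thesis by (metis imageI)
  qed
  ultimately show "fideal ?S" by (simp add: fideal_def)
qed

text \<open>A prime index leaves no ideal strictly between Q and R.\<close>

lemma prime_norm_ideal:
  assumes Q: "fideal Q" "Q \<subseteq> R" "nu Q = real q" and q: "prime q"
  shows "prime_id Q" "of_nat q \<in> Q"
proof -
  have ne: "Q \<noteq> R" using Q(3) nu_R q by (auto simp: prime_nat_iff)
  have "x \<in> Q \<or> y \<in> Q" if xy: "x \<in> R" "y \<in> R" "x * y \<in> Q" for x y
  proof (rule ccontr)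
    assume n: "\<not> (x \<in> Q \<or> y \<in> Q)"
    then have "x \<noteq> 0" using add_subgroup_0[OF fideal_subgroup[OF Q(1)]] by auto
    then have xR: "fideal ((*) x ` R)" "(*) x ` R \<subseteq> R"
      using fideal_scale[OF fideal_R, of x] xy(1) R_subset_F R_mult by auto
    \<comment> \<open>Q + x R is R or Q. In the first case 1 = i + x r with i in Q, and multiplying
      by y puts y into Q; in the second case x lies in Q.\<close>
    let ?S = "(\<lambda>(x, y). x + y) ` (Q \<times> (*) x ` R)"
    note S = fideal_sum[OF Q(1) xR(1) Q(2) xR(2)]
    have idx: "lattice_index R Q = lattice_index R ?S * lattice_index ?S Q"
      by (rule lattice_index_trans[OF is_lat_R fideal_is_lat[OF S(1)] fideal_is_lat[OF Q(1)] S(3,2)])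
    have "lattice_index R Q = q" using nu_nat[OF Q(1,2)] Q(3) by simp
    then have "lattice_index R ?S dvd q" using idx by (metis dvd_triv_left)
    then consider "lattice_index R ?S = 1" | "lattice_index R ?S = q"
      using q unfolding prime_nat_iff by blast
    then show False
    proof cases
      case 1
      then have "?S = R"
        using nu_nat[OF S(1,2)] nu_R by (intro lattice_eq_if_nu_eq[OF is_lat_R fideal_is_lat[OF S(1)] S(2)]) simp
      with R_1 have "1 \<in> ?S" by (simp only:)
      then obtain i r where ir: "i \<in> Q" "r \<in> R" "1 = i + x * r" by auto
      have "y = y * (i + x * r)" using ir(3) by simp
      also have "\<dots> = y * i + r * (x * y)" by (simp add: algebra_simps)
      also have "\<dots> \<in> Q"
        using fideal_mult[OF Q(1) xy(2) ir(1)] fideal_mult[OF Q(1) ir(2) xy(3)]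
          add_subgroup_add[OF fideal_subgroup[OF Q(1)]] by blast
      finally show False using n by blast
    next
      case 2
      then have "Q = ?S"
        using nu_nat[OF S(1,2)] Q(3) by (intro lattice_eq_if_nu_eq[OF fideal_is_lat[OF S(1)] fideal_is_lat[OF Q(1)] S(3)]) simp
      moreover have "x * 1 \<in> (*) x ` R" using R_1 by blast
      ultimately show False using S(4) n by auto
    qed
  qed
  then show "prime_id Q" using Q ne by (auto simp: prime_id_def)
  \<comment> \<open>q generates the product of Q with its conjugate, which lies in Q.\<close>
  have "of_nat q * 1 \<in> (*) (of_nat q) ` R" using R_1 by blast
  then have "of_nat q \<in> Q \<star> cnj ` Q" using prd_cnj[OF Q(1)] Q(3) by simp
  moreover have "cnj ` Q \<subseteq> R" using Q(2) R_cnj by blast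
  ultimately show "of_nat q \<in> Q" using prd_subset_left[OF Q(1)] by blast
qed

text \<open>The norms of P and Q multiply to p^2 and neither is 1, so both are p. Then P conj(P) = p
  R = P Q, and cancelling P identifies Q with the conjugate of P.\<close>

lemma split_prime_ideal:
  assumes "p \<in> split_primes"
  shows "\<exists>P. prime_id P \<and> nu P = real p \<and> cnj ` P \<noteq> P"
proof -
  obtain P Q where p: "prime p" and P: "prime_id P" and Q: "prime_id Q" and ne: "P \<noteq> Q"
    and PQ: "P \<star> Q = (*) (of_nat p) ` R"
    using assms by (auto simp: split_primes_def)
  note P' = prime_id_fideal[OF P] prime_id_subset[OF P] and Q' = prime_id_fideal[OF Q] prime_id_subset[OF Q]
  have p0: "p > 0" using p prime_gt_0_nat by blast
  have "nu P * nu Q = real p ^ 2"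
    using nu_prd[OF P'(1) Q'(1)] PQ nu_nat_scale[OF p0] by simp
  then have "real (lattice_index R P * lattice_index R Q) = real (p ^ 2)"
    using nu_nat(1)[OF P'] nu_nat(1)[OF Q'] by simp
  then have eq: "lattice_index R P * lattice_index R Q = p ^ 2" unfolding of_nat_eq_iff .
  have ne1: "lattice_index R J \<noteq> 1" if "prime_id J" for J
  proof
    assume "lattice_index R J = 1"
    then have "nu J = nu R" using nu_nat(1)[OF prime_id_fideal[OF that] prime_id_subset[OF that]] nu_R by simp
    then show False
      using lattice_eq_if_nu_eq[OF is_lat_R fideal_is_lat[OF prime_id_fideal[OF that]] prime_id_subset[OF that]]
        prime_id_neq[OF that] by simp
  qed
  have "lattice_index R P dvd p ^ 2" using eq by (metis dvd_triv_left)
  then obtain i where i: "i \<le> 2" "lattice_index R P = p ^ i"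
    using divides_primepow_nat[OF p] by blast
  have "i \<noteq> 0" using i(2) ne1[OF P] by auto
  moreover have "i \<noteq> 2"
  proof
    assume "i = 2"
    then have "lattice_index R Q = 1" using eq i(2) p0 by simp
    then show False using ne1[OF Q] by simp
  qed
  ultimately have "i = 1" using i(1) by simp
  then have nuP: "nu P = real p" using nu_nat(1)[OF P'] i(2) by simp
  have "P \<star> cnj ` P = P \<star> Q"
    using prd_cnj[OF P'(1)] nuP PQ by simp
  then have "fideal_inv P \<star> (P \<star> cnj ` P) = fideal_inv P \<star> (P \<star> Q)" by simp
  then have "cnj ` P = Q"
    using fideal_inv_prd_prd[OF P'(1) fideal_cnj[OF P'(1)]] fideal_inv_prd_prd[OF P'(1) Q'(1)] by simp
  then show ?thesis using P nuP ne by blast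
qed

text \<open>Only meaningful for split \<open>p\<close>: one of the two primes above \<open>p\<close>.\<close>

definition over :: "nat \<Rightarrow> complex set" where
  "over p = (SOME P. prime_id P \<and> nu P = real p \<and> cnj ` P \<noteq> P)"

lemma over:
  assumes "p \<in> split_primes"
  shows "prime_id (over p)" "nu (over p) = real p" "cnj ` over p \<noteq> over p" "prime p"
    "fideal (over p)" "over p \<subseteq> R" "of_nat p \<in> over p"
proof -
  show *: "prime_id (over p)" "nu (over p) = real p" "cnj ` over p \<noteq> over p"
    using someI_ex[OF split_prime_ideal[OF assms]] unfolding over_def by blast+
  show "prime p" using assms by (simp add: split_primes_def)
  show "fideal (over p)" "over p \<subseteq> R" using * prime_id_fideal prime_id_subset by blast+
  then show "of_nat p \<in> over p" using prime_norm_ideal(2) * \<open>prime p\<close> by blast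
qed

section \<open>Ideals divisible by none of the chosen primes\<close>

definition avoiding :: "nat set \<Rightarrow> nat \<Rightarrow> complex set set" where
  "avoiding A n = {J \<in> ideals_of R n. \<forall>p\<in>A. \<not> J \<subseteq> over p}"

text \<open>Multiplication by \<open>over q\<close> maps the ideals of norm n div q that avoid A
  bijectively onto those of norm n that avoid A and are divisible by \<open>over q\<close>. This is
  the effect of one Euler factor on coefficients.\<close>

lemma card_avoiding_insert:
  assumes A: "insert q A \<subseteq> split_primes" "q \<notin> A" and n: "n > 0"
  shows "card (avoiding A n) = card (avoiding (insert q A) n) + (if q dvd n then card (avoiding A (n div q)) else 0)"
proof -
  have q: "q \<in> split_primes" using A by blast
  note P = over[OF q]
  let ?B = "{J \<in> avoiding A n. J \<subseteq> over q}"
  have fin: "finite (avoiding A n)"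
    using finite_subset[OF _ finite_ideals_of[OF is_lat_R n]] by (auto simp: avoiding_def)
  have "avoiding A n = avoiding (insert q A) n \<union> ?B" "avoiding (insert q A) n \<inter> ?B = {}"
    by (auto simp: avoiding_def)
  then have c: "card (avoiding A n) = card (avoiding (insert q A) n) + card ?B"
    using fin card_Un_disjoint by (metis finite_Un)
  show ?thesis
  proof (cases "q dvd n")
    case False
    then have "?B = {}"
      using divide_ideal(1)[OF P(5,6,2)] by (auto simp: avoiding_def)
    then have "card ?B = 0" by (simp only: card.empty)
    then show ?thesis using c False by simp
  next
    case True
    have "?B = (\<star>) (over q) ` avoiding A (n div q)"
    proof (intro equalityI subsetI)
      fix J assume "J \<in> ?B"
      then have J: "J \<in> ideals_of R n" "J \<subseteq> over q" "\<forall>p\<in>A. \<not> J \<subseteq> over p" by (auto simp: avoiding_def)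
      note d = divide_ideal[OF P(5,6,2) J(1,2)]
      have "fideal_inv (over q) \<star> J \<in> avoiding A (n div q)"
        using d(2,3) J(3) by (auto simp: avoiding_def)
      then have "over q \<star> (fideal_inv (over q) \<star> J) \<in> (\<star>) (over q) ` avoiding A (n div q)" by (rule imageI)
      then show "J \<in> (\<star>) (over q) ` avoiding A (n div q)" using d(4) by simp
    next
      fix J assume "J \<in> (\<star>) (over q) ` avoiding A (n div q)"
      then obtain J1 where J1: "J1 \<in> ideals_of R (n div q)" "\<forall>p\<in>A. \<not> J1 \<subseteq> over p" "J = over q \<star> J1"
        by (auto simp: avoiding_def)
      note m = multiply_ideal[OF P(5,6,2) J1(1)]
      have "\<not> J \<subseteq> over p" if p: "p \<in> A" for p
      proof
        assume "J \<subseteq> over p"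
        have ps: "p \<in> split_primes" using p A by blast
        have J1R: "J1 \<subseteq> R" using J1(1) by (simp add: ideals_of_def)
        have le: "over q \<star> J1 \<subseteq> over p" using \<open>J \<subseteq> over p\<close> J1(3) by (simp only:)
        have "\<not> J1 \<subseteq> over p" using J1(2) p by (rule bspec)
        \<comment> \<open>By primality \<open>over p\<close> would have to contain
          \<open>over q\<close>, and with it both of the rational primes p and q.\<close>
        with prime_id_prd[OF over(1)[OF ps] P(6) J1R le] have "over q \<subseteq> over p" by (simp only: simp_thms)
        then have "of_nat q \<in> over p" using P(7) by (rule subsetD)
        then have "p = q"
          using prime_id_coprime[OF over(1)[OF ps] over(7)[OF ps] _ over(4)[OF ps] P(4)] by simp
        then show False using p A by blast
      qed
      then show "J \<in> ?B"
        using m J1(3) True by (auto simp: avoiding_def)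
    qed
    moreover have "inj_on ((\<star>) (over q)) (avoiding A (n div q))"
    proof (rule inj_on_inverseI)
      fix J assume "J \<in> avoiding A (n div q)"
      then show "fideal_inv (over q) \<star> (over q \<star> J) = J"
        by (intro fideal_inv_prd_prd P) (auto simp: avoiding_def ideals_of_def)
    qed
    ultimately show ?thesis using c True by (simp add: card_image)
  qed
qed

lemma ideal_norm_prd_cnj:
  assumes "J \<in> ideals_of R n" "q dvd n" "n > 0"
  shows "J \<star> cnj ` J \<subseteq> (*) (of_nat q) ` R"
proof -
  have "J \<star> cnj ` J = (*) (of_nat n) ` R"
    using prd_cnj[of J] assms(1) by (auto simp: ideals_of_iff is_lat_R nu_R)
  also obtain k where k: "n = q * k" using assms(2) by blast
  then have "(*) (of_nat n :: complex) ` R = (*) (of_nat q) ` ((*) (of_nat k) ` R)"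
    by (simp add: image_mult_mult)
  also have "\<dots> \<subseteq> (*) (of_nat q) ` R"
    using R_mult[OF R_nat] by blast
  finally show ?thesis .
qed

text \<open>J times its conjugate is generated by the norm n and therefore lies in P; so P contains
  J or the conjugate of J.\<close>

lemma subset_prime_or_cnj:
  assumes J: "J \<in> ideals_of R n" "q dvd n" "n > 0" and P: "prime_id P" "of_nat q \<in> P"
  shows "J \<subseteq> P \<or> J \<subseteq> cnj ` P"
proof -
  have "(*) (of_nat q) ` R \<subseteq> P"
    using fideal_mult[OF prime_id_fideal[OF P(1)] _ P(2)] by (auto simp: mult.commute)
  then have "J \<star> cnj ` J \<subseteq> P" using ideal_norm_prd_cnj[OF J] by blast
  moreover have JR: "J \<subseteq> R" "cnj ` J \<subseteq> R" using J(1) R_cnj by (auto simp: ideals_of_def)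
  ultimately consider "J \<subseteq> P" | "cnj ` J \<subseteq> P" using prime_id_prd[OF P(1)] by blast
  then show ?thesis
  proof cases
    case 2
    then have "cnj ` (cnj ` J) \<subseteq> cnj ` P" by blast
    then show ?thesis by (simp add: image_image)
  qed blast
qed

text \<open>The ideal \<open>J + q R\<close> has norm \<open>1\<close>, \<open>q\<close> or \<open>q\<^sup>2\<close>, and norm \<open>q\<close> is excluded.\<close>

lemma subset_if_no_prime_norm:
  assumes J: "J \<in> ideals_of R n" "q dvd n" "n > 0" and q: "prime q" and none: "ideals_of R q = {}"
  shows "J \<subseteq> (*) (of_nat q) ` R"
proof -
  let ?qR = "(*) (of_nat q) ` R :: complex set"
  have q0: "q > 0" using q prime_gt_0_nat by blast
  have J': "fideal J" "J \<subseteq> R" using J(1) by (auto simp: ideals_of_def)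
  have qR: "fideal ?qR" "?qR \<subseteq> R"
    using fideal_nat_scale[OF fideal_R q0] R_mult[OF R_nat] by auto
  let ?S = "(\<lambda>(x, y). x + y) ` (J \<times> ?qR)"
  note S = fideal_sum[OF J'(1) qR(1) J'(2) qR(2)]
  have idx: "lattice_index R ?qR = lattice_index R ?S * lattice_index ?S ?qR"
    by (rule lattice_index_trans[OF is_lat_R fideal_is_lat[OF S(1)] fideal_is_lat[OF qR(1)] S(4,2)])
  have "real (lattice_index R ?qR) = real (q ^ 2)"
    using nu_nat(1)[OF qR] nu_nat_scale[OF q0] by simp
  then have qq: "lattice_index R ?qR = q ^ 2" unfolding of_nat_eq_iff .
  then have "lattice_index R ?S dvd q ^ 2" using idx by (metis dvd_triv_left)
  then obtain i where i: "i \<le> 2" "lattice_index R ?S = q ^ i"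
    using divides_primepow_nat[OF q] by blast
  have "i \<noteq> 1"
  proof
    assume "i = 1"
    then have "?S \<in> ideals_of R q" using S i(2) by (simp add: ideals_of_def)
    then show False using none by blast
  qed
  then consider "i = 0" | "i = 2" using i(1) by linarith
  then show ?thesis
  proof cases
    case 1
    then have "?S = R"
      using nu_nat[OF S(1,2)] nu_R i(2) by (intro lattice_eq_if_nu_eq[OF is_lat_R fideal_is_lat[OF S(1)] S(2)]) simp
    with R_1 have "1 \<in> ?S" by (simp only:)
    then obtain x y where xy: "x \<in> J" "y \<in> R" "1 = x + of_nat q * y" by auto
    show ?thesis
    proof
      fix z assume z: "z \<in> J"
      \<comment> \<open>1 is its own conjugate, which brings in z conj(x), an element of J conj(J);
        that product lies in q R because q divides n.\<close>
      have "z = z * cnj (x + of_nat q * y)" using xy(3) by simp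
      also have "\<dots> = z * cnj x + of_nat q * (z * cnj y)" by (simp add: algebra_simps)
      also have "\<dots> \<in> ?qR"
      proof (rule add_subgroup_add[OF fideal_subgroup[OF qR(1)]])
        have "z * cnj x \<in> J \<star> cnj ` J" using xy(1) z by (intro prdI) auto
        then show "z * cnj x \<in> ?qR" using ideal_norm_prd_cnj[OF J] by blast
        show "of_nat q * (z * cnj y) \<in> ?qR"
          using z J'(2) R_mult R_cnj[OF xy(2)] by blast
      qed
      finally show "z \<in> ?qR" .
    qed
  next
    case 2
    then have "?qR = ?S"
      using nu_nat[OF S(1,2)] nu_nat[OF qR] qq i(2)
      by (intro lattice_eq_if_nu_eq[OF fideal_is_lat[OF S(1)] fideal_is_lat[OF qR(1)] S(4)]) simp
    then show ?thesis using S(3) by simp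
  qed
qed

text \<open>Q is the ideal by which the induction in \<open>ex1_avoiding\<close> divides when the
  prime q divides the norm: the conjugate of \<open>over q\<close> if q splits, the self-conjugate
  prime of norm q if q ramifies, and q R if q is inert. The last clause keeps the induction inside
  the norms that occur.\<close>

lemma ex_dividing_ideal:
  assumes q: "prime q"
  shows "\<exists>Q a. fideal Q \<and> Q \<subseteq> R \<and> nu Q = real a \<and> a > 1 \<and> (\<forall>p\<in>split_primes. \<not> Q \<subseteq> over p) \<and>
    (\<forall>n>0. \<forall>J\<in>avoiding split_primes n. q dvd n \<longrightarrow> J \<subseteq> Q) \<and>
    (\<forall>n>0. q dvd n \<longrightarrow> ideals_of R n \<noteq> {} \<longrightarrow> a dvd n \<and> ideals_of R (n div a) \<noteq> {})"
proof -
  have q1: "q > 1" using q prime_gt_1_nat by blast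
  have not_over: "\<not> Q \<subseteq> over p" if "p \<in> split_primes" "of_nat q \<in> Q" "p \<noteq> q" for p Q
    using prime_id_coprime[OF over(1)[OF that(1)] over(7)[OF that(1)] _ over(4)[OF that(1)] q] that(2,3) by blast
  \<comment> \<open>Split, ramified and inert; the last two are told apart by whether an ideal of
    norm q exists.\<close>
  consider (split) "q \<in> split_primes" | (prime) Q where "q \<notin> split_primes" "Q \<in> ideals_of R q"
    | (inert) "q \<notin> split_primes" "ideals_of R q = {}" by blast
  then show ?thesis
  proof cases
    case split
    note P = over[OF split]
    let ?P = "over q" and ?Q = "cnj ` over q"
    have Q: "fideal ?Q" "?Q \<subseteq> R" "nu ?Q = real q"
      using fideal_cnj[OF P(5)] P(6) R_cnj nu_cnj[OF P(5)] P(2) by auto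
    have qQ: "of_nat q \<in> ?Q" using prime_norm_ideal(2)[OF Q q] .
    \<comment> \<open>Inclusion between ideals of equal norm would be equality, but the chosen prime
      differs from its conjugate.\<close>
    have "\<not> ?Q \<subseteq> ?P"
      using lattice_eq_if_nu_eq[OF fideal_is_lat[OF P(5)] fideal_is_lat[OF Q(1)]] P(2,3) Q(3) by auto
    then have "\<forall>p\<in>split_primes. \<not> ?Q \<subseteq> over p" using not_over[OF _ qQ] by blast
    moreover have "J \<subseteq> ?Q" if "n > 0" "J \<in> avoiding split_primes n" "q dvd n" for n J
      using subset_prime_or_cnj[OF _ that(3,1) P(1,7), of J] that(2) split by (auto simp: avoiding_def)
    moreover have "q dvd n \<and> ideals_of R (n div q) \<noteq> {}" if n: "n > 0" "q dvd n" "ideals_of R n \<noteq> {}" for n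
    proof -
      obtain J where J: "J \<in> ideals_of R n" using n(3) by blast
      then consider "J \<subseteq> ?P" | "J \<subseteq> ?Q" using subset_prime_or_cnj[OF J n(2,1) P(1,7)] by blast
      then show ?thesis
        using divide_ideal(2)[OF P(5,6,2) J] divide_ideal(2)[OF Q J] n(2) by cases blast+
    qed
    ultimately show ?thesis using Q q1 by blast
  next
    case prime
    have Q: "fideal Q" "Q \<subseteq> R" "nu Q = real q" using prime(2) by (auto simp: ideals_of_iff is_lat_R nu_R)
    note pr = prime_norm_ideal[OF Q q]
    \<comment> \<open>Otherwise Q and its conjugate, whose product is q R, would split q.\<close>
    have "cnj ` Q = Q"
    proof (rule ccontr)
      assume "cnj ` Q \<noteq> Q"
      moreover have "Q \<star> cnj ` Q = (*) (of_nat q) ` R" using prd_cnj[OF Q(1)] Q(3) by simp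
      ultimately have "q \<in> split_primes"
        using pr(1) prime_id_cnj[OF pr(1)] q unfolding split_primes_def by blast
      then show False using prime(1) by blast
    qed
    then have sub: "J \<subseteq> Q" if "n > 0" "J \<in> ideals_of R n" "q dvd n" for n J
      using subset_prime_or_cnj[OF that(2,3,1) pr] by simp
    moreover have "\<forall>p\<in>split_primes. \<not> Q \<subseteq> over p" using not_over[OF _ pr(2)] prime(1) by blast
    moreover have "q dvd n \<and> ideals_of R (n div q) \<noteq> {}" if n: "n > 0" "q dvd n" "ideals_of R n \<noteq> {}" for n
      using divide_ideal(2)[OF Q _ sub[OF n(1) _ n(2)]] n by blast
    ultimately show ?thesis using Q q1 by (auto simp: avoiding_def)
  next
    case inert
    let ?Q = "(*) (of_nat q) ` R"
    have q0: "q > 0" using q1 by simp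
    have Q: "fideal ?Q" "?Q \<subseteq> R" "nu ?Q = real (q\<^sup>2)"
      using fideal_nat_scale[OF fideal_R q0] R_mult[OF R_nat] nu_nat_scale[OF q0] by auto
    have "of_nat q * 1 \<in> ?Q" using R_1 by blast
    then have qQ: "of_nat q \<in> ?Q" by simp
    have sub: "J \<subseteq> ?Q" if "n > 0" "J \<in> ideals_of R n" "q dvd n" for n J
      by (rule subset_if_no_prime_norm[OF that(2,3,1) q inert(2)])
    moreover have "\<forall>p\<in>split_primes. \<not> ?Q \<subseteq> over p" using not_over[OF _ qQ] inert(1) by blast
    moreover have "q\<^sup>2 dvd n \<and> ideals_of R (n div q\<^sup>2) \<noteq> {}" if n: "n > 0" "q dvd n" "ideals_of R n \<noteq> {}" for n
      using divide_ideal(1,2)[OF Q _ sub[OF n(1) _ n(2)]] n by blast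
    moreover have "q\<^sup>2 > 1" by (rule one_less_power[OF q1]) simp
    ultimately show ?thesis using Q
      by (intro exI[of _ ?Q] exI[of _ "q\<^sup>2"]) (auto simp: avoiding_def)
  qed
qed

text \<open>With Q and a from \<open>ex_dividing_ideal\<close>, the ideals of norm n that avoid the
  chosen primes are the products of Q with such ideals of norm n div a, so existence and uniqueness
  descend to a smaller norm.\<close>

lemma ex1_avoiding:
  assumes "n > 0" "ideals_of R n \<noteq> {}"
  shows "\<exists>!J. J \<in> avoiding split_primes n"
  using assms
proof (induction n rule: less_induct)
  case (less n)
  show ?case
  proof (cases "n = 1")
    case True
    have "\<not> R \<subseteq> over p" if "p \<in> split_primes" for p
      using over(1,6)[OF that] prime_id_neq by blast
    then show ?thesis
      using True ideals_of_1[OF fideal_R] by (auto simp: avoiding_def)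
  next
    case False
    then obtain q where q: "prime q" "q dvd n" using prime_factor_nat by blast
    obtain Q a where Q: "fideal Q" "Q \<subseteq> R" "nu Q = real a" and a: "a > 1"
      and nover: "\<forall>p\<in>split_primes. \<not> Q \<subseteq> over p"
      and sub: "\<forall>n>0. \<forall>J\<in>avoiding split_primes n. q dvd n \<longrightarrow> J \<subseteq> Q"
      and ex: "\<forall>n>0. q dvd n \<longrightarrow> ideals_of R n \<noteq> {} \<longrightarrow> a dvd n \<and> ideals_of R (n div a) \<noteq> {}"
      using ex_dividing_ideal[OF q(1)] by (elim exE conjE) (rule that; assumption)
    have n': "a dvd n" "ideals_of R (n div a) \<noteq> {}"
      using ex[rule_format, OF less.prems(1) q(2) less.prems(2)] by simp_all
    have pos: "n div a > 0" using n'(1) less.prems(1) by (auto intro: Nat.gr0I)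
    have "n div a < n" using a less.prems(1) by simp
    from less.IH[OF this pos n'(2)]
    obtain J1 where J1: "J1 \<in> avoiding split_primes (n div a)"
      "\<forall>J. J \<in> avoiding split_primes (n div a) \<longrightarrow> J = J1"
      by (rule ex1E)
    have J1': "J1 \<in> ideals_of R (n div a)" "\<forall>p\<in>split_primes. \<not> J1 \<subseteq> over p" "J1 \<subseteq> R"
      using J1(1) by (auto simp: avoiding_def ideals_of_def)
    show ?thesis
    proof (rule ex1I)
      have "\<not> Q \<star> J1 \<subseteq> over p" if p: "p \<in> split_primes" for p
        using prime_id_prd[OF over(1)[OF p] Q(2) J1'(3)] bspec[OF nover p] bspec[OF J1'(2) p] by auto
      then show "Q \<star> J1 \<in> avoiding split_primes n"
        using multiply_ideal(1)[OF Q J1'(1)] n'(1) by (simp add: avoiding_def)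
    next
      fix J assume J: "J \<in> avoiding split_primes n"
      have JQ: "J \<subseteq> Q" using sub[rule_format, OF less.prems(1) J q(2)] .
      have J': "J \<in> ideals_of R n" "\<forall>p\<in>split_primes. \<not> J \<subseteq> over p" using J by (auto simp: avoiding_def)
      note d = divide_ideal[OF Q J'(1) JQ]
      have "fideal_inv Q \<star> J \<in> avoiding split_primes (n div a)"
        using d(2,3) J'(2) unfolding avoiding_def by blast
      then have "fideal_inv Q \<star> J = J1" by (rule J1(2)[rule_format])
      then show "J = Q \<star> J1" using d(4) by simp
    qed
  qed
qed

text \<open>If \<open>over p\<close> contains an ideal of norm n, then p divides n, so primes beyond
  N impose no condition.\<close>

lemma card_avoiding_le:
  assumes n: "n > 0" "n \<le> N"
  shows "card (avoiding {p \<in> split_primes. p \<le> N} n) = (if ideals_of R n = {} then 0 else 1)"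
proof -
  have "avoiding {p \<in> split_primes. p \<le> N} n = avoiding split_primes n"
  proof -
    have "p \<le> N" if "J \<in> ideals_of R n" "p \<in> split_primes" "J \<subseteq> over p" for p J
      using divide_ideal(1)[OF over(5,6,2)[OF that(2)] that(1,3)] n dvd_imp_le[of p n] by linarith
    then show ?thesis unfolding avoiding_def by blast
  qed
  moreover have "card (avoiding split_primes n) = 1" if ne: "ideals_of R n \<noteq> {}"
  proof -
    obtain J where "avoiding split_primes n = {J}"
      using ex1_avoiding[OF n(1) ne] by blast
    then show ?thesis by simp
  qed
  moreover have "avoiding split_primes n = {}" if "ideals_of R n = {}"
    using that by (simp add: avoiding_def)
  ultimately show ?thesis by auto
qed

end

section \<open>Dirichlet series\<close>


text \<open>The recursion for the Dirichlet inverse of a series with leading coefficient 1. Proper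
  divisors are taken from \<open>{..<n}\<close> to make the descent visible.\<close>

function ds_inv_coeff :: "(nat \<Rightarrow> complex) \<Rightarrow> nat \<Rightarrow> complex" where
  "ds_inv_coeff f n =
     (if n = 1 then 1 else - (\<Sum>d\<in>{d \<in> {..<n}. d dvd n}. ds_inv_coeff f d * f (n div d)))"
  by auto
termination
  by (relation "measure snd") auto

declare ds_inv_coeff.simps [simp del]

lemma ds_coeff_mult: "ds_coeff (f * g) n = (\<Sum>d | d dvd n. ds_coeff f d * ds_coeff g (n div d))"
  by (simp add: times_dirichlet_series.rep_eq)

lemma ds_unit:
  assumes "ds_coeff f 1 = 1"
  shows "f dvd 1"
proof -
  let ?g = "dirichlet (ds_inv_coeff (ds_coeff f))"
  have "?g * f = 1"
  proof (rule ds_eqI)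
    fix n :: nat assume n: "n > 0"
    have div: "{d. d dvd n} = insert n {d \<in> {..<n}. d dvd n}"
    proof (intro equalityI subsetI)
      fix d assume "d \<in> {d. d dvd n}"
      then have "d dvd n" "d \<le> n" using n by (auto intro: dvd_imp_le)
      then show "d \<in> insert n {d \<in> {..<n}. d dvd n}" by (cases "d = n") auto
    qed auto
    have "ds_coeff (?g * f) n = ds_inv_coeff (ds_coeff f) n
        + (\<Sum>d\<in>{d \<in> {..<n}. d dvd n}. ds_coeff ?g d * ds_coeff f (n div d))"
      unfolding ds_coeff_mult div using n assms by (simp add: ds_coeff_dirichlet)
    also have "(\<Sum>d\<in>{d \<in> {..<n}. d dvd n}. ds_coeff ?g d * ds_coeff f (n div d))
        = (\<Sum>d\<in>{d \<in> {..<n}. d dvd n}. ds_inv_coeff (ds_coeff f) d * ds_coeff f (n div d))"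
      using n by (intro sum.cong) (auto simp: ds_coeff_dirichlet)
    also have "ds_inv_coeff (ds_coeff f) n + \<dots> = ds_coeff 1 n"
    proof (cases "n = 1")
      case True
      then have e: "{d \<in> {..<n}. d dvd n} = {}" by auto
      have i: "ds_inv_coeff (ds_coeff f) n = 1"
        using True by (subst ds_inv_coeff.simps) simp
      show ?thesis
        unfolding e i using True by (simp add: one_dirichlet_series.rep_eq)
    next
      case False
      then show ?thesis
        by (subst ds_inv_coeff.simps) (simp add: one_dirichlet_series.rep_eq)
    qed
    finally show "ds_coeff (?g * f) n = ds_coeff 1 n" .
  qed
  then show ?thesis by (metis dvd_triv_right)
qed

lemma ds_coeff_const_mult:
  assumes "n > 0"
  shows "ds_coeff (ds_const c * f) n = c * ds_coeff f n"
proof -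
  have "ds_coeff (ds_const c * f) n = (\<Sum>d | d dvd n. if d = 1 then c * ds_coeff f n else 0)"
    unfolding ds_coeff_mult using assms by (intro sum.cong) (auto simp: ds_const_def ds_coeff_dirichlet)
  also have "\<dots> = c * ds_coeff f n" using assms by simp
  finally show ?thesis .
qed

lemma ds_coeff_minus: "ds_coeff (f - g) n = ds_coeff f n - ds_coeff g n"
  by (simp add: minus_dirichlet_series.rep_eq)

lemma ds_coeff_plus: "ds_coeff (f + g) n = ds_coeff f n + ds_coeff g n"
  by (simp add: plus_dirichlet_series.rep_eq)

lemma ds_coeff_euler_factor_mult:
  assumes "n > 0" "q > 0"
  shows "ds_coeff ((1 - ds_npow q) * f) n = ds_coeff f n - (if q dvd n then ds_coeff f (n div q) else 0)"
proof -
  have "ds_coeff (ds_npow q * f) n = (\<Sum>d | d dvd n. if d = q then ds_coeff f (n div q) else 0)"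
    unfolding ds_coeff_mult using assms by (intro sum.cong) (auto simp: ds_npow_def ds_coeff_dirichlet)
  also have "\<dots> = (if q dvd n then ds_coeff f (n div q) else 0)" using assms by simp
  finally show ?thesis by (simp add: left_diff_distrib ds_coeff_minus)
qed

text \<open>A factor 1 - p^-s with p > d leaves the coefficient at d unchanged, because p does not
  divide d. So the limit in \<open>ds_infprod\<close> is that of an eventually constant
  sequence.\<close>

lemma ds_coeff_partial_product:
  assumes "d > 0" "d \<le> N"
  shows "ds_coeff (\<Prod>p\<in>{p \<in> A. p \<le> N}. 1 - ds_npow p) d = ds_coeff (\<Prod>p\<in>{p \<in> A. p \<le> d}. 1 - ds_npow p) d"
  using assms(2)
proof (induction N rule: dec_induct)
  case (step N)
  show ?case
  proof (cases "Suc N \<in> A")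
    case True
    then have "{p \<in> A. p \<le> Suc N} = insert (Suc N) {p \<in> A. p \<le> N}" by (auto simp: le_Suc_eq)
    then have "(\<Prod>p\<in>{p \<in> A. p \<le> Suc N}. 1 - ds_npow p) = (1 - ds_npow (Suc N)) * (\<Prod>p\<in>{p \<in> A. p \<le> N}. 1 - ds_npow p)"
      by simp
    moreover have "\<not> Suc N dvd d"
    proof
      assume "Suc N dvd d"
      then have "Suc N \<le> d" using assms(1) by (rule dvd_imp_le)
      then show False using step.hyps by simp
    qed
    ultimately show ?thesis
      using step.IH assms(1) by (simp add: ds_coeff_euler_factor_mult)
  next
    case False
    then have "{p \<in> A. p \<le> Suc N} = {p \<in> A. p \<le> N}" by (auto simp: le_Suc_eq)
    then show ?thesis using step.IH by simp
  qed
qed simp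

lemma ds_coeff_infprod:
  assumes "d > 0" "d \<le> N"
  shows "ds_coeff (ds_infprod (\<lambda>p. 1 - ds_npow p) A) d = ds_coeff (\<Prod>p\<in>{p \<in> A. p \<le> N}. 1 - ds_npow p) d"
proof -
  let ?c = "ds_coeff (\<Prod>p\<in>{p \<in> A. p \<le> d}. 1 - ds_npow p) d"
  have "(\<lambda>N. ds_coeff (\<Prod>p\<in>{p \<in> A. p \<le> N}. 1 - ds_npow p) d) \<longlonglongrightarrow> ?c"
  proof (rule tendsto_eventually)
    show "eventually (\<lambda>N. ds_coeff (\<Prod>p\<in>{p \<in> A. p \<le> N}. 1 - ds_npow p) d = ?c) sequentially"
      using eventually_ge_at_top[of d] by eventually_elim (rule ds_coeff_partial_product[OF assms(1)])
  qed
  then have "lim (\<lambda>N. ds_coeff (\<Prod>p\<in>{p \<in> A. p \<le> N}. 1 - ds_npow p) d) = ?c" by (rule limI)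
  then show ?thesis
    using assms ds_coeff_partial_product[OF assms, of A] by (simp add: ds_infprod_def ds_coeff_dirichlet)
qed

section \<open>Ring-theoretic notions translated into lattices, and the identity of series\<close>

context imag_quadratic
begin

lemma R_eq: "ring_of_integers F = R"
proof
  show "ring_of_integers F \<subseteq> R"
    unfolding ring_of_integers_def R_def using maximal by (auto elim!: FE)
  show "R \<subseteq> ring_of_integers F"
  proof
    fix x assume x: "x \<in> R"
    obtain m t :: int where mt: "x * cnj x = of_int m" "x + cnj x = of_int t"
      using R_norm_trace[OF x] by metis
    have "x * x = (x + cnj x) * x - x * cnj x" by (simp add: algebra_simps)
    then have "x * x = of_int t * x - of_int m" unfolding mt .
    then have "poly [:of_int m, - of_int t, 1:] x = 0" by (simp add: algebra_simps)
    then have "algebraic_int x"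
      by (intro algebraic_int.intros[of "[:of_int m, - of_int t, 1:]"])
         (auto simp: coeff_pCons split: nat.splits)
    then show "x \<in> ring_of_integers F"
      using x R_subset_F by (auto simp: ring_of_integers_def)
  qed
qed

lemma cring_R: "cring (subring_of_complex R)"
proof -
  have "\<exists>y\<in>R. y + x = 0" if "x \<in> R" for x
    using add_subgroup_uminus[OF add_subgroup_R that] by (intro bexI[of _ "- x"]) auto
  then show ?thesis
    using add_subgroup_add[OF add_subgroup_R] add_subgroup_0[OF add_subgroup_R] R_mult R_1
    by (intro cringI abelian_groupI comm_monoidI) (auto simp: subring_of_complex_def algebra_simps)
qed

lemma ideal_iff: "ideal J (int_ring F) \<longleftrightarrow> add_subgroup J \<and> J \<subseteq> R \<and> (\<forall>x\<in>R. \<forall>y\<in>J. x * y \<in> J)"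
proof
  assume "ideal J (int_ring F)"
  then interpret ideal J "int_ring F" .
  have "add_subgroup J"
    unfolding add_subgroup_def
  proof (intro conjI ballI)
    show "0 \<in> J" using additive_subgroup.zero_closed[OF is_additive_subgroup] by (simp add: subring_of_complex_def)
    fix x y assume xy: "x \<in> J" "y \<in> J"
    have "- 1 \<in> R" using R_int[of "- 1"] by simp
    then have "- y \<in> J"
      using I_l_closed[OF xy(2), of "- 1"] by (simp add: subring_of_complex_def R_eq)
    then show "x - y \<in> J" using additive_subgroup.a_closed[OF is_additive_subgroup xy(1) \<open>- y \<in> J\<close>] by (simp add: subring_of_complex_def)
  qed
  moreover have "J \<subseteq> R" using a_subset by (simp add: subring_of_complex_def R_eq)
  moreover have "\<forall>x\<in>R. \<forall>y\<in>J. x * y \<in> J" using I_l_closed by (simp add: subring_of_complex_def R_eq)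
  ultimately show "add_subgroup J \<and> J \<subseteq> R \<and> (\<forall>x\<in>R. \<forall>y\<in>J. x * y \<in> J)" by blast
next
  assume J: "add_subgroup J \<and> J \<subseteq> R \<and> (\<forall>x\<in>R. \<forall>y\<in>J. x * y \<in> J)"
  interpret cring "int_ring F" using cring_R by (simp add: R_eq)
  show "ideal J (int_ring F)"
  proof (rule idealI)
    show "ring (int_ring F)" by (rule ring_axioms)
    show "subgroup J (add_monoid (int_ring F))"
    proof (rule group.subgroupI)
      show "group (add_monoid (int_ring F))" by (rule a_group)
      show "J \<subseteq> carrier (add_monoid (int_ring F))" using J by (simp add: subring_of_complex_def R_eq)
      show "J \<noteq> {}" using J add_subgroup_0 by blast
      show "inv\<^bsub>add_monoid (int_ring F)\<^esub> a \<in> J" if a: "a \<in> J" for a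
      proof -
        have "- a \<in> J" using J a add_subgroup_uminus by blast
        moreover have "\<ominus>\<^bsub>int_ring F\<^esub> a = - a"
        proof (rule minus_equality)
          show "- a \<oplus>\<^bsub>int_ring F\<^esub> a = \<zero>\<^bsub>int_ring F\<^esub>" by (simp add: subring_of_complex_def)
          show "a \<in> carrier (int_ring F)" "- a \<in> carrier (int_ring F)"
            using J a \<open>- a \<in> J\<close> by (auto simp: subring_of_complex_def R_eq)
        qed
        ultimately show ?thesis by (simp add: a_inv_def)
      qed
      show "a \<otimes>\<^bsub>add_monoid (int_ring F)\<^esub> b \<in> J" if "a \<in> J" "b \<in> J" for a b
        using J that add_subgroup_add by (auto simp: subring_of_complex_def)
    qed
    show "x \<otimes>\<^bsub>int_ring F\<^esub> a \<in> J" "a \<otimes>\<^bsub>int_ring F\<^esub> x \<in> J" if "a \<in> J" "x \<in> carrier (int_ring F)" for a x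
      using J that by (auto simp: subring_of_complex_def R_eq mult.commute[of a])
  qed
qed

text \<open>A nonzero x in an ideal brings with it the positive integer x conj(x), which makes the
  ideal commensurable with R.\<close>

lemma fideal_ideal_iff: "fideal J \<and> J \<subseteq> R \<longleftrightarrow> ideal J (int_ring F) \<and> J \<noteq> {0}"
proof
  assume J: "fideal J \<and> J \<subseteq> R"
  then obtain k where "k > 0" "of_int k * 1 \<in> J"
    using is_latE[OF fideal_is_lat] R_1 by metis
  then have "J \<noteq> {0}" by auto
  then show "ideal J (int_ring F) \<and> J \<noteq> {0}"
    using J fideal_subgroup by (auto simp: ideal_iff fideal_def)
next
  assume *: "ideal J (int_ring F) \<and> J \<noteq> {0}"
  then have J: "add_subgroup J" "J \<subseteq> R" "\<forall>x\<in>R. \<forall>y\<in>J. x * y \<in> J" by (auto simp: ideal_iff)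
  then obtain x where x: "x \<in> J" "x \<noteq> 0" using * add_subgroup_0 by blast
  then have xR: "x \<in> R" using J(2) by blast
  obtain m :: int where m: "x * cnj x = of_int m" using R_norm_trace(1)[OF xR] by blast
  have "(cmod x)\<^sup>2 = of_int m" using m by (intro cmod_square_eq) simp
  moreover have "(cmod x)\<^sup>2 > 0" using x by simp
  ultimately have "m > 0" by simp
  have "cnj x * x \<in> J" using J(3) R_cnj[OF xR] x(1) by blast
  then have "of_int m \<in> J" using m by (simp add: mult.commute)
  then have "is_lat J"
    using J \<open>m > 0\<close> R_mult[OF R_int] by (intro is_latI[of _ m]) (auto simp: mult.commute)
  then show "fideal J \<and> J \<subseteq> R" using J by (simp add: fideal_def)
qed

lemma nonzero_ideals_eq: "nonzero_ideals F = {J. fideal J \<and> J \<subseteq> R}"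
  unfolding nonzero_ideals_def fideal_ideal_iff ..

lemma ideal_norm_eq: "ideal_norm F J = lattice_index R J"
proof -
  have "carrier (int_ring F Quot J) = (\<lambda>x. (+) x ` J) ` R"
    by (auto simp: FactRing_def A_RCOSETS_def RCOSETS_def r_coset_def subring_of_complex_def R_eq
        image_def add.commute)
  then show ?thesis by (simp add: ideal_norm_def order_def lattice_index_def)
qed

lemma ideals_of_norm: "{J \<in> nonzero_ideals F. ideal_norm F J = n} = ideals_of R n"
  by (auto simp: nonzero_ideals_eq ideal_norm_eq ideals_of_def)

text \<open>The norms of a unit and of its inverse are nonnegative integers with product 1;
  conversely the conjugate of an element of norm 1 is its inverse.\<close>

lemma unit_count_eq: "unit_count F = card U"
proof -
  have "Units (int_ring F) = U"
  proof (intro equalityI subsetI)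
    fix u assume "u \<in> Units (int_ring F)"
    then obtain v where uv: "u \<in> R" "v \<in> R" "v * u = 1"
      by (auto simp: Units_def subring_of_complex_def R_eq)
    obtain k l :: int where kl: "u * cnj u = of_int k" "v * cnj v = of_int l"
      using R_norm_trace(1) uv by metis
    have "of_int (k * l) = (v * u) * cnj (v * u)" using kl by (simp add: mult_ac)
    then have "k * l = 1" unfolding uv(3) by (metis complex_cnj_one mult_1 of_int_eq_1_iff)
    moreover have "k \<ge> 0"
    proof -
      have "(cmod u)\<^sup>2 = of_int k" using kl(1) by (intro cmod_square_eq) simp
      then show ?thesis using zero_le_power2[of "cmod u"] by simp
    qed
    ultimately have "k = 1" using pos_zmult_eq_1_iff_lemma[of k l] by auto
    then show "u \<in> U" using uv kl by (simp add: U_def)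
  next
    fix u assume "u \<in> U"
    then show "u \<in> Units (int_ring F)"
      using R_cnj by (auto simp: Units_def subring_of_complex_def R_eq U_def mult.commute)
  qed
  then show ?thesis by (simp add: unit_count_def)
qed

text \<open>The coset of J consists of the products (a R) J = a J, which is literally
  \<open>hclass J\<close>.\<close>

lemma ideal_class_eq:
  assumes "fideal J"
  shows "ideal_class F J = hclass J"
proof -
  have "(*) a ` R \<star> J = (*) a ` J" for a
    unfolding scale_prd[symmetric] R_prd[OF assms] ..
  then show ?thesis
    by (auto simp: ideal_class_def r_coset_def fractional_ideal_group_def principal_fractional_ideals_def
        ideal_prod_subring_of_complex hclass_def R_eq)
qed

lemma ideal_classes_of_norm:
  "{c \<in> carrier (class_group F). \<exists>J\<in>nonzero_ideals F. ideal_norm F J = n \<and> c = ideal_class F J}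
    = hclass ` ideals_of R n"
proof -
  have "ideal_class F J \<in> carrier (class_group F)" if "fideal J" "J \<subseteq> R" for J
  proof -
    have "J \<in> fractional_ideals F"
      using that R_1 R_subset_F by (auto simp: fractional_ideals_def nonzero_ideals_eq R_eq intro!: bexI[of _ 1])
    then show ?thesis
      by (auto simp: class_group_def FactGroup_def RCOSETS_def ideal_class_def fractional_ideal_group_def)
  qed
  then show ?thesis
    unfolding ideals_of_norm[symmetric] using ideal_class_eq by (auto simp: nonzero_ideals_eq)
qed

lemma primeideal_iff:
  "primeideal P (int_ring F) \<and> P \<noteq> {0} \<longleftrightarrow> prime_id P"
proof
  assume P: "primeideal P (int_ring F) \<and> P \<noteq> {0}"
  then interpret primeideal P "int_ring F" by blast
  have "fideal P \<and> P \<subseteq> R" using P is_ideal fideal_ideal_iff by blast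
  then show "prime_id P"
    using I_notcarr I_prime by (auto simp: prime_id_def subring_of_complex_def R_eq)
next
  assume P: "prime_id P"
  then have "ideal P (int_ring F) \<and> P \<noteq> {0}" using fideal_ideal_iff prime_id_fideal prime_id_subset by blast
  moreover from this have "primeideal P (int_ring F)"
    using P cring_R by (intro primeidealI) (auto simp: prime_id_def subring_of_complex_def R_eq)
  ultimately show "primeideal P (int_ring F) \<and> P \<noteq> {0}" by blast
qed

lemma split_primes_eq: "{p. prime p \<and> splits_in p F} = split_primes"
proof -
  have "splits_in p F \<longleftrightarrow> (\<exists>P Q. prime_id P \<and> prime_id Q \<and> P \<noteq> Q \<and> P \<star> Q = (*) (of_nat p) ` R)"
    if p: "prime p" for p
  proof -
    have pidl: "PIdl\<^bsub>int_ring F\<^esub> (of_nat p) = (*) (of_nat p) ` R"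
      by (auto simp: cgenideal_def subring_of_complex_def R_eq image_def mult.commute)
    \<comment> \<open>\<open>primeideal\<close> admits the zero ideal and \<open>prime_id\<close>
      does not; a factorization of p R cannot involve it.\<close>
    have nz: "P \<noteq> {0} \<and> Q \<noteq> {0}" if "P \<star> Q = (*) (of_nat p) ` R" for P Q
    proof -
      have z: "add_subgroup {0 :: complex}" by (simp add: add_subgroup_def)
      have "of_nat p * 1 \<in> P \<star> Q" unfolding that using R_1 by blast
      moreover have "of_nat p \<noteq> (0 :: complex)" using p by auto
      ultimately have "\<not> P \<star> Q \<subseteq> {0}" by auto
      then show ?thesis
        using prd_subset[OF z, of P Q] by force
    qed
    show ?thesis
      unfolding splits_in_def ideal_prod_subring_of_complex pidl
      using primeideal_iff nz by metis
  qed
  then show ?thesis unfolding split_primes_def by blast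
qed

lemma ds_coeff_dedekind_zeta: "n > 0 \<Longrightarrow> ds_coeff (dedekind_zeta F) n = of_nat (card (ideals_of R n))"
  by (simp add: dedekind_zeta_def ds_coeff_dirichlet ideals_of_norm)

lemma ds_coeff_ideal_class_series:
  "n > 0 \<Longrightarrow> ds_coeff (ideal_class_series F) n = of_nat (card (hclass ` ideals_of R n))"
  by (simp add: ideal_class_series_def ds_coeff_dirichlet ideal_classes_of_norm)

text \<open>The convolution identity for the subgroups of R, divided by the Dedekind series; that
  series is invertible because R is the only ideal of norm 1.\<close>

lemma zeta_quotient:
  "zeta * ds_shift1 zeta / dedekind_zeta F = dirichlet (\<lambda>f. of_nat (card (generating R f)))"
proof -
  let ?\<Psi> = "dirichlet (\<lambda>f. of_nat (card (generating R f)))"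
  have "zeta * ds_shift1 zeta = dedekind_zeta F * ?\<Psi>"
  proof (rule ds_eqI)
    fix m :: nat assume m: "m > 0"
    have pos: "d > 0" "m div d > 0" if "d dvd m" for d
      using that m by (auto intro: Nat.gr0I)
    have "ds_coeff (zeta * ds_shift1 zeta) m = (\<Sum>d | d dvd m. of_nat (m div d))"
      unfolding ds_coeff_mult using pos
      by (intro sum.cong) (auto simp: zeta_def ds_shift1_def ds_coeff_dirichlet)
    also have "\<dots> = (\<Sum>d | d dvd m. of_nat d)"
      by (rule sum.reindex_bij_witness[of _ "\<lambda>d. m div d" "\<lambda>d. m div d"])
         (use m in \<open>auto simp: div_div_eq_right\<close>)
    also have "\<dots> = of_nat (\<Sum>{d. d dvd m})" by simp
    also have "\<dots> = (\<Sum>n | n dvd m. of_nat (card (ideals_of R n)) * of_nat (card (generating R (m div n))))"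
      unfolding sum_divisors_eq_convolution[OF m] by simp
    also have "\<dots> = ds_coeff (dedekind_zeta F * ?\<Psi>) m"
      unfolding ds_coeff_mult using pos
      by (intro sum.cong) (auto simp: ds_coeff_dedekind_zeta ds_coeff_dirichlet)
    finally show "ds_coeff (zeta * ds_shift1 zeta) m = ds_coeff (dedekind_zeta F * ?\<Psi>) m" .
  qed
  then have "zeta * ds_shift1 zeta / dedekind_zeta F = ?\<Psi> * (dedekind_zeta F * inverse (dedekind_zeta F))"
    by (simp add: divide_dirichlet_series_def mult_ac)
  also have "dedekind_zeta F * inverse (dedekind_zeta F) = 1"
    by (intro ds_times_inverse ds_unit) (use ds_coeff_dedekind_zeta[of 1] ideals_of_1[OF fideal_R] in simp)
  finally show ?thesis by simp
qed

text \<open>A sieve: each factor removes the ideals divisible by one chosen prime.\<close>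

lemma ds_coeff_prod_dedekind_zeta:
  assumes "finite A" "A \<subseteq> split_primes" "n > 0"
  shows "ds_coeff ((\<Prod>p\<in>A. 1 - ds_npow p) * dedekind_zeta F) n = of_nat (card (avoiding A n))"
  using assms
proof (induction A arbitrary: n rule: finite_induct)
  case empty
  then show ?case by (simp add: ds_coeff_dedekind_zeta avoiding_def)
next
  case (insert q A)
  have q: "q > 0" using insert.prems(1) by (auto simp: split_primes_def prime_gt_0_nat)
  have IH: "ds_coeff ((\<Prod>p\<in>A. 1 - ds_npow p) * dedekind_zeta F) n = of_nat (card (avoiding A n))" if "n > 0" for n
    using insert.IH insert.prems(1) that by simp
  have "n div q > 0" if "q dvd n" using that insert.prems(2) by (auto intro: Nat.gr0I)
  then show ?case
    using insert.hyps insert.prems q card_avoiding_insert[OF insert.prems(1) insert.hyps(2) insert.prems(2)]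
    by (simp add: mult.assoc ds_coeff_euler_factor_mult IH)
qed

text \<open>The coefficient at n involves only divisors of n, where the infinite product agrees with
  the finite product over p <= n.\<close>

lemma ds_coeff_infprod_dedekind_zeta:
  assumes n: "n > 0"
  shows "ds_coeff (ds_infprod (\<lambda>p. 1 - ds_npow p) split_primes * dedekind_zeta F) n
    = (if ideals_of R n = {} then 0 else 1)"
proof -
  let ?A = "{p \<in> split_primes. p \<le> n}"
  have "ds_coeff (ds_infprod (\<lambda>p. 1 - ds_npow p) split_primes * dedekind_zeta F) n
      = ds_coeff ((\<Prod>p\<in>?A. 1 - ds_npow p) * dedekind_zeta F) n"
    unfolding ds_coeff_mult
  proof (intro sum.cong refl)
    fix d assume "d \<in> {d. d dvd n}"
    then have "d > 0" "d \<le> n" using n by (auto intro: Nat.gr0I dvd_imp_le)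
    then show "ds_coeff (ds_infprod (\<lambda>p. 1 - ds_npow p) split_primes) d * ds_coeff (dedekind_zeta F) (n div d)
        = ds_coeff (\<Prod>p\<in>?A. 1 - ds_npow p) d * ds_coeff (dedekind_zeta F) (n div d)"
      by (simp add: ds_coeff_infprod)
  qed
  also have "\<dots> = of_nat (card (avoiding ?A n))"
    by (rule ds_coeff_prod_dedekind_zeta) (use n in auto)
  finally show ?thesis
    using card_avoiding_le[OF n order_refl] by simp
qed

text \<open>The convolution over ideals and subgroups factors the left side as the class series
  times 2 / w psi + (w - 2) / w, where the constant series repairs the coefficient at f = 1.\<close>

theorem classes_series_eq:
  assumes M: "fideal M" and w: "w = unit_count F"
  shows "dirichlet (\<lambda>m. of_nat (card (hclass ` subgroups_of M m))) =
      ds_const (2 / of_nat w) * (zeta * ds_shift1 zeta / dedekind_zeta F) * ideal_class_series F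
    + ds_const ((of_nat w - 2) / of_nat w)
        * ds_infprod (\<lambda>p. 1 - ds_npow p) {p. prime p \<and> splits_in p F} * dedekind_zeta F"
proof -
  let ?C = "ideal_class_series F" and ?\<Psi> = "dirichlet (\<lambda>f. of_nat (card (generating R f)))"
    and ?E = "ds_infprod (\<lambda>p. 1 - ds_npow p) split_primes * dedekind_zeta F"
    and ?c = "(of_nat w - 2) / of_nat w :: complex"
  have w': "w = card U" "w > 0" using w unit_count_eq card_U_pos by auto
  \<comment> \<open>If w = 2 the constant is 0; otherwise all ideals are principal and both series
    have the indicator of the norms as coefficients.\<close>
  have E: "ds_const ?c * ?E = ds_const ?c * ?C"
  proof (rule ds_eqI)
    fix n :: nat assume n: "n > 0"
    show "ds_coeff (ds_const ?c * ?E) n = ds_coeff (ds_const ?c * ?C) n"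
    proof (cases "card U = 2")
      case True
      then show ?thesis using w' n by (simp add: ds_coeff_const_mult)
    next
      case False
      then have "card (hclass ` ideals_of R n) = (if ideals_of R n = {} then 0 else 1)"
        using card_U_eq_2_or_principal by blast
      then show ?thesis
        using n by (simp only: ds_coeff_const_mult ds_coeff_infprod_dedekind_zeta ds_coeff_ideal_class_series) simp
    qed
  qed
  have "dirichlet (\<lambda>m. of_nat (card (hclass ` subgroups_of M m))) = ?C * (ds_const (2 / of_nat w) * ?\<Psi> + ds_const ?c)"
  proof (rule ds_eqI)
    fix m :: nat assume m: "m > 0"
    have pos: "n > 0" "m div n > 0" if "n dvd m" for n
      using that m by (auto intro: Nat.gr0I)
    have "complex_of_real (real (card (hclass ` subgroups_of M m))) = (\<Sum>n | n dvd m. of_nat (card (hclass ` ideals_of R n))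
        * (if m div n = 1 then 1 else 2 * of_nat (card (generating R (m div n))) / of_nat (card U)))"
      unfolding card_classes_subgroups_of_eq[OF M m] of_real_sum by (intro sum.cong) auto
    also have "\<dots> = ds_coeff (?C * (ds_const (2 / of_nat w) * ?\<Psi> + ds_const ?c)) m"
      unfolding ds_coeff_mult
    proof (intro sum.cong refl)
      fix n assume "n \<in> {n. n dvd m}"
      then have n: "n > 0" "m div n > 0" using pos by auto
      have "ds_coeff (ds_const (2 / of_nat w) * ?\<Psi> + ds_const ?c) (m div n)
          = (if m div n = 1 then 1 else 2 * of_nat (card (generating R (m div n))) / of_nat (card U))"
      proof -
        have A: "ds_coeff (ds_const (2 / of_nat w) * ?\<Psi>) (m div n) = 2 / of_nat w * of_nat (card (generating R (m div n)))"
          using n(2) by (simp only: ds_coeff_const_mult ds_coeff_dirichlet) simp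
        have B: "ds_coeff (ds_const ?c) (m div n) = (if m div n = 1 then ?c else 0)"
          using n(2) by (simp only: ds_const_def ds_coeff_dirichlet) simp
        show ?thesis
          unfolding ds_coeff_plus A B using w' generating_1[OF fideal_R] by (auto simp: field_simps)
      qed
      then show "of_nat (card (hclass ` ideals_of R n))
          * (if m div n = 1 then 1 else 2 * of_nat (card (generating R (m div n))) / of_nat (card U))
        = ds_coeff ?C n * ds_coeff (ds_const (2 / of_nat w) * ?\<Psi> + ds_const ?c) (m div n)"
        using n by (simp add: ds_coeff_ideal_class_series)
    qed
    finally show "ds_coeff (dirichlet (\<lambda>m. of_nat (card (hclass ` subgroups_of M m)))) m
        = ds_coeff (?C * (ds_const (2 / of_nat w) * ?\<Psi> + ds_const ?c)) m"
      using m by (simp add: ds_coeff_dirichlet)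
  qed
  also have "\<dots> = ds_const (2 / of_nat w) * ?\<Psi> * ?C + ds_const ?c * ?C"
    by (simp add: algebra_simps)
  also have "\<dots> = ds_const (2 / of_nat w) * ?\<Psi> * ?C + ds_const ?c * ?E"
    unfolding E ..
  finally show ?thesis
    unfolding zeta_quotient split_primes_eq by (simp add: mult.assoc)
qed

end

section \<open>Two-dimensional spaces and field discriminants\<close>


lemma det_mat2: "det (mat 2 2 f) = f (0, 0) * f (1, 1) - f (0, 1) * (f (1, 0) :: 'a::comm_ring_1)"
proof -
  let ?A = "mat 2 2 f"
  have A: "?A \<in> carrier_mat 2 2" by simp
  have d: "det (mat_delete ?A 0 j) = mat_delete ?A 0 j $$ (0, 0)" for j
    by (rule det_single) (simp add: mat_delete_def)
  have "det ?A = (\<Sum>j<2. ?A $$ (0, j) * cofactor ?A 0 j)"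
    by (rule laplace_expansion_row[OF A]) simp
  also have "\<dots> = f (0, 0) * f (1, 1) - f (0, 1) * f (1, 0)"
    unfolding cofactor_def d by (simp add: mat_delete_def numeral_2_eq_2)
  finally show ?thesis .
qed

locale rat_vector_space = vector_space scale
  for scale :: "rat \<Rightarrow> 'v::ab_group_add \<Rightarrow> 'v"
begin

lemma basis_of_length_eq:
  assumes "basis_of scale W e" "basis_of scale W e'"
  shows "length e = length e'"
proof -
  have "dim (set e) = card (set e')" "dim (set e) = card (set e)"
    using assms unfolding basis_of_def by (metis dim_eq_card)+
  then show ?thesis
    using assms by (simp add: basis_of_def distinct_card)
qed

lemma basis_of_pair:
  "basis_of scale W [u, v] \<longleftrightarrow> u \<noteq> v \<and> independent {u, v} \<and> span {u, v} = W"
  by (simp add: basis_of_def)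

lemma basis_of_length_2:
  assumes "basis_of scale W e" "length e = 2"
  obtains u v where "e = [u, v]" "u \<noteq> v" "independent {u, v}" "span {u, v} = W"
proof -
  obtain u v where e: "e = [u, v]"
    using assms(2) by (auto simp: length_Suc_conv numeral_2_eq_2)
  show thesis
    using that[OF e] assms(1) unfolding e basis_of_pair by blast
qed

lemma span_pair: "x \<in> span {u, v} \<longleftrightarrow> (\<exists>a b. x = scale a u + scale b v)"
proof -
  have "x - scale a u = scale b v \<longleftrightarrow> x = scale a u + scale b v" for a b
    by (auto simp: algebra_simps)
  then show ?thesis
    unfolding span_breakdown_eq[of x u] span_singleton by auto
qed

lemma representation_pair:
  assumes "independent {u, v}" "u \<noteq> v" "x \<in> span {u, v}"
  shows "x = scale (representation {u, v} x u) u + scale (representation {u, v} x v) v"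
  using sum_representation_eq[OF assms(1,3), of "{u, v}"] assms(2) by simp

lemma int_span_pair:
  "int_span scale [u, v] = range (\<lambda>(p :: int, q :: int). scale (of_int p) u + scale (of_int q) v)"
proof (intro equalityI subsetI)
  fix x assume "x \<in> int_span scale [u, v]"
  then show "x \<in> range (\<lambda>(p :: int, q :: int). scale (of_int p) u + scale (of_int q) v)"
    by (auto simp: int_span_def)
next
  fix x assume "x \<in> range (\<lambda>(p :: int, q :: int). scale (of_int p) u + scale (of_int q) v)"
  then obtain p q :: int where "x = scale (of_int p) u + scale (of_int q) v" by auto
  then show "x \<in> int_span scale [u, v]"
    unfolding int_span_def by (intro image_eqI[where x = "\<lambda>i. if i = 0 then p else q"]) simp_all
qed

text \<open>\<open>endo_det\<close> and \<open>endo_trace\<close> refer to an unspecified basis.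
  Naming it u, v makes both computable without a proof of invariance; ratios of areas eliminate u
  and v later.\<close>

lemma endo_det_trace_2:
  assumes e: "basis_of scale W e" "length e = 2" and f: "\<And>x. x \<in> W \<Longrightarrow> f x \<in> W"
  shows "\<exists>u v p q r t. u \<in> W \<and> v \<in> W \<and> W = span {u, v} \<and>
    f u = scale p u + scale q v \<and> f v = scale r u + scale t v \<and>
    endo_det scale W f = p * t - q * r \<and> endo_trace scale W f = p + t"
proof -
  define e' where "e' = (SOME e. basis_of scale W e)"
  have e': "basis_of scale W e'"
    unfolding e'_def using e(1) by (rule someI)
  have "length e' = 2" using basis_of_length_eq[OF e' e(1)] e(2) by simp
  then obtain u v where uv: "e' = [u, v]" "u \<noteq> v" "independent {u, v}" "span {u, v} = W"
    using basis_of_length_2[OF e'] by blast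
  have mem: "u \<in> W" "v \<in> W" using uv(4) span_base by blast+
  let ?r = "representation {u, v}"
  have fu: "f u = scale (?r (f u) u) u + scale (?r (f u) v) v"
    by (rule representation_pair[OF uv(3,2)]) (simp add: uv(4) f mem)
  have fv: "f v = scale (?r (f v) u) u + scale (?r (f v) v) v"
    by (rule representation_pair[OF uv(3,2)]) (simp add: uv(4) f mem)
  have l2: "length [u, v] = 2" by simp
  have "endo_det scale W f = ?r (f u) u * ?r (f v) v - ?r (f u) v * ?r (f v) u"
    unfolding endo_det_def e'_def[symmetric] uv(1) matrix_of_def l2 det_mat2 by simp
  moreover have "endo_trace scale W f = ?r (f u) u + ?r (f v) v"
    unfolding endo_trace_def e'_def[symmetric] uv(1) matrix_of_def l2 by (simp add: diag_mat_def numeral_2_eq_2)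
  ultimately show ?thesis
    using mem uv(4) fu fv by blast
qed

end

lemma vector_space_rat: "rat_vector_space (\<lambda>q z. of_rat q * z :: complex)"
  by unfold_locales (auto simp: algebra_simps of_rat_add of_rat_mult)

lemma area_rat_lin:
  "area (of_rat p * \<alpha> + of_rat q * \<beta>) (of_rat r * \<alpha> + of_rat t * \<beta>) = of_rat (p * t - q * r) * area \<alpha> \<beta>"
  using area_lin[of "of_rat p" \<alpha> "of_rat q" \<beta> "of_rat r" "of_rat t"]
  by (simp add: of_real_of_rat of_rat_diff of_rat_mult)

text \<open>The trace as a derivation of the area form: the left side is the trace of multiplication
  by x times the area, in whatever basis u, v.\<close>

lemma area_Re: "area (x * u) v + area u (x * v) = 2 * Re x * area u v"
  by (simp add: area_def algebra_simps)

text \<open>The left side is the Gram determinant of the trace form 2 Re(x y), so discriminants of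
  bases become squares of areas.\<close>

lemma area_square: "4 * (Re (x * x) * Re (y * y) - Re (x * y) * Re (x * y)) = - (2 * area x y)\<^sup>2"
  by (simp add: area_def power2_eq_square algebra_simps)

locale quadratic_discriminant =
  fixes D :: rat
  assumes D_neg: "D < 0"
begin

definition s :: complex where "s = csqrt (of_rat D)"

lemma s_square: "s * s = of_rat D"
  unfolding s_def by (metis power2_csqrt power2_eq_square)

lemma s_eq: "s = \<i> * of_real (sqrt \<bar>of_rat D\<bar>)"
proof -
  have "(of_rat D :: real) < 0" using D_neg by simp
  then show ?thesis
    unfolding s_def using csqrt_of_real'[of "of_rat D"] by (simp add: of_real_of_rat)
qed

lemma s_parts: "Re s = 0" "Im s \<noteq> 0"
  using D_neg by (simp_all add: s_eq)

lemma basis_field: "basis_of rat_scale (quadratic_field D) [1, s]"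
proof -
  interpret rat_vector_space rat_scale by (rule vector_space_rat)
  have Im_rat: "Im (of_rat k * s) = of_rat k * Im s" for k
    by (simp flip: of_real_of_rat)
  have "1 \<noteq> s" using s_parts by auto
  moreover have "1 \<notin> span {s}"
  proof
    assume "1 \<in> span {s}"
    then obtain k where k: "1 = of_rat k * s" unfolding span_singleton by auto
    then have "of_rat k * Im s = 0" using Im_rat[of k] by (metis one_complex.sel(2))
    then have "k = 0" using s_parts by simp
    then show False using k by simp
  qed
  moreover have "independent {s}"
    using s_parts by (auto simp: independent_insert independent_empty)
  ultimately have "independent {1, s}"
    by (simp add: independent_insert)
  moreover have "span {1, s} = quadratic_field D"
    unfolding quadratic_field_def s_def[symmetric] by (simp add: set_eq_iff span_pair)
  ultimately show ?thesis
    using \<open>1 \<noteq> s\<close> by (simp add: basis_of_pair)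
qed

lemma field_mult:
  assumes "x \<in> quadratic_field D" "y \<in> quadratic_field D"
  shows "x * y \<in> quadratic_field D"
proof -
  obtain a b c d where xy: "x = of_rat a + of_rat b * s" "y = of_rat c + of_rat d * s"
    using assms by (auto simp: quadratic_field_def s_def)
  have "x * y = of_rat (a * c) + of_rat (a * d + b * c) * s + of_rat (b * d) * (s * s)"
    unfolding xy by (simp add: of_rat_add of_rat_mult algebra_simps)
  also have "\<dots> = of_rat (a * c + b * d * D) + of_rat (a * d + b * c) * s"
    unfolding s_square by (simp add: of_rat_add of_rat_mult algebra_simps)
  finally show ?thesis by (auto simp: quadratic_field_def s_def)
qed

lemma area_span_nonzero:
  assumes "quadratic_field D = module.span rat_scale {u, v}"
  shows "area u v \<noteq> 0"
proof -
  interpret rat_vector_space rat_scale by (rule vector_space_rat)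
  have "1 = of_rat 1 + of_rat 0 * csqrt (of_rat D)" "s = of_rat 0 + of_rat 1 * csqrt (of_rat D)"
    by (simp_all add: s_def)
  then have "1 \<in> quadratic_field D" "s \<in> quadratic_field D"
    unfolding quadratic_field_def by blast+
  then obtain a b c d where e: "1 = of_rat a * u + of_rat b * v" "s = of_rat c * u + of_rat d * v"
    unfolding assms span_pair by auto
  have "area 1 s \<noteq> 0" using s_parts by (simp add: area_def)
  then show ?thesis
    unfolding e[symmetric] using area_rat_lin[of a u b v c d] unfolding e[symmetric] by auto
qed

lemma field_trace_eq:
  assumes x: "x \<in> quadratic_field D"
  shows "of_rat (field_trace (quadratic_field D) x) = 2 * Re x"
proof -
  interpret rat_vector_space rat_scale by (rule vector_space_rat)
  obtain u v p q r t where *: "quadratic_field D = span {u, v}"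
    "x * u = of_rat p * u + of_rat q * v" "x * v = of_rat r * u + of_rat t * v"
    "endo_trace rat_scale (quadratic_field D) ((*) x) = p + t"
    using endo_det_trace_2[OF basis_field, of "(*) x"] field_mult[OF x] by auto
  have nz: "area u v \<noteq> 0" by (rule area_span_nonzero[OF *(1)])
  have "area (x * u) v = of_rat p * area u v"
    unfolding *(2) using area_rat_lin[of p u q v 0 1] by simp
  moreover have "area u (x * v) = of_rat t * area u v"
    unfolding *(3) using area_rat_lin[of 1 u 0 v r t] by simp
  ultimately have "(of_rat p + of_rat t) * area u v = 2 * Re x * area u v"
    using area_Re[of x u v] by (simp add: algebra_simps)
  then have "of_rat p + of_rat t = 2 * Re x" using nz by simp
  then show ?thesis
    unfolding field_trace_def using *(4) by (simp add: of_rat_add)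
qed

text \<open>An integral basis u, v satisfies (2 area u v)^2 = -D, and 1, \<omega> are two integers
  of the field with (2 area 1 \<omega>)^2 = -D as well. So the matrix expressing 1, \<omega> in u, v
  is unimodular.\<close>

lemma ring_of_integers_eq:
  fixes b n :: int
  assumes disc: "is_field_discriminant (quadratic_field D) D" and D: "D = of_int (b * b - 4 * n)"
    and \<omega>: "\<omega> = (of_int b + s) / 2"
  shows "ring_of_integers (quadratic_field D) = lat 1 \<omega>" "\<omega> * \<omega> = of_int b * \<omega> - of_int n" "Im \<omega> \<noteq> 0"
proof -
  interpret rat_vector_space rat_scale by (rule vector_space_rat)
  obtain w where w: "basis_of rat_scale (quadratic_field D) w"
    "int_span rat_scale w = ring_of_integers (quadratic_field D)"
    "gram_det (\<lambda>x y. field_trace (quadratic_field D) (x * y)) w = D"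
    using disc unfolding is_field_discriminant_def by blast
  have "length w = 2" using basis_of_length_eq[OF w(1) basis_field] by simp
  then obtain u v where uv: "w = [u, v]" "span {u, v} = quadratic_field D"
    using basis_of_length_2[OF w(1)] by blast
  have mem: "u \<in> quadratic_field D" "v \<in> quadratic_field D"
    using uv(2) span_base by blast+
  have O: "ring_of_integers (quadratic_field D) = lat u v"
    unfolding w(2)[symmetric] uv(1) by (simp add: int_span_pair lat_def)
  have "of_rat D = - (2 * area u v)\<^sup>2"
  proof -
    let ?T = "\<lambda>x y. field_trace (quadratic_field D) (x * y)"
    have l2: "length [u, v] = 2" by simp
    have "D = ?T u u * ?T v v - ?T u v * ?T v u"
      using w(3) unfolding uv(1) gram_det_def l2 det_mat2 by simp
    then have "(of_rat D :: real) = of_rat (?T u u) * of_rat (?T v v) - of_rat (?T u v) * of_rat (?T v u)"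
      by (metis of_rat_diff of_rat_mult)
    also have "\<dots> = 4 * (Re (u * u) * Re (v * v) - Re (u * v) * Re (u * v))"
      unfolding mult.commute[of v u] field_trace_eq[OF field_mult[OF mem(1) mem(1)]]
        field_trace_eq[OF field_mult[OF mem(2) mem(2)]] field_trace_eq[OF field_mult[OF mem]]
      by (simp only: algebra_simps)
    finally show ?thesis using area_square[of u v] by simp
  qed
  have Ds: "(of_rat D :: real) = - (Im s)\<^sup>2"
  proof -
    have "Re (s * s) = - (Im s)\<^sup>2" using s_parts by (simp add: power2_eq_square)
    moreover have "Re (s * s) = of_rat D" unfolding s_square by (simp flip: of_real_of_rat)
    ultimately show ?thesis by simp
  qed
  have Im\<omega>: "area 1 \<omega> = Im s / 2" by (simp add: area_def \<omega>)
  then show "Im \<omega> \<noteq> 0" using s_parts by (simp add: area_def)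
  have sq: "(area u v)\<^sup>2 = (area 1 \<omega>)\<^sup>2"
    using Ds \<open>of_rat D = - (2 * area u v)\<^sup>2\<close> unfolding Im\<omega> by (simp add: power_mult_distrib power_divide)
  have sD: "s * s = of_int (b * b - 4 * n)"
    unfolding s_square using D by (simp only: of_rat_of_int_eq)
  have "4 * (\<omega> * \<omega>) = of_int b * of_int b + 2 * of_int b * s + s * s"
    unfolding \<omega> by (simp add: algebra_simps)
  also have "\<dots> = 4 * (of_int b * \<omega> - of_int n)"
    unfolding sD \<omega> by (simp add: algebra_simps)
  finally have "4 * (\<omega> * \<omega>) = 4 * (of_int b * \<omega> - of_int n)" .
  then show om2: "\<omega> * \<omega> = of_int b * \<omega> - of_int n"
    by (simp only: mult_cancel_left) simp
  have "poly [:of_int n, - of_int b, 1:] \<omega> = 0" using om2 by (simp add: algebra_simps)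
  then have "algebraic_int \<omega>"
    by (intro algebraic_int.intros[of "[:of_int n, - of_int b, 1:]"])
       (auto simp: coeff_pCons split: nat.splits)
  moreover have "\<omega> = of_rat (of_int b / 2) + of_rat (1 / 2) * csqrt (of_rat D)"
    by (simp add: \<omega> s_def of_rat_divide field_simps)
  then have "\<omega> \<in> quadratic_field D" unfolding quadratic_field_def by blast
  ultimately have "\<omega> \<in> lat u v" unfolding O[symmetric] ring_of_integers_def by simp
  moreover have "1 = of_rat 1 + of_rat 0 * csqrt (of_rat D)" by simp
  then have "1 \<in> quadratic_field D" unfolding quadratic_field_def by blast
  then have "1 \<in> lat u v" unfolding O[symmetric] ring_of_integers_def by simp
  ultimately obtain x y z t where e: "1 = of_int x * u + of_int y * v" "\<omega> = of_int z * u + of_int t * v"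
    by (metis latE)
  define k where "k = x * t - y * z"
  have "area 1 \<omega> = of_int k * area u v"
    unfolding e k_def by (rule area_lin_int)
  moreover have "area 1 \<omega> \<noteq> 0" using Im\<omega> s_parts by simp
  ultimately have "(real_of_int k)\<^sup>2 = 1"
    using sq by (simp add: power_mult_distrib)
  then have "k = 1 \<or> k = -1" by (simp add: power2_eq_1_iff) linarith
  then have k1: "of_int k * (of_int k * x) = x" for x :: complex by auto
  \<comment> \<open>Cramer's rule; since k is 1 or -1, multiplying by k once more returns u and v
    themselves.\<close>
  have "of_int k * u = of_int t * 1 + of_int (- y) * \<omega>" "of_int k * v = of_int (- z) * 1 + of_int x * \<omega>"
    unfolding e k_def by (simp_all add: algebra_simps)
  then have "of_int k * u \<in> lat 1 \<omega>" "of_int k * v \<in> lat 1 \<omega>" by (simp_all only: lat_mem)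
  then have "of_int k * (of_int k * u) \<in> lat 1 \<omega>" "of_int k * (of_int k * v) \<in> lat 1 \<omega>"
    by (simp_all only: add_subgroup_of_int_mult[OF add_subgroup_lat])
  then have "lat u v \<subseteq> lat 1 \<omega>" by (simp add: lat_subset_iff k1)
  moreover have "lat 1 \<omega> \<subseteq> lat u v"
    using \<open>1 \<in> lat u v\<close> \<open>\<omega> \<in> lat u v\<close> by (simp add: lat_subset_iff)
  ultimately show "ring_of_integers (quadratic_field D) = lat 1 \<omega>" using O by blast
qed

lemma quadratic_field_eq:
  assumes \<omega>: "\<omega> = (of_int b + s) / 2"
  shows "quadratic_field D = range (\<lambda>(x, y). of_rat x + of_rat y * \<omega>)"
proof (intro equalityI subsetI)
  fix z assume "z \<in> quadratic_field D"
  then obtain x y where "z = of_rat x + of_rat y * s" by (auto simp: quadratic_field_def s_def)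
  then have "z = of_rat (x - y * of_int b) + of_rat (2 * y) * \<omega>"
    by (simp add: \<omega> of_rat_diff of_rat_mult algebra_simps)
  then show "z \<in> range (\<lambda>(x, y). of_rat x + of_rat y * \<omega>)" by auto
next
  fix z assume "z \<in> range (\<lambda>(x, y). of_rat x + of_rat y * \<omega>)"
  then obtain x y where "z = of_rat x + of_rat y * \<omega>" by auto
  then have "z = of_rat (x + y * of_int b / 2) + of_rat (y / 2) * csqrt (of_rat D)"
    by (simp add: \<omega> s_def of_rat_add of_rat_mult of_rat_divide field_simps)
  then show "z \<in> quadratic_field D" unfolding quadratic_field_def by blast
qed

end

section \<open>Binary lattices as ideals\<close>


lemma card_quotient_kernel:
  assumes "\<And>x y. x \<in> S \<Longrightarrow> y \<in> S \<Longrightarrow> P x y \<longleftrightarrow> h x = h y"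
  shows "card (S // {(x, y) \<in> S \<times> S. P x y}) = card (h ` S)"
proof -
  let ?r = "{(x, y) \<in> S \<times> S. P x y}"
  have cls: "?r `` {x} = {y \<in> S. h y = h x}" if "x \<in> S" for x
    using that assms[OF that] by auto
  have "S // ?r = (\<lambda>c. {y \<in> S. h y = c}) ` h ` S"
    unfolding quotient_def image_image using cls by auto
  moreover have "inj_on (\<lambda>c. {y \<in> S. h y = c}) (h ` S)"
    by (rule inj_onI) blast
  ultimately show ?thesis by (simp add: card_image)
qed

text \<open>The form is A x^2 + \<tau> x y + C y^2, and A times it is the norm of A x + \<omega> y
  when \<omega> is a root of X^2 - \<tau> X + A C. This is the origin of \<kappa> = A C and of the
  ideal Z A + Z \<omega>.\<close>

locale binary_lattice = pos_def_quadratic_space scale B + imag_quadratic \<omega> \<tau> \<kappa>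
  for scale :: "rat \<Rightarrow> 'v::ab_group_add \<Rightarrow> 'v" and B \<omega> \<tau> \<kappa> +
  fixes e1 e2 :: 'v and A C :: int
  assumes basis: "basis_of scale UNIV [e1, e2]" and A_pos: "A > 0"
    and B11: "B e1 e1 = of_int A" and B12: "2 * B e1 e2 = of_int \<tau>" and B22: "B e2 e2 = of_int C"
    and kappa: "\<kappa> = A * C"
begin

sublocale rat_vector_space scale by unfold_locales

lemma e_basis: "e1 \<noteq> e2" "independent {e1, e2}" "span {e1, e2} = UNIV"
  using basis by (simp_all add: basis_of_pair)

text \<open>This sends the form \<open>B x x\<close> to \<open>norm (\<phi> x)\<^sup>2 / A\<close>.\<close>

definition \<phi> :: "'v \<Rightarrow> complex" where
  "\<phi> v = of_rat (representation {e1, e2} v e1) * of_int A + of_rat (representation {e1, e2} v e2) * \<omega>"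

lemma \<phi>_add: "\<phi> (x + y) = \<phi> x + \<phi> y"
  by (simp add: \<phi>_def representation_add e_basis of_rat_add algebra_simps)

lemma \<phi>_scale: "\<phi> (scale q x) = of_rat q * \<phi> x"
  by (simp add: \<phi>_def representation_scale e_basis of_rat_mult algebra_simps)

lemma \<phi>_e: "\<phi> e1 = of_int A" "\<phi> e2 = \<omega>"
  using e_basis(1) by (simp_all add: \<phi>_def representation_basis e_basis e_basis(1)[symmetric])

lemma \<phi>_0: "\<phi> 0 = 0"
  using \<phi>_scale[of 0 0] by simp

lemma \<phi>_lin: "\<phi> (scale x u + scale y v) = of_rat x * \<phi> u + of_rat y * \<phi> v"
  by (simp add: \<phi>_add \<phi>_scale)

lemma coords: obtains x y where "v = scale x e1 + scale y e2"
  using e_basis(3) span_pair[of v e1 e2] by auto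

lemma area_e: "area (of_int A) \<omega> \<noteq> 0"
  using A_pos Im_om by (simp add: area_def)

lemma inj_\<phi>: "inj \<phi>"
proof (rule injI)
  fix u v assume eq: "\<phi> u = \<phi> v"
  obtain x y where u: "u = scale x e1 + scale y e2" by (rule coords)
  obtain x' y' where v: "v = scale x' e1 + scale y' e2" by (rule coords)
  have "of_real (of_rat x) * of_int A + of_real (of_rat y) * \<omega>
      = of_real (of_rat x') * of_int A + of_real (of_rat y') * \<omega>"
    using eq by (simp add: u v \<phi>_lin \<phi>_e of_real_of_rat)
  from lat_coord_unique[OF area_e this] show "u = v"
    by (simp add: u v)
qed

lemma range_\<phi>: "range \<phi> = F"
proof (intro equalityI subsetI)
  fix z assume "z \<in> range \<phi>"
  then obtain v where v: "z = \<phi> v" by blast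
  obtain x y where "v = scale x e1 + scale y e2" by (rule coords)
  then have "z = of_rat (x * of_int A) + of_rat y * \<omega>"
    by (simp add: v \<phi>_lin \<phi>_e of_rat_mult)
  then show "z \<in> F" by (simp only: F_mem)
next
  fix z assume "z \<in> F"
  then obtain x y where "z = of_rat x + of_rat y * \<omega>" by (rule FE)
  then have "z = \<phi> (scale (x / of_int A) e1 + scale y e2)"
    using A_pos by (simp add: \<phi>_lin \<phi>_e of_rat_divide)
  then show "z \<in> range \<phi>" by blast
qed

lemma \<phi>_F: "\<phi> v \<in> F"
  using range_\<phi> by blast

text \<open>The polarized norm identity; the left side is twice the real part of conj(\<phi> x)
  \<phi> y.\<close>

lemma inner_\<phi>: "cnj (\<phi> x) * \<phi> y + \<phi> x * cnj (\<phi> y) = of_rat (2 * of_int A * B x y)"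
proof -
  obtain x1 x2 where x: "x = scale x1 e1 + scale x2 e2" by (rule coords)
  obtain y1 y2 where y: "y = scale y1 e1 + scale y2 e2" by (rule coords)
  have B_add': "B u (v + v') = B u v + B u v'" and B_scale': "B u (scale a v) = a * B u v" for u v v' a
    by (metis B_sym B_add, metis B_sym B_scale)
  have B21: "2 * B e2 e1 = of_int \<tau>" using B12 by (simp add: B_sym)
  have "2 * of_int A * B x y = of_int A * (x1 * y1 * (2 * B e1 e1) + x1 * y2 * (2 * B e1 e2)
      + x2 * y1 * (2 * B e2 e1) + x2 * y2 * (2 * B e2 e2))"
    unfolding x y by (simp add: B_add B_add' B_scale B_scale' algebra_simps)
  also have "\<dots> = 2 * x1 * y1 * of_int A * of_int A + (x1 * y2 + x2 * y1) * of_int A * of_int \<tau>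
      + 2 * x2 * y2 * of_int \<kappa>"
    unfolding B11 B12 B21 B22 kappa by (simp add: algebra_simps)
  finally have "of_rat (2 * of_int A * B x y) = (2 * of_rat x1 * of_rat y1 * of_int A * of_int A
      + (of_rat x1 * of_rat y2 + of_rat x2 * of_rat y1) * of_int A * of_int \<tau>
      + 2 * of_rat x2 * of_rat y2 * of_int \<kappa> :: complex)"
    by (simp add: of_rat_add of_rat_mult)
  moreover have "cnj (\<phi> x) * \<phi> y + \<phi> x * cnj (\<phi> y) = 2 * of_rat x1 * of_rat y1 * of_int A * of_int A
      + (of_rat x1 * of_rat y2 + of_rat x2 * of_rat y1) * of_int A * of_int \<tau>
      + 2 * of_rat x2 * of_rat y2 * (of_int \<tau> * \<omega> - \<omega> * \<omega>)"
    by (simp add: x y \<phi>_lin \<phi>_e cnj_of_rat cnj_om algebra_simps)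
  ultimately show ?thesis unfolding om2 by simp
qed

text \<open>The determinant as factor of the signed area, which frees it from the unspecified basis
  in \<open>endo_det\<close>.\<close>

lemma endo_det_area:
  assumes "\<And>x y. f (x + y) = f x + f y" "\<And>a x. f (scale a x) = scale a (f x)"
  shows "area (\<phi> (f x)) (\<phi> (f y)) = of_rat (endo_det scale UNIV f) * area (\<phi> x) (\<phi> y)"
proof -
  obtain u v p q r t where *: "UNIV = span {u, v}" "f u = scale p u + scale q v" "f v = scale r u + scale t v"
    "endo_det scale UNIV f = p * t - q * r"
    using endo_det_trace_2[OF basis, of f] by auto
  obtain a b where x: "x = scale a u + scale b v" using *(1) span_pair[of x u v] by blast
  obtain c d where y: "y = scale c u + scale d v" using *(1) span_pair[of y u v] by blast
  have f: "f (scale a u + scale b v) = scale a (f u) + scale b (f v)" for a b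
    by (simp only: assms)
  have "area (\<phi> (f x)) (\<phi> (f y)) = of_rat (a * d - b * c) * area (\<phi> (f u)) (\<phi> (f v))"
    unfolding x y f \<phi>_lin by (rule area_rat_lin)
  also have "area (\<phi> (f u)) (\<phi> (f v)) = of_rat (p * t - q * r) * area (\<phi> u) (\<phi> v)"
    unfolding *(2,3) \<phi>_lin by (rule area_rat_lin)
  also have "of_rat (a * d - b * c) * (of_rat (p * t - q * r) * area (\<phi> u) (\<phi> v))
      = of_rat (p * t - q * r) * (of_rat (a * d - b * c) * area (\<phi> u) (\<phi> v))" by simp
  also have "of_rat (a * d - b * c) * area (\<phi> u) (\<phi> v) = area (\<phi> x) (\<phi> y)"
    unfolding x y \<phi>_lin by (rule area_rat_lin[symmetric])
  finally show ?thesis unfolding *(4) .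
qed

text \<open>The number conj(\<phi> x) \<phi> y has real part A B(x, y) and imaginary part the signed
  area; an isometry of determinant 1 preserves both. Fixing x = e1 exhibits \<sigma> as a
  multiplication.\<close>

lemma special_orthogonal_is_mult:
  assumes "\<sigma> \<in> special_orthogonal_group scale B"
  shows "\<exists>u\<in>F - {0}. \<forall>x. \<phi> (\<sigma> x) = u * \<phi> x"
proof -
  have lin: "\<And>x y. \<sigma> (x + y) = \<sigma> x + \<sigma> y" "\<And>a x. \<sigma> (scale a x) = scale a (\<sigma> x)"
    and BB: "\<And>x y. B (\<sigma> x) (\<sigma> y) = B x y" and det: "endo_det scale UNIV \<sigma> = 1"
    using assms by (auto simp: special_orthogonal_group_def orthogonal_group_def Vector_Spaces.linear_iff)
  have eq: "cnj (\<phi> (\<sigma> x)) * \<phi> (\<sigma> y) = cnj (\<phi> x) * \<phi> y" for x y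
  proof (rule complex_eqI)
    have Re2: "Re (cnj z * w + z * cnj w) = 2 * Re (cnj z * w)" for z w by simp
    have "cnj (\<phi> (\<sigma> x)) * \<phi> (\<sigma> y) + \<phi> (\<sigma> x) * cnj (\<phi> (\<sigma> y)) = cnj (\<phi> x) * \<phi> y + \<phi> x * cnj (\<phi> y)"
      unfolding inner_\<phi> BB ..
    then have "2 * Re (cnj (\<phi> (\<sigma> x)) * \<phi> (\<sigma> y)) = 2 * Re (cnj (\<phi> x) * \<phi> y)"
      unfolding Re2[symmetric] by (simp only:)
    then show "Re (cnj (\<phi> (\<sigma> x)) * \<phi> (\<sigma> y)) = Re (cnj (\<phi> x) * \<phi> y)" by (simp only: mult_cancel_left) simp
    show "Im (cnj (\<phi> (\<sigma> x)) * \<phi> (\<sigma> y)) = Im (cnj (\<phi> x) * \<phi> y)"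
      using endo_det_area[of \<sigma> x y, OF lin] unfolding det area_def by simp
  qed
  let ?z = "\<phi> (\<sigma> e1)"
  have "cnj ?z * ?z \<noteq> 0" using eq[of e1 e1] A_pos by (simp add: \<phi>_e)
  then have z: "cnj ?z \<noteq> 0" by auto
  \<comment> \<open>The multiplier comes from \<open>eq\<close> with first argument e1, where \<phi>
    e1 = A.\<close>
  have "of_int A / cnj ?z \<in> F - {0}"
    using z A_pos by (auto intro!: F_divide F_int F_cnj \<phi>_F)
  moreover have "\<phi> (\<sigma> x) = of_int A / cnj ?z * \<phi> x" for x
    using eq[of e1 x] z by (simp add: \<phi>_e field_simps)
  ultimately show ?thesis by blast
qed

text \<open>The image of \<phi> is F, so multiplication by u pulls back to the space; modulus 1
  preserves the hermitian products and the areas, hence B and the determinant.\<close>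

lemma mult_is_special_orthogonal:
  assumes u: "u \<in> F" "cmod u = 1"
  shows "\<exists>\<sigma>\<in>special_orthogonal_group scale B. \<forall>x. \<phi> (\<sigma> x) = u * \<phi> x"
proof -
  define \<sigma> where "\<sigma> x = inv_into UNIV \<phi> (u * \<phi> x)" for x
  have \<sigma>: "\<phi> (\<sigma> x) = u * \<phi> x" for x
    unfolding \<sigma>_def using F_mult[OF u(1) \<phi>_F] range_\<phi> by (intro f_inv_into_f) blast
  have uu: "cnj u * u = 1" using complex_norm_square[of u] u(2) by (simp add: mult.commute)
  have add: "\<sigma> (x + y) = \<sigma> x + \<sigma> y" for x y
    by (rule injD[OF inj_\<phi>]) (simp add: \<sigma> \<phi>_add algebra_simps)
  have scl: "\<sigma> (scale a x) = scale a (\<sigma> x)" for a x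
    by (rule injD[OF inj_\<phi>]) (simp add: \<sigma> \<phi>_scale algebra_simps)
  have u0: "u \<noteq> 0" using u(2) by auto
  have "bij \<sigma>"
  proof (rule bijI)
    show "inj \<sigma>"
    proof (rule injI)
      fix x y assume "\<sigma> x = \<sigma> y"
      then have "u * \<phi> x = u * \<phi> y" by (simp flip: \<sigma>)
      then show "x = y" using u0 injD[OF inj_\<phi>] by simp
    qed
    show "surj \<sigma>"
    proof (rule surjI)
      fix y
      have "\<phi> y / u \<in> range \<phi>" unfolding range_\<phi> by (rule F_divide[OF \<phi>_F u(1)])
      then have "\<phi> (inv_into UNIV \<phi> (\<phi> y / u)) = \<phi> y / u" by (rule f_inv_into_f)
      then have "\<phi> (\<sigma> (inv_into UNIV \<phi> (\<phi> y / u))) = \<phi> y" using u0 by (simp add: \<sigma>)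
      then show "\<sigma> (inv_into UNIV \<phi> (\<phi> y / u)) = y" by (rule injD[OF inj_\<phi>])
    qed
  qed
  moreover have "B (\<sigma> x) (\<sigma> y) = B x y" for x y
  proof -
    have "cnj (\<phi> (\<sigma> x)) * \<phi> (\<sigma> y) + \<phi> (\<sigma> x) * cnj (\<phi> (\<sigma> y))
        = (cnj u * u) * (cnj (\<phi> x) * \<phi> y + \<phi> x * cnj (\<phi> y))"
      unfolding \<sigma> by (simp add: algebra_simps)
    then have "(of_rat (2 * of_int A * B (\<sigma> x) (\<sigma> y)) :: complex) = of_rat (2 * of_int A * B x y)"
      unfolding inner_\<phi> uu by simp
    then have "2 * of_int A * B (\<sigma> x) (\<sigma> y) = 2 * of_int A * B x y" unfolding of_rat_eq_iff .
    then show ?thesis using A_pos by simp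
  qed
  moreover have "endo_det scale UNIV \<sigma> = 1"
  proof -
    have "area (\<phi> e1) (\<phi> e2) = of_rat (endo_det scale UNIV \<sigma>) * area (\<phi> e1) (\<phi> e2)"
      using endo_det_area[of \<sigma> e1 e2, OF add scl] area_mult[of u "\<phi> e1" "\<phi> e2"] u(2) by (simp add: \<sigma>)
    then have "(of_rat (endo_det scale UNIV \<sigma>) :: real) = 1"
      using area_e by (simp add: \<phi>_e)
    then show ?thesis by simp
  qed
  moreover have "Vector_Spaces.linear scale scale \<sigma>"
    unfolding Vector_Spaces.linear_iff using add scl vector_space_axioms by blast
  ultimately have "\<sigma> \<in> special_orthogonal_group scale B"
    by (simp add: special_orthogonal_group_def orthogonal_group_def)
  then show ?thesis using \<sigma> by blast
qed

definition I :: "complex set" where "I = lat (of_int A) \<omega>"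

lemma \<phi>_int_span: "\<phi> ` int_span scale [u, v] = lat (\<phi> u) (\<phi> v)"
  unfolding int_span_pair lat_def image_image by (simp add: case_prod_unfold \<phi>_lin)

text \<open>Stability under \<omega> is the relation \<omega>^2 = \<tau> \<omega> - C A, whose
  constant term is a multiple of A. Commensurability follows because A R lies in I and I in
  R.\<close>

lemma fideal_I: "fideal I"
proof -
  have sg: "add_subgroup I" unfolding I_def by (rule add_subgroup_lat)
  have gens: "of_int A \<in> I" "\<omega> \<in> I" unfolding I_def by (rule lat_gens)+
  have om: "\<omega> * y \<in> I" if y: "y \<in> I" for y
  proof -
    obtain p q where pq: "y = of_int p * of_int A + of_int q * \<omega>"
      using y unfolding I_def by (rule latE)
    have "\<omega> * y = of_int (p * A) * \<omega> + of_int q * (\<omega> * \<omega>)" by (simp add: pq algebra_simps)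
    also have "\<dots> = of_int (- q * C) * of_int A + of_int (p * A + q * \<tau>) * \<omega>"
      unfolding om2 kappa by (simp add: algebra_simps)
    finally show ?thesis unfolding I_def by (simp only: lat_mem)
  qed
  have mult: "x * y \<in> I" if x: "x \<in> R" and "y \<in> I" for x y
  proof -
    obtain p q where "x = of_int p * 1 + of_int q * \<omega>" using x unfolding R_def by (rule latE)
    then have "x * y = of_int p * y + of_int q * (\<omega> * y)" by (simp add: algebra_simps)
    then show ?thesis
      using om[OF \<open>y \<in> I\<close>] \<open>y \<in> I\<close> by (simp only: add_subgroup_add[OF sg] add_subgroup_of_int_mult[OF sg])
  qed
  have "I \<subseteq> R" unfolding I_def by (rule lat_subset[OF add_subgroup_R R_int R_om])
  moreover have "of_int A * x \<in> I" if "x \<in> R" for x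
    using mult[OF that gens(1)] by (simp add: mult.commute)
  ultimately have "is_lat I"
    using sg A_pos R_mult[OF R_int] by (intro is_latI[of _ A]) auto
  then show ?thesis using mult by (simp add: fideal_def)
qed

lemma add_subgroup_int_span: "add_subgroup (int_span scale [u, v])"
proof -
  have "int_span scale [u, v] = (\<lambda>(p, q). scale (of_int p) u + scale (of_int q) v) ` (UNIV :: (int \<times> int) set)"
    by (rule int_span_pair)
  moreover have "add_subgroup \<dots>"
    by (rule add_subgroup_image) (auto simp: add_subgroup_def scale_left_distrib)
  ultimately show ?thesis by simp
qed

text \<open>A subgroup of finite index has a basis spanning the whole space and inherits integrality
  of the form from L, so the lattice conditions in \<open>sublattices\<close> hold
  automatically.\<close>

lemma bij_betw_sublattices:
  assumes L: "zlattice scale B L" "L = int_span scale [e1, e2]" and m: "m > 0"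
  shows "bij_betw ((`) \<phi>) (sublattices scale B L m) (subgroups_of I m)"
proof (rule bij_betw_imageI)
  have \<phi>L: "\<phi> ` L = I" unfolding L(2) \<phi>_int_span \<phi>_e I_def ..
  show "inj_on ((`) \<phi>) (sublattices scale B L m)"
    by (rule inj_onI) (simp add: inj_image_eq_iff[OF inj_\<phi>])
  show "(`) \<phi> ` sublattices scale B L m = subgroups_of I m"
  proof (intro equalityI subsetI)
    fix K' assume "K' \<in> (`) \<phi> ` sublattices scale B L m"
    then obtain K where K: "K' = \<phi> ` K" "zlattice scale B K" "K \<subseteq> L" "lattice_index L K = m"
      by (auto simp: sublattices_def)
    obtain e where e: "basis_of scale UNIV e" "K = int_span scale e"
      using K(2) by (auto simp: zlattice_def)
    have "length e = 2" using basis_of_length_eq[OF e(1) basis] by simp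
    then obtain u v where "e = [u, v]" using basis_of_length_2[OF e(1)] by blast
    then have "add_subgroup K" using e(2) add_subgroup_int_span by simp
    then have "add_subgroup K'" unfolding K(1) by (rule add_subgroup_image) (rule \<phi>_add)
    moreover have "K' \<subseteq> I" using K(1,3) \<phi>L by blast
    moreover have "lattice_index I K' = m"
      unfolding K(1) \<phi>L[symmetric] using lattice_index_image[of \<phi> L K, OF \<phi>_add inj_\<phi>] K(4) by simp
    ultimately show "K' \<in> subgroups_of I m" by (simp add: subgroups_of_def)
  next
    fix K' assume K': "K' \<in> subgroups_of I m"
    then have idx: "lattice_index I K' = m" "K' \<subseteq> I" by (auto simp: subgroups_of_def)
    have lK: "is_lat K'" by (rule subgroups_of_is_lat[OF fideal_is_lat[OF fideal_I] K' m])
    obtain \<gamma> \<delta> where g: "area \<gamma> \<delta> \<noteq> 0" "K' = lat \<gamma> \<delta>" using is_lat_basis[OF lK] by blast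
    have "\<gamma> \<in> range \<phi>" "\<delta> \<in> range \<phi>"
      using lat_gens[of \<gamma> \<delta>] lat_gens[of \<delta> \<gamma>] g(2) is_lat_subset_F[OF lK] range_\<phi> by auto
    then obtain u v where uv: "\<gamma> = \<phi> u" "\<delta> = \<phi> v" by blast
    define K where "K = int_span scale [u, v]"
    have \<phi>K: "\<phi> ` K = K'" unfolding K_def \<phi>_int_span g(2) uv ..
    \<comment> \<open>Independence over the rationals comes from independence over the reals, that
      is, from the nonzero area.\<close>
    have zero: "p = 0 \<and> q = 0" if "scale p u + scale q v = 0" for p q
    proof -
      have "of_rat p * \<gamma> + of_rat q * \<delta> = \<phi> (scale p u + scale q v)" by (simp add: \<phi>_lin uv)
      also have "\<dots> = \<phi> (scale 0 u + scale 0 v)" unfolding that by simp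
      finally have "of_real (of_rat p) * \<gamma> + of_real (of_rat q) * \<delta> = of_real 0 * \<gamma> + of_real 0 * \<delta>"
        by (simp add: \<phi>_lin \<phi>_0 of_real_of_rat)
      from lat_coord_unique[OF g(1) this] show ?thesis by simp
    qed
    have "u \<noteq> v" using zero[of 1 "- 1"] by auto
    moreover have "independent {u, v}"
    proof -
      have "v \<noteq> 0" using zero[of 0 1] by auto
      then have "independent {v}" by (auto simp: independent_insert independent_empty)
      moreover have "u \<notin> span {v}"
        using zero[of 1 "- k" for k] by (auto simp: span_singleton)
      ultimately show ?thesis using \<open>u \<noteq> v\<close> by (simp add: independent_insert)
    qed
    moreover have "span {u, v} = UNIV"
    proof -
      have "x \<in> span {u, v}" for x
      proof -
        obtain k :: int where k: "k > 0" "of_int k * \<phi> x \<in> R" using F_denominator[OF \<phi>_F] by blast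
        obtain l where l: "l > 0" "\<And>y. y \<in> R \<Longrightarrow> of_int l * y \<in> K'" using is_latE[OF lK] by blast
        have "of_int l * (of_int k * \<phi> x) \<in> lat \<gamma> \<delta>" using l(2)[OF k(2)] g(2) by simp
        then obtain p q where pq: "of_int l * (of_int k * \<phi> x) = of_int p * \<gamma> + of_int q * \<delta>" by (rule latE)
        have "\<phi> x = of_rat (of_int p / of_int (l * k)) * \<phi> u + of_rat (of_int q / of_int (l * k)) * \<phi> v"
          using pq k(1) l(1) uv by (simp add: of_rat_divide of_rat_mult field_simps)
        then have "\<phi> x = \<phi> (scale (of_int p / of_int (l * k)) u + scale (of_int q / of_int (l * k)) v)"
          by (simp only: \<phi>_lin)
        then have "x = scale (of_int p / of_int (l * k)) u + scale (of_int q / of_int (l * k)) v"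
          by (rule injD[OF inj_\<phi>])
        then show ?thesis unfolding span_pair by blast
      qed
      then show ?thesis by blast
    qed
    ultimately have "basis_of scale UNIV [u, v]" by (simp add: basis_of_pair)
    moreover have "K \<subseteq> L"
      using idx(2) unfolding \<phi>K[symmetric] \<phi>L[symmetric] by (simp add: inj_image_subset_iff[OF inj_\<phi>])
    moreover have "\<forall>x\<in>K. B x x \<in> \<int>" using \<open>K \<subseteq> L\<close> L(1) by (auto simp: zlattice_def)
    moreover have "lattice_index L K = m"
      using lattice_index_image[of \<phi> L K, OF \<phi>_add inj_\<phi>] idx(1) \<phi>K \<phi>L by simp
    ultimately have "K \<in> sublattices scale B L m"
      unfolding sublattices_def zlattice_def K_def by blast
    then show "K' \<in> (`) \<phi> ` sublattices scale B L m" using \<phi>K by blast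
  qed
qed

text \<open>Special isometries act as multiplications by elements of F. Conversely, a homothety
  between sublattices of the same index has modulus 1 by comparison of covolumes, so it comes from a
  special isometry.\<close>

lemma num_SL_classes_eq:
  assumes L: "zlattice scale B L" "L = int_span scale [e1, e2]" and m: "m > 0"
  shows "num_SL_classes scale B L m = card (hclass ` subgroups_of I m)"
proof -
  let ?S = "sublattices scale B L m"
  note bij = bij_betw_sublattices[OF L m]
  have mem: "\<phi> ` K \<in> subgroups_of I m" if "K \<in> ?S" for K
    using bij that unfolding bij_betw_def by blast
  have iff: "(\<exists>\<sigma>\<in>special_orthogonal_group scale B. \<sigma> ` K1 = K2) \<longleftrightarrow> hclass (\<phi> ` K1) = hclass (\<phi> ` K2)"
    if K: "K1 \<in> ?S" "K2 \<in> ?S" for K1 K2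
  proof
    assume "\<exists>\<sigma>\<in>special_orthogonal_group scale B. \<sigma> ` K1 = K2"
    then obtain \<sigma> where \<sigma>: "\<sigma> \<in> special_orthogonal_group scale B" "\<sigma> ` K1 = K2" by blast
    obtain u where u: "u \<in> F - {0}" "\<And>x. \<phi> (\<sigma> x) = u * \<phi> x"
      using special_orthogonal_is_mult[OF \<sigma>(1)] by blast
    have "\<phi> ` K2 = (*) u ` \<phi> ` K1"
      unfolding \<sigma>(2)[symmetric] image_image u(2) ..
    then show "hclass (\<phi> ` K1) = hclass (\<phi> ` K2)"
      unfolding hclass_eq_iff using u(1) by (intro bexI[of _ u])
  next
    assume "hclass (\<phi> ` K1) = hclass (\<phi> ` K2)"
    then obtain u where u: "u \<in> F - {0}" "\<phi> ` K2 = (*) u ` \<phi> ` K1"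
      unfolding hclass_eq_iff by (rule bexE)
    have "nu ((*) u ` \<phi> ` K1) = nu (\<phi> ` K1)"
      unfolding u(2)[symmetric] by (rule subgroups_of_scale_nu[OF fideal_is_lat[OF fideal_I] mem[OF K(2)] mem[OF K(1)] m])
    then have "cmod u = 1"
      using scale_norm_1 subgroups_of_is_lat[OF fideal_is_lat[OF fideal_I] mem[OF K(1)] m] u(1) by simp
    then obtain \<sigma> where \<sigma>: "\<sigma> \<in> special_orthogonal_group scale B" "\<And>x. \<phi> (\<sigma> x) = u * \<phi> x"
      using mult_is_special_orthogonal[of u] u(1) by auto
    have "\<phi> ` \<sigma> ` K1 = \<phi> ` K2"
      unfolding u(2) image_image \<sigma>(2) ..
    then have "\<sigma> ` K1 = K2" by (simp add: inj_image_eq_iff[OF inj_\<phi>])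
    then show "\<exists>\<sigma>\<in>special_orthogonal_group scale B. \<sigma> ` K1 = K2" using \<sigma>(1) by blast
  qed
  have "num_SL_classes scale B L m = card ((\<lambda>K. hclass (\<phi> ` K)) ` ?S)"
    unfolding num_SL_classes_def by (rule card_quotient_kernel) (rule iff)
  also have "(\<lambda>K. hclass (\<phi> ` K)) ` ?S = hclass ` subgroups_of I m"
    using bij unfolding bij_betw_def by (metis image_image)
  finally show ?thesis .
qed

lemma zeta_SL_eq:
  assumes L: "zlattice scale B L" "L = int_span scale [e1, e2]"
  shows "zeta_SL scale B L = dirichlet (\<lambda>m. of_nat (card (hclass ` subgroups_of I m)))"
  by (rule ds_eqI) (simp add: zeta_SL_def ds_coeff_dirichlet num_SL_classes_eq[OF L])

end

theorem theorem1p1: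
  fixes scale :: "rat \<Rightarrow> 'v::ab_group_add \<Rightarrow> 'v"
    and B :: "'v \<Rightarrow> 'v \<Rightarrow> rat"
    and L :: "'v set"
    and e :: "'v list"
    and d\<^sub>L :: rat
    and F :: "complex set"
    and w :: nat
  assumes "pos_def_quadratic_space scale B"
    and "zlattice scale B L"
    and "basis_of scale UNIV e" and "L = int_span scale e"
    and "length e = 2"
    and "d\<^sub>L = gram_det B e"
    and "F = quadratic_field (- 4 * d\<^sub>L)"
    and "is_field_discriminant F (- 4 * d\<^sub>L)"
    and "w = unit_count F"
  shows "zeta_SL scale B L =
      ds_const (2 / of_nat w) * (zeta * ds_shift1 zeta / dedekind_zeta F) * ideal_class_series F
    + ds_const ((of_nat w - 2) / of_nat w)
        * ds_infprod (\<lambda>p. 1 - ds_npow p) {p. prime p \<and> splits_in p F} * dedekind_zeta F"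
proof -
  interpret V: pos_def_quadratic_space scale B by fact
  interpret V: rat_vector_space scale by unfold_locales
  obtain e1 e2 where e: "e = [e1, e2]" "e1 \<noteq> e2" "V.independent {e1, e2}" "V.span {e1, e2} = UNIV"
    using V.basis_of_length_2[OF assms(3,5)] by blast
  have B_add': "B u (v + v') = B u v + B u v'" and B_scale': "B u (scale a v) = a * B u v" for u v v' a
    by (metis V.B_sym V.B_add, metis V.B_sym V.B_scale)
  have L: "L = int_span scale [e1, e2]" using assms(4) e(1) by simp
  have comb: "scale (of_int p) e1 + scale (of_int q) e2 \<in> L" for p q :: int
    unfolding L V.int_span_pair by auto
  have "e1 \<in> L" "e2 \<in> L" "e1 + e2 \<in> L"
    using comb[of 1 0] comb[of 0 1] comb[of 1 1] by simp_all
  then have ints: "B e1 e1 \<in> \<int>" "B e2 e2 \<in> \<int>" "B (e1 + e2) (e1 + e2) \<in> \<int>"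
    using assms(2) by (auto simp: zlattice_def)
  obtain A C :: int where AC: "B e1 e1 = of_int A" "B e2 e2 = of_int C"
    using ints(1,2) by (auto elim!: Ints_cases)
  \<comment> \<open>Polarization gives integrality of 2 B(e1, e2) = b, while B(e1, e2) may be a
    half-integer; this is why -4 d_L = b^2 - 4 A C is the integral quantity.\<close>
  have "2 * B e1 e2 = B (e1 + e2) (e1 + e2) - B e1 e1 - B e2 e2"
    by (simp add: V.B_add B_add' V.B_sym[of e2 e1])
  then have "2 * B e1 e2 \<in> \<int>" using ints by simp
  then obtain b :: int where b: "2 * B e1 e2 = of_int b" by (auto elim!: Ints_cases)
  have ne: "e1 \<noteq> 0" using e(3) V.dependent_zero[of "{e1, e2}"] by auto
  have A_pos: "A > 0" using V.B_pos[OF ne] AC by simp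
  have d: "d\<^sub>L = of_int A * of_int C - B e1 e2 * B e1 e2"
  proof -
    have l2: "length [e1, e2] = 2" by simp
    show ?thesis
      using assms(6) unfolding e(1) gram_det_def l2 det_mat2 by (simp add: AC V.B_sym[of e2 e1])
  qed
  have "- 4 * d\<^sub>L = (2 * B e1 e2) * (2 * B e1 e2) - 4 * (of_int A * of_int C)"
    unfolding d by (simp add: algebra_simps)
  then have D: "- 4 * d\<^sub>L = of_int (b * b - 4 * (A * C))" unfolding b by simp
  have "- 4 * d\<^sub>L < 0"
  proof -
    \<comment> \<open>-A times the component of e2 orthogonal to e1. The form takes the value A d_L
      on it, which gives d_L > 0.\<close>
    let ?v = "scale (B e1 e2) e1 + scale (- of_int A) e2"
    have "?v \<noteq> 0"
    proof
      assume "?v = 0"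
      then have "scale (of_int A) e2 = scale (B e1 e2) e1" by simp
      then have "e2 = scale (B e1 e2 / of_int A) e1"
        using A_pos V.scale_scale[of "inverse (of_int A)" "of_int A" e2]
        by (simp add: divide_inverse mult.commute)
      then have "e2 \<in> V.span {e1}" unfolding V.span_singleton by blast
      then have "V.dependent {e1, e2}"
        using e(2) by (metis V.independent_insert insert_commute singletonD)
      then show False using e(3) by blast
    qed
    then have "0 < B ?v ?v" by (rule V.B_pos)
    also have "B (scale p e1 + scale q e2) (scale p e1 + scale q e2)
        = p * p * of_int A + 2 * p * q * B e1 e2 + q * q * of_int C" for p q
      by (simp add: V.B_add B_add' V.B_scale B_scale' AC V.B_sym[of e2 e1] algebra_simps)
    also have "B e1 e2 * B e1 e2 * of_int A + 2 * B e1 e2 * (- of_int A) * B e1 e2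
        + - of_int A * - of_int A * of_int C = of_int A * d\<^sub>L"
      unfolding d by (simp add: algebra_simps)
    finally have "d\<^sub>L > 0" using A_pos by (simp add: zero_less_mult_iff)
    then show ?thesis by simp
  qed
  then interpret D: quadratic_discriminant "- 4 * d\<^sub>L" by unfold_locales
  \<comment> \<open>The root of X^2 - b X + A C in the upper half plane.\<close>
  define \<omega> where "\<omega> = (of_int b + D.s) / 2"
  note R = D.ring_of_integers_eq[OF assms(8)[unfolded assms(7)] D \<omega>_def]
  note FF = D.quadratic_field_eq[OF \<omega>_def]
  interpret Q: binary_lattice scale B \<omega> b "A * C" e1 e2 A C
  proof unfold_locales
    show "Im \<omega> \<noteq> 0" "\<omega> * \<omega> = of_int b * \<omega> - of_int (A * C)" by (fact R)+
    show "of_rat x + of_rat y * \<omega> \<in> lat 1 \<omega>" if "algebraic_int (of_rat x + of_rat y * \<omega>)" for x y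
      unfolding R(1)[symmetric] ring_of_integers_def FF using that by auto
    show "basis_of scale UNIV [e1, e2]" using assms(3) e(1) by simp
  qed (use AC A_pos b in auto)
  have F: "F = imag_quadratic.F \<omega>"
    using FF assms(7) by (simp add: Q.F_def)
  show ?thesis
    unfolding Q.zeta_SL_eq[OF assms(2) L] F
    by (rule Q.classes_series_eq[OF Q.fideal_I]) (use assms(9) F in simp)
qed

end
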